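(* Suppose $R$ is Cohen-Macaulay. The following statements are equivalent: (a) $\mathrm{Ap}(S,E)$ has $1+\mathrm{codim}(R)$ elements; (b) $(\mathbf{x}^{\mathbf{a}_1},\dots,\mathbf{x}^{\mathbf{a}_d})$ is a reduction ideal of $\mathfrak{m}$ and $R$ is of minimal multiplicity, i.e. $e(R)=1+\mathrm{codim}(R)$; (c) $(\mathbf{x}^{\mathbf{a}_1},\dots,\mathbf{x}^{\mathbf{a}_d})\,\mathfrak{m}=\mathfrak{m}^2$.
   Context: Let $d\ge 1$, let $\mathbb{N}$ be the set of non-negative integers, and let $S\subseteq\mathbb{N}^d$ be an affine (finitely generated) semigroup containing $\mathbf 0$, fully embedded in $\mathbb{N}^d$ (i.e. of dimension $d$: $S$ spans $\mathbb{R}^d$), and simplicial: the cone $\mathrm{cone}(S)\subseteq\mathbb{R}^d_{\ge0}$ of non-negative real combinations of elements of $S$ has exactly $d$ extremal rays. Its minimal generating set is $\{\mathbf{a}_1,\dots,\mathbf{a}_{d+s}\}$, where $\mathbf{a}_1,\dots,\mathbf{a}_d$ are the extremal rays of $S$, i.e. the smallest nonzero elements of $S$ lying on each of the $d$ extremal rays of the cone. Put $E=\{\mathbf{a}_1,\dots,\mathbf{a}_d\}$ and $\mathrm{Ap}(S,E)=\{\mathbf{a}\in S : \mathbf{a}-\mathbf{a}_i\notin S \text{ for } i=1,\dots,d\}$. Let $\mathbb{K}$ be a field. For $\mathbf a=(a_1,\dots,a_d)\in\mathbb{N}^d$ put $\mathbf{x}^{\mathbf{a}}=x_1^{a_1}\cdots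 x_d^{a_d}$. Let $R=\mathbb{K}[S]=\mathbb{K}[\mathbf{x}^{\mathbf{a}_1},\dots,\mathbf{x}^{\mathbf{a}_{d+s}}]\subseteq\mathbb{K}[x_1,\dots,x_d]$ (of Krull dimension $d$) and $\mathfrak{m}=(\mathbf{x}^{\mathbf{a}_1},\dots,\mathbf{x}^{\mathbf{a}_{d+s}})$. Here $\mathrm{codim}(R)$ is the embedding dimension $d+s$ minus $\dim R=d$, so $\mathrm{codim}(R)=s$. An ideal $J\subseteq\mathfrak{m}$ of $R$ is a reduction ideal of $\mathfrak{m}$ if $\mathfrak{m}^{n+1}=J\mathfrak{m}^n$ for $n\gg0$. The multiplicity of $R$ is $e(R)=e(\mathfrak{m})=\lim_{n\to\infty}\frac{d!}{n^d}\lambda_R(R/\mathfrak{m}^n)$, where $\lambda_R$ denotes length. *)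

theory Defs
  imports
    "HOL-Analysis.Analysis"
    "HOL-Library.Poly_Mapping"
    "HOL-Library.Extended_Nat"
    "HOL-Algebra.Module"
    "HOL-Algebra.QuotRing"
    "HOL-Algebra.Ideal_Product"
    "HOL-Algebra.Ring_Divisibility"
begin

section \<open>Commutative algebra\<close>

text \<open>Dimensions, heights, depths and lengths are suprema in \<^typ>\<open>enat\<close>, so they make sense
  (possibly with value infinity) for every ring.\<close>

definition prime_chain :: "('a, 'b) ring_scheme \<Rightarrow> nat \<Rightarrow> (nat \<Rightarrow> 'a set) \<Rightarrow> bool" where
  "prime_chain R n P \<longleftrightarrow> (\<forall>i\<le>n. primeideal (P i) R) \<and> (\<forall>i<n. P i \<subset> P (Suc i))"

definition krull_dim :: "('a, 'b) ring_scheme \<Rightarrow> enat" where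
  "krull_dim R = (SUP n\<in>{n. \<exists>P. prime_chain R n P}. enat n)"

definition height :: "('a, 'b) ring_scheme \<Rightarrow> 'a set \<Rightarrow> enat" where
  "height R Q = (SUP n\<in>{n. \<exists>P. prime_chain R n P \<and> P n = Q}. enat n)"

definition regular_sequence :: "('a, 'b) ring_scheme \<Rightarrow> 'a list \<Rightarrow> bool" where
  "regular_sequence R xs \<longleftrightarrow>
     set xs \<subseteq> carrier R \<and>
     (\<forall>i<length xs. \<forall>r\<in>carrier R.
        xs ! i \<otimes>\<^bsub>R\<^esub> r \<in> Idl\<^bsub>R\<^esub> (set (take i xs)) \<longrightarrow> r \<in> Idl\<^bsub>R\<^esub> (set (take i xs))) \<and>
     Idl\<^bsub>R\<^esub> (set xs) \<noteq> carrier R"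

definition depth :: "('a, 'b) ring_scheme \<Rightarrow> 'a set \<Rightarrow> enat" where
  "depth R I = (SUP xs\<in>{xs. set xs \<subseteq> I \<and> regular_sequence R xs}. enat (length xs))"

text \<open>Eisenbud's definition (Commutative Algebra, Section 18.2): a Noetherian ring is
  Cohen-Macaulay if the depth of every maximal ideal equals its codimension (height).\<close>

definition cohen_macaulay :: "('a, 'b) ring_scheme \<Rightarrow> bool" where
  "cohen_macaulay R \<longleftrightarrow>
     cring R \<and> noetherian_ring R \<and> (\<forall>M. maximalideal M R \<longrightarrow> depth R M = height R M)"

definition module_length :: "('a, 'b) ring_scheme \<Rightarrow> ('a, 'c) module \<Rightarrow> enat" where
  "module_length R M =
     (SUP n\<in>{n. \<exists>N. (\<forall>i\<le>n. submodule (N i) R M) \<and> (\<forall>i<n. N i \<subset> N (Suc i))}. enat n)"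

definition quotient_module :: "('a, 'b) ring_scheme \<Rightarrow> 'a set \<Rightarrow> ('a, 'a set) module" where
  "quotient_module R I =
     ring.extend (R Quot I)
       (module.fields (\<lambda>r X. (I +>\<^bsub>R\<^esub> r) \<otimes>\<^bsub>R Quot I\<^esub> X))"

abbreviation ideal_power :: "('a, 'b) ring_scheme \<Rightarrow> 'a set \<Rightarrow> nat \<Rightarrow> 'a set" where
  "ideal_power R I n \<equiv> I [^]\<^bsub>ideals_set R\<^esub> n"

definition reduction_ideal :: "('a, 'b) ring_scheme \<Rightarrow> 'a set \<Rightarrow> 'a set \<Rightarrow> bool" where
  "reduction_ideal R J I \<longleftrightarrow>
     ideal J R \<and> J \<subseteq> I \<and>
     (\<exists>n0. \<forall>n\<ge>n0. ideal_power R I (Suc n) = J \<cdot>\<^bsub>R\<^esub> ideal_power R I n)"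

text \<open>The next three notions are meant for a ring \<open>R\<close> of finite Krull dimension with a
  distinguished maximal ideal \<open>m\<close> such that all \<open>R/m\<^sup>n\<close> have finite length (a local ring, or
  a positively graded algebra over a field).\<close>

definition ring_multiplicity :: "('a, 'b) ring_scheme \<Rightarrow> 'a set \<Rightarrow> real" where
  "ring_multiplicity R m =
     (let d = the_enat (krull_dim R) in
      lim (\<lambda>n. fact d / real n ^ d *
               real (the_enat (module_length R (quotient_module R (ideal_power R m n))))))"

definition embedding_dim :: "('a, 'b) ring_scheme \<Rightarrow> 'a set \<Rightarrow> nat" where
  "embedding_dim R m =
     (LEAST n. \<exists>A. A \<subseteq> carrier R \<and> finite A \<and> card A = n \<and> Idl\<^bsub>R\<^esub> A = m)"

definition codim :: "('a, 'b) ring_scheme \<Rightarrow> 'a set \<Rightarrow> nat" where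
  "codim R m = embedding_dim R m - the_enat (krull_dim R)"


section \<open>Simplicial affine semigroups\<close>

inductive_set generated_monoid :: "'a::comm_monoid_add set \<Rightarrow> 'a set" for A where
  zero: "0 \<in> generated_monoid A"
| add: "a \<in> A \<Longrightarrow> b \<in> generated_monoid A \<Longrightarrow> a + b \<in> generated_monoid A"

definition affine_semigroup :: "(nat ^ 'd) set \<Rightarrow> bool" where
  "affine_semigroup S \<longleftrightarrow> (\<exists>A. finite A \<and> S = generated_monoid A)"

definition minimal_generating_set :: "(nat ^ 'd) set \<Rightarrow> (nat ^ 'd) set \<Rightarrow> bool" where
  "minimal_generating_set A S \<longleftrightarrow>
     generated_monoid A = S \<and> (\<forall>B. B \<subset> A \<longrightarrow> generated_monoid B \<noteq> S)"

definition real_vec :: "nat ^ 'd \<Rightarrow> real ^ 'd" where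
  "real_vec a = (\<chi> i. real (a $ i))"

definition semigroup_cone :: "(nat ^ 'd) set \<Rightarrow> (real ^ 'd) set" where
  "semigroup_cone S = convex_cone hull (real_vec ` S)"

text \<open>The cone is pointed, being contained in the non-negative orthant, so its one-dimensional
  faces are half-lines emanating from the origin.\<close>

definition extremal_rays :: "(nat ^ 'd) set \<Rightarrow> (real ^ 'd) set set" where
  "extremal_rays S = {F. F face_of semigroup_cone S \<and> aff_dim F = 1}"

definition fully_embedded :: "(nat ^ 'd) set \<Rightarrow> bool" where
  "fully_embedded S \<longleftrightarrow> span (real_vec ` S) = UNIV"

definition simplicial :: "(nat ^ 'd) set \<Rightarrow> bool" where
  "simplicial S \<longleftrightarrow> finite (extremal_rays S) \<and> card (extremal_rays S) = CARD('d)"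

text \<open>Elements of \<open>S\<close> on a common ray are comparable in the componentwise order.\<close>

definition extremal_elements :: "(nat ^ 'd) set \<Rightarrow> (nat ^ 'd) set" where
  "extremal_elements S =
     {e \<in> S. e \<noteq> 0 \<and> (\<exists>F\<in>extremal_rays S. real_vec e \<in> F \<and>
        (\<forall>b\<in>S. b \<noteq> 0 \<longrightarrow> real_vec b \<in> F \<longrightarrow> e \<le> b))}"

text \<open>Subtraction on \<^typ>\<open>nat\<close> truncates, so \<open>a - e \<notin> S\<close>, meant in the integers, is expressed
  additively.\<close>

definition apery_set :: "(nat ^ 'd) set \<Rightarrow> (nat ^ 'd) set \<Rightarrow> (nat ^ 'd) set" where
  "apery_set S E = {a \<in> S. \<forall>e\<in>E. \<not> (\<exists>b\<in>S. a = b + e)}"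


section \<open>Semigroup rings\<close>

text \<open>The polynomial ring in variables indexed by \<open>'d\<close> over a field \<open>'k\<close> is
  \<^typ>\<open>nat ^ 'd \<Rightarrow>\<^sub>0 'k\<close>, with convolution as multiplication; the semigroup ring is its subring
  of polynomials all of whose exponents lie in \<open>S\<close>.\<close>

definition semigroup_ring :: "(nat ^ 'd) set \<Rightarrow> (nat ^ 'd \<Rightarrow>\<^sub>0 'k::field) ring" where
  "semigroup_ring S =
     \<lparr>carrier = {p. Poly_Mapping.keys p \<subseteq> S}, mult = (*), one = 1, zero = 0, add = (+)\<rparr>"

definition monomial_ideal :: "(nat ^ 'd) set \<Rightarrow> (nat ^ 'd) set \<Rightarrow> (nat ^ 'd \<Rightarrow>\<^sub>0 'k::field) set" where
  "monomial_ideal S A = Idl\<^bsub>semigroup_ring S\<^esub> ((\<lambda>a. Poly_Mapping.single a 1) ` A)"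

end

theory Submission
  imports Defs "HOL-Real_Asymp.Real_Asymp"
begin

text \<open>Write \<open>x\<^sup>b\<close> for the monomial with exponent \<open>b\<close> and \<open>S\<^sub>+\<close> for the set of nonzero elements of \<open>S\<close>. All
ideals in the statement are spanned by monomials: \<open>m\<close> by those with exponent in \<open>S\<^sub>+\<close>, \<open>J\<close> by those
with exponent in \<open>E + S\<close>, and products of ideals correspond to sums of sets of exponents.

The equivalence of the first and the third condition is combinatorial. The embedding dimension of
the ring is the number of minimal generators (\<open>embedding_dim_eq\<close>) and its Krull dimension is the
number \<open>d\<close> of variables (\<open>krull_dim_eq\<close>), so its codimension is the number of generators outside \<open>E\<close>.
These generators and \<open>0\<close> always belong to the Apery set; that there is nothing else in it means that
every sum of two elements of \<open>S\<^sub>+\<close> lies in \<open>E + S\<close>, which is the equality \<open>J m = m\<^sup>2\<close>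
(\<open>Ap_minimal_iff\<close>). This equality implies inductively that \<open>J\<close> is a reduction of \<open>m\<close>. Everything
else follows from the formula \<open>e(R) = card (Ap(S, E))\<close>, valid if \<open>J\<close> is a reduction of \<open>m\<close>
and the ring is Cohen-Macaulay (\<open>multiplicity_eq_card_Ap\<close>).

To prove this formula, note that each element of \<open>S\<close> is \<open>w + \<Sum>e\<in>E. f e * e\<close> with \<open>w\<close> in the Apery
set and natural numbers \<open>f e\<close>. If this representation is unique, there are
\<open>card (Ap(S, E)) * (n - 1 + d choose d)\<close> exponents outside the \<open>n\<close>-th power of \<open>J\<close>, and this is the
length of \<open>R/J\<^sup>n\<close>. As \<open>J\<^sup>n \<subseteq> m\<^sup>n \<subseteq> J\<^bsup>n - k\<^esup>\<close> with a constant \<open>k\<close>, the length of \<open>R/m\<^sup>n\<close> grows in the same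
way.

Uniqueness is where the Cohen-Macaulay property enters. It follows from the exchange property that
\<open>b + e' = c + e\<close> with \<open>b, c \<in> S\<close> and different \<open>e, e' \<in> E\<close> implies \<open>b - e \<in> S\<close>
(\<open>decomposition_unique\<close>). Multiplication by \<open>x\<^bsup>b - e\<^esup>\<close> maps the ideal \<open>I = (x\<^sup>e, x\<^bsup>e'\<^esup>)\<close> to \<open>R\<close>, and the
property says that this map is the multiplication by an element of \<open>R\<close>: the class of the map in
\<open>Ext\<^sup>1(R/I, R)\<close> has to vanish. Since \<open>R/I\<close> has dimension at most \<open>d - 2\<close> and \<open>m\<close> contains a regular
sequence of length \<open>d\<close>, this is a case of the theorem of Ischebeck that
\<open>Ext\<^sup>i(N, R) = 0\<close> for \<open>i < depth R - dim N\<close>. For \<open>i = 0\<close> and \<open>i = 1\<close> the theorem is proved here directly in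
terms of elements and homomorphisms of ideals (\<open>hom_vanishing\<close>, \<open>ext_vanishing\<close>). The rings are not
local, so these statements hold up to multipliers outside \<open>m\<close>.

Two more ingredients are needed. The dimension of \<open>R/I\<close> is bounded by counting monomials: elements
taken from the steps of a chain of primes are algebraically independent, while few monomials survive
in the quotient (\<open>prime_chain_independent\<close>, \<open>dim_below_outside\<close>); the faces of the cone provide a chain
of primes of length \<open>d\<close> below \<open>m\<close> (\<open>face_chain\<close>). The convex geometry reduces to the facts that the
vectors in \<open>E\<close> form a basis, that the elements of \<open>S\<close> have non-negative coordinates in it, and that each
element of \<open>S\<close> has a positive multiple with integral coordinates (\<open>simplicial_coordinates\<close>).\<close>

section \<open>Ideals of subrings\<close>

text \<open>Elements are computed with in the ambient commutative ring; only the carrier varies.\<close>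

definition ring_on :: "'a::comm_ring_1 set \<Rightarrow> 'a ring" where
  "ring_on B = \<lparr>carrier = B, mult = (*), one = 1, zero = 0, add = (+)\<rparr>"

lemma ring_on_simps [simp]:
  "carrier (ring_on B) = B" "mult (ring_on B) = (*)" "one (ring_on B) = 1"
  "zero (ring_on B) = 0" "add (ring_on B) = (+)"
  by (simp_all add: ring_on_def)

locale unital_subring =
  fixes B :: "'a::comm_ring_1 set"
  assumes one_mem [simp, intro]: "1 \<in> B"
    and add_mem [simp, intro]: "x \<in> B \<Longrightarrow> y \<in> B \<Longrightarrow> x + y \<in> B"
    and uminus_mem [simp, intro]: "x \<in> B \<Longrightarrow> - x \<in> B"
    and mult_mem [simp, intro]: "x \<in> B \<Longrightarrow> y \<in> B \<Longrightarrow> x * y \<in> B"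
begin

abbreviation R where "R \<equiv> ring_on B"

lemma diff_mem [simp, intro]: "x \<in> B \<Longrightarrow> y \<in> B \<Longrightarrow> x - y \<in> B"
  by (metis add_mem uminus_mem diff_conv_add_uminus)

lemma zero_mem [simp, intro]: "0 \<in> B"
  using diff_mem[OF one_mem one_mem] by simp

lemma cring: "cring R"
proof (rule cringI)
  show "abelian_group R"
    by (rule abelian_groupI) (auto simp: algebra_simps intro: bexI[of _ "- _"])
  show "comm_monoid R"
    by (rule comm_monoidI) (auto simp: algebra_simps)
qed (auto simp: algebra_simps)

lemma ring: "ring R"
  using cring by (simp add: cring.axioms(1))

lemma ideal_iff:
  "ideal I R \<longleftrightarrow> I \<subseteq> B \<and> 0 \<in> I \<and> (\<forall>x\<in>I. \<forall>y\<in>I. x + y \<in> I) \<and> (\<forall>r\<in>B. \<forall>x\<in>I. r * x \<in> I)"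
proof
  assume I: "ideal I R"
  note sub = ideal.axioms(1)[OF I]
  show "I \<subseteq> B \<and> 0 \<in> I \<and> (\<forall>x\<in>I. \<forall>y\<in>I. x + y \<in> I) \<and> (\<forall>r\<in>B. \<forall>x\<in>I. r * x \<in> I)"
    using additive_subgroup.a_subset[OF sub] additive_subgroup.zero_closed[OF sub]
      additive_subgroup.a_closed[OF sub] ideal.I_l_closed[OF I] by simp
next
  assume I: "I \<subseteq> B \<and> 0 \<in> I \<and> (\<forall>x\<in>I. \<forall>y\<in>I. x + y \<in> I) \<and> (\<forall>r\<in>B. \<forall>x\<in>I. r * x \<in> I)"
  have inv: "inv\<^bsub>add_monoid R\<^esub> x = - x" if "x \<in> I" for x
  proof -
    interpret cring R by (rule cring)
    have "\<ominus>\<^bsub>R\<^esub> x = - x"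
      using that I by (intro minus_equality) (auto)
    then show ?thesis by (simp add: a_inv_def)
  qed
  have neg: "- x \<in> I" if "x \<in> I" for x
  proof -
    have "(- 1) * x \<in> I" using I that by blast
    then show ?thesis by simp
  qed
  show "ideal I R"
  proof (rule idealI[OF ring])
    show "subgroup I (add_monoid R)"
      unfolding subgroup_def using I inv neg by auto
    show "x \<otimes>\<^bsub>R\<^esub> y \<in> I" "y \<otimes>\<^bsub>R\<^esub> x \<in> I" if "y \<in> I" "x \<in> carrier R" for x y
      using I that by (simp_all add: mult.commute[of y x])
  qed
qed

lemma idealD:
  assumes "ideal I R"
  shows "I \<subseteq> B" "0 \<in> I" "\<And>x y. x \<in> I \<Longrightarrow> y \<in> I \<Longrightarrow> x + y \<in> I" "\<And>x. x \<in> I \<Longrightarrow> - x \<in> I"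
    "\<And>x y. x \<in> I \<Longrightarrow> y \<in> I \<Longrightarrow> x - y \<in> I"
    "\<And>r x. r \<in> B \<Longrightarrow> x \<in> I \<Longrightarrow> r * x \<in> I" "\<And>r x. r \<in> B \<Longrightarrow> x \<in> I \<Longrightarrow> x * r \<in> I"
proof -
  show 1: "I \<subseteq> B" "0 \<in> I" "\<And>x y. x \<in> I \<Longrightarrow> y \<in> I \<Longrightarrow> x + y \<in> I"
    and 2: "\<And>r x. r \<in> B \<Longrightarrow> x \<in> I \<Longrightarrow> r * x \<in> I"
    using assms unfolding ideal_iff by blast+
  show "\<And>r x. r \<in> B \<Longrightarrow> x \<in> I \<Longrightarrow> x * r \<in> I"
    using 2 by (simp add: mult.commute)
  show 3: "- x \<in> I" if "x \<in> I" for x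
    using 2[of "- 1" x] that by simp
  show "x - y \<in> I" if "x \<in> I" "y \<in> I" for x y
    using 1(3)[OF that(1) 3[OF that(2)]] by simp
qed

lemma primeideal_iff:
  "primeideal P R \<longleftrightarrow> ideal P R \<and> P \<noteq> B \<and> (\<forall>a\<in>B. \<forall>b\<in>B. a * b \<in> P \<longrightarrow> a \<in> P \<or> b \<in> P)"
proof
  assume "primeideal P R"
  then interpret P: primeideal P R .
  show "ideal P R \<and> P \<noteq> B \<and> (\<forall>a\<in>B. \<forall>b\<in>B. a * b \<in> P \<longrightarrow> a \<in> P \<or> b \<in> P)"
    using P.I_notcarr P.I_prime P.is_ideal by auto
next
  assume P: "ideal P R \<and> P \<noteq> B \<and> (\<forall>a\<in>B. \<forall>b\<in>B. a * b \<in> P \<longrightarrow> a \<in> P \<or> b \<in> P)"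
  show "primeideal P R"
    by (rule primeidealI[OF _ cring]) (use P in \<open>simp_all add: eq_commute\<close>)
qed

lemma primeideal_one: "primeideal P R \<Longrightarrow> 1 \<notin> P"
  by (metis primeideal_iff ideal_iff mult.right_neutral subset_antisym subsetI)

lemma genideal_ideal: "G \<subseteq> B \<Longrightarrow> ideal (Idl\<^bsub>R\<^esub> G) R"
  using ring.genideal_ideal[OF ring] by simp

lemma genideal_least: "ideal I R \<Longrightarrow> G \<subseteq> I \<Longrightarrow> Idl\<^bsub>R\<^esub> G \<subseteq> I"
  unfolding genideal_def by blast

lemma genideal_self: "G \<subseteq> B \<Longrightarrow> G \<subseteq> Idl\<^bsub>R\<^esub> G"
  unfolding genideal_def by blast

definition adjoin :: "'a set \<Rightarrow> 'a \<Rightarrow> 'a set" where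
  "adjoin I f = {i + r * f | i r. i \<in> I \<and> r \<in> B}"

definition colon :: "'a set \<Rightarrow> 'a \<Rightarrow> 'a set" where
  "colon I f = {r \<in> B. r * f \<in> I}"

lemma adjoinI: "i \<in> I \<Longrightarrow> r \<in> B \<Longrightarrow> i + r * f \<in> adjoin I f"
  unfolding adjoin_def by blast

lemma adjoinE:
  assumes "x \<in> adjoin I f"
  obtains i r where "i \<in> I" "r \<in> B" "x = i + r * f"
  using assms unfolding adjoin_def by blast

lemma adjoin_mono: "I \<subseteq> adjoin I f"
  unfolding adjoin_def by (force intro: exI[of _ 0])

lemma adjoin_mem: "ideal I R \<Longrightarrow> f \<in> adjoin I f"
  using adjoinI[of 0 I 1 f] idealD(2) by simp

lemma ideal_adjoin:
  assumes I: "ideal I R" and f: "f \<in> B"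
  shows "ideal (adjoin I f) R"
  unfolding ideal_iff
proof (intro conjI ballI)
  show "adjoin I f \<subseteq> B"
    using idealD(1)[OF I] f unfolding adjoin_def by auto
  show "0 \<in> adjoin I f"
    using adjoin_mono idealD(2)[OF I] by blast
  fix x assume "x \<in> adjoin I f"
  then obtain i r where x: "i \<in> I" "r \<in> B" "x = i + r * f" by (rule adjoinE)
  show "x + y \<in> adjoin I f" if y': "y \<in> adjoin I f" for y
  proof -
    obtain j s where y: "j \<in> I" "s \<in> B" "y = j + s * f" by (rule adjoinE[OF y'])
    have "x + y = (i + j) + (r + s) * f" using x y by (simp add: algebra_simps)
    moreover have "(i + j) + (r + s) * f \<in> adjoin I f"
      using x y idealD(3)[OF I] by (intro adjoinI) auto
    ultimately show ?thesis by simp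
  qed
  show "t * x \<in> adjoin I f" if "t \<in> B" for t
  proof -
    have "t * x = t * i + (t * r) * f" using x by (simp add: algebra_simps)
    moreover have "t * i + (t * r) * f \<in> adjoin I f"
      using x that idealD(6)[OF I] by (intro adjoinI) auto
    ultimately show ?thesis by simp
  qed
qed

lemma adjoin_least: "ideal J R \<Longrightarrow> I \<subseteq> J \<Longrightarrow> f \<in> J \<Longrightarrow> adjoin I f \<subseteq> J"
  by (auto simp: adjoin_def idealD)

lemma genideal_insert:
  assumes "G \<subseteq> B" "f \<in> B"
  shows "Idl\<^bsub>R\<^esub> (insert f G) = adjoin (Idl\<^bsub>R\<^esub> G) f"
proof
  have G: "ideal (Idl\<^bsub>R\<^esub> G) R" using assms genideal_ideal by blast
  show "Idl\<^bsub>R\<^esub> (insert f G) \<subseteq> adjoin (Idl\<^bsub>R\<^esub> G) f"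
    using genideal_self[OF assms(1)] adjoin_mono[of "Idl\<^bsub>R\<^esub> G" f] adjoin_mem[OF G]
    by (intro genideal_least ideal_adjoin[OF G assms(2)]) blast
  show "adjoin (Idl\<^bsub>R\<^esub> G) f \<subseteq> Idl\<^bsub>R\<^esub> (insert f G)"
    using genideal_self[of "insert f G"] assms
    by (intro adjoin_least genideal_ideal genideal_least) auto
qed

lemma ideal_colon:
  assumes "ideal I R" "f \<in> B"
  shows "ideal (colon I f) R"
  using idealD[OF assms(1)] assms(2) unfolding ideal_iff colon_def
  by (auto simp: distrib_right mult.assoc)

lemma colon_mono: "ideal I R \<Longrightarrow> f \<in> B \<Longrightarrow> I \<subseteq> colon I f"
  using idealD[of I] by (auto simp: colon_def)

end

section \<open>Noetherian induction and Nakayama's lemma\<close>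

locale noetherian_subring = unital_subring B for B :: "'a::comm_ring_1 set" +
  assumes noetherian: "noetherian_ring (ring_on B)"
begin

lemma ideal_chain_stable:
  assumes V: "\<And>n. ideal (V n) R" and mono: "\<And>n. V n \<subseteq> V (Suc n)"
  shows "\<exists>n. \<forall>k\<ge>n. V k = V n"
proof -
  have le: "V i \<subseteq> V j" if "i \<le> j" for i j
    using lift_Suc_mono_le[of V, OF mono that] .
  have "\<Union>(range V) \<in> range V"
  proof (rule noetherian_ring.ideal_chain_is_trivial[OF noetherian])
    show "subset.chain {I. ideal I R} (range V)"
      unfolding subset_chain_def
    proof (intro conjI ballI)
      show "range V \<subseteq> {I. ideal I R}" using V by auto
      fix X Y assume "X \<in> range V" "Y \<in> range V"
      then obtain i j where "X = V i" "Y = V j" by auto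
      then show "X \<subseteq> Y \<or> Y \<subseteq> X" using le[of i j] le[of j i] by (cases "i \<le> j") simp_all
    qed
  qed auto
  then obtain n where n: "\<Union>(range V) = V n" by (rule rangeE)
  have "V k = V n" if "k \<ge> n" for k
  proof
    show "V k \<subseteq> V n" unfolding n[symmetric] by (rule UN_upper) simp
  qed (rule le[OF that])
  then show ?thesis by (intro exI allI impI)
qed

lemma ideal_finitely_generated:
  assumes "ideal I R"
  obtains G where "finite G" "G \<subseteq> I" "I = Idl\<^bsub>R\<^esub> G"
proof -
  have "\<exists>G\<subseteq>B. finite G \<and> I = Idl\<^bsub>R\<^esub> G"
    using noetherian_ring.finetely_gen[OF noetherian assms] unfolding ring_on_simps .
  then obtain G where "G \<subseteq> B" "finite G" "I = Idl\<^bsub>R\<^esub> G" by (elim exE conjE)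
  show ?thesis
  proof (rule that)
    show "G \<subseteq> I" using genideal_self[OF \<open>G \<subseteq> B\<close>] \<open>I = _\<close> by simp
  qed fact+
qed

lemma ideal_noetherian_induct [consumes 1, case_names step]:
  assumes I: "ideal I R"
    and step: "\<And>I. ideal I R \<Longrightarrow> (\<And>J. ideal J R \<Longrightarrow> I \<subset> J \<Longrightarrow> \<Phi> J) \<Longrightarrow> \<Phi> I"
  shows "\<Phi> I"
proof (rule ccontr)
  assume "\<not> \<Phi> I"
  have bad: "\<exists>J. ideal J R \<and> \<not> \<Phi> J \<and> I \<subset> J" if "ideal I R \<and> \<not> \<Phi> I" for I
    using step[of I] that by blast
  define F where "F I = (SOME J. ideal J R \<and> \<not> \<Phi> J \<and> I \<subset> J)" for I
  have F: "ideal (F I) R \<and> \<not> \<Phi> (F I) \<and> I \<subset> F I" if "ideal I R \<and> \<not> \<Phi> I" for I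
    unfolding F_def by (rule someI_ex[OF bad[OF that]])
  define V where "V n = (F ^^ n) I" for n
  have V: "ideal (V n) R \<and> \<not> \<Phi> (V n)" for n
    by (induction n) (use I \<open>\<not> \<Phi> I\<close> F in \<open>simp_all add: V_def\<close>)
  have less: "V n \<subset> V (Suc n)" for n
    using F[OF V[of n]] by (simp add: V_def)
  obtain n where n: "\<forall>k\<ge>n. V k = V n"
    using ideal_chain_stable[of V, OF conjunct1[OF V] psubset_imp_subset[OF less]] by (elim exE)
  have "V (Suc n) = V n" using n by (elim allE[of _ "Suc n"]) simp
  then show False using less[of n] by simp
qed

text \<open>The ideals \<open>J : a\<close> and \<open>J + (a)\<close> belong to the outer terms of the exact sequence
  \<open>0 \<rightarrow> R/(J : a) \<rightarrow> R/J \<rightarrow> R/(J + (a)) \<rightarrow> 0\<close>. If \<open>a * b \<in> J\<close> with \<open>a, b \<notin> J\<close>, both are strictly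
  larger than \<open>J\<close>, so the ideals between \<open>I\<close> and the primes are covered by Noetherian induction. This
  takes the place of prime filtrations of finitely generated modules.\<close>

lemma ideal_prime_induct [consumes 1, case_names whole prime step]:
  assumes I: "ideal I R"
    and whole: "\<Phi> B"
    and prime: "\<And>P. primeideal P R \<Longrightarrow> I \<subseteq> P \<Longrightarrow> \<Phi> P"
    and step: "\<And>J a. ideal J R \<Longrightarrow> I \<subseteq> J \<Longrightarrow> a \<in> B \<Longrightarrow> \<Phi> (colon J a) \<Longrightarrow> \<Phi> (adjoin J a) \<Longrightarrow> \<Phi> J"
  shows "\<Phi> I"
proof -
  have "I \<subseteq> J \<longrightarrow> \<Phi> J" if "ideal J R" for J
    using that
  proof (induction J rule: ideal_noetherian_induct)
    case (step J)
    show ?case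
    proof
      assume IJ: "I \<subseteq> J"
      show "\<Phi> J"
      proof (cases "J = B \<or> primeideal J R")
        case True
        then show ?thesis
        proof
          assume "J = B"
          then show ?thesis using whole by simp
        next
          assume "primeideal J R"
          then show ?thesis using IJ by (rule prime)
        qed
      next
        case False
        have "\<not> (\<forall>a\<in>B. \<forall>b\<in>B. a * b \<in> J \<longrightarrow> a \<in> J \<or> b \<in> J)"
        proof
          assume "\<forall>a\<in>B. \<forall>b\<in>B. a * b \<in> J \<longrightarrow> a \<in> J \<or> b \<in> J"
          then have "primeideal J R"
            using step.hyps(1) False unfolding primeideal_iff by simp
          then show False using False by simp
        qed
        then obtain a b where ab: "a \<in> B" "b \<in> B" "a * b \<in> J" "a \<notin> J" "b \<notin> J"
          by auto
        have "b * a \<in> J" using ab(3) by (simp add: mult.commute)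
        have c: "J \<subset> colon J a"
          using colon_mono[OF step.hyps(1) \<open>a \<in> B\<close>] ab \<open>b * a \<in> J\<close> by (auto simp: colon_def)
        have d: "J \<subset> adjoin J a"
          using adjoin_mono[of J a] adjoin_mem[OF step.hyps(1), of a] ab by auto
        have "\<Phi> (colon J a)"
          by (rule mp[OF step.IH[OF ideal_colon[OF step.hyps(1) \<open>a \<in> B\<close>] c]]) (use IJ c in auto)
        moreover have "\<Phi> (adjoin J a)"
          by (rule mp[OF step.IH[OF ideal_adjoin[OF step.hyps(1) \<open>a \<in> B\<close>] d]]) (use IJ d in auto)
        ultimately show ?thesis
          by (rule assms(4)[OF step.hyps(1) IJ \<open>a \<in> B\<close>])
      qed
    qed
  qed
  from mp[OF this[OF I]] show ?thesis by simp
qed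

text \<open>The free module over \<open>B\<close> with basis \<open>X\<close>, as functions on a type that contains \<open>X\<close>; the values
  outside \<open>X\<close> are fixed so that equal tuples are equal functions.\<close>

definition tuples :: "'i set \<Rightarrow> ('i \<Rightarrow> 'a) set" where
  "tuples X = {v. (\<forall>i\<in>X. v i \<in> B) \<and> (\<forall>i. i \<notin> X \<longrightarrow> v i = 0)}"

definition tuple_module :: "'i set \<Rightarrow> ('i \<Rightarrow> 'a) set \<Rightarrow> bool" where
  "tuple_module X V \<longleftrightarrow> V \<subseteq> tuples X \<and> (\<lambda>i. 0) \<in> V \<and> (\<forall>v\<in>V. \<forall>w\<in>V. (\<lambda>i. v i + w i) \<in> V) \<and>
     (\<forall>r\<in>B. \<forall>v\<in>V. (\<lambda>i. r * v i) \<in> V)"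

lemma tuple_moduleD:
  assumes "tuple_module X V"
  shows "V \<subseteq> tuples X" "(\<lambda>i. 0) \<in> V" "\<And>v w. v \<in> V \<Longrightarrow> w \<in> V \<Longrightarrow> (\<lambda>i. v i + w i) \<in> V"
    "\<And>r v. r \<in> B \<Longrightarrow> v \<in> V \<Longrightarrow> (\<lambda>i. r * v i) \<in> V"
  using assms unfolding tuple_module_def by blast+

lemma tuple_module_diff:
  assumes "tuple_module X V" "v \<in> V" "w \<in> V"
  shows "(\<lambda>i. v i - w i) \<in> V"
  using tuple_moduleD(3)[OF assms(1) assms(2) tuple_moduleD(4)[OF assms(1) _ assms(3), of "- 1"]]
  by simp

text \<open>Finite free modules are Noetherian: a chain of submodules stabilises as soon as its
  projection to one coordinate and its intersection with the kernel of this projection do.\<close>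

lemma tuple_module_chain_stable:
  assumes "finite X" "\<And>n. tuple_module X (V n)" "\<And>n. V n \<subseteq> V (Suc n)"
  shows "\<exists>n. \<forall>k\<ge>n. V k = V n"
  using assms
proof (induction X arbitrary: V rule: finite_induct)
  case empty
  have "V n = {\<lambda>i. 0}" for n
  proof
    show "V n \<subseteq> {\<lambda>i. 0}"
      using tuple_moduleD(1)[OF empty(1)[of n]] unfolding tuples_def by auto
    show "{\<lambda>i. 0} \<subseteq> V n"
      using tuple_moduleD(2)[OF empty(1)[of n]] by simp
  qed
  then show ?case by simp
next
  case (insert x X)
  have le: "V i \<subseteq> V j" if "i \<le> j" for i j
    using lift_Suc_mono_le[of V, OF insert.prems(2) that] .
  define C where "C n = (\<lambda>v. v x) ` V n" for n
  define W where "W n = {v \<in> V n. v x = 0}" for n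
  have "ideal (C n) R" for n
    unfolding ideal_iff
  proof (intro conjI ballI)
    note V = tuple_moduleD[OF insert.prems(1)[of n]]
    show "C n \<subseteq> B" using V(1) by (auto simp: C_def tuples_def)
    show "0 \<in> C n" using V(2) by (force simp: C_def)
    show "a + b \<in> C n" if "a \<in> C n" "b \<in> C n" for a b
      using that V(3) by (force simp: C_def)
    show "r * a \<in> C n" if "r \<in> B" "a \<in> C n" for r a
      using that V(4) by (force simp: C_def)
  qed
  moreover have "C n \<subseteq> C (Suc n)" for n
    unfolding C_def using insert.prems(2) by blast
  ultimately have "\<exists>n. \<forall>k\<ge>n. C k = C n"
    by (rule ideal_chain_stable)
  then obtain n1 where n1: "\<forall>k\<ge>n1. C k = C n1" ..
  have "tuple_module X (W n)" for n
    unfolding tuple_module_def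
  proof (intro conjI ballI)
    note V = tuple_moduleD[OF insert.prems(1)[of n]]
    show "W n \<subseteq> tuples X"
    proof
      fix v assume "v \<in> W n"
      then have "v \<in> tuples (insert x X)" "v x = 0" using V(1) by (auto simp: W_def)
      then show "v \<in> tuples X" unfolding tuples_def by (simp, metis)
    qed
    show "(\<lambda>i. 0) \<in> W n" using V(2) by (simp add: W_def)
    show "(\<lambda>i. v i + w i) \<in> W n" if "v \<in> W n" "w \<in> W n" for v w
      using that V(3) by (simp add: W_def)
    show "(\<lambda>i. r * v i) \<in> W n" if "r \<in> B" "v \<in> W n" for r v
      using that V(4) by (simp add: W_def)
  qed
  moreover have "W n \<subseteq> W (Suc n)" for n
    unfolding W_def using insert.prems(2) by blast
  ultimately have "\<exists>n. \<forall>k\<ge>n. W k = W n"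
    by (rule insert.IH)
  then obtain n2 where n2: "\<forall>k\<ge>n2. W k = W n2" ..
  define n where "n = max n1 n2"
  have "V k \<subseteq> V n" if "k \<ge> n" for k
  proof
    fix v assume v: "v \<in> V k"
    have "C k = C n" "W k = W n" using n1 n2 that unfolding n_def by (metis max.cobounded1 max.cobounded2 order_trans)+
    then obtain w where w: "w \<in> V n" "v x = w x" using v unfolding C_def by fastforce
    have "(\<lambda>i. v i - w i) \<in> W k"
      using tuple_module_diff[OF insert.prems(1) v] w le[OF that] by (auto simp: W_def)
    then have "(\<lambda>i. v i - w i) \<in> V n" unfolding \<open>W k = W n\<close> by (simp add: W_def)
    from tuple_moduleD(3)[OF insert.prems(1) this w(1)] show "v \<in> V n" by simp
  qed
  then show ?case using le by (intro exI[of _ n] allI impI subset_antisym)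
qed


text \<open>Nakayama's lemma after localisation at the prime \<open>m\<close>: if, modulo \<open>N\<close> and up to multipliers
  outside \<open>m\<close>, each element of \<open>Z\<close> is \<open>f\<close> times an element of \<open>Z\<close>, then an element \<open>z\<close> that
  survives in the localised quotient yields a sequence of survivors, each a multiple of the next.
  The cyclic modules that they generate increase, so two neighbours are multiples of each other, and
  a unit of the form \<open>u - g * f\<close> kills them.\<close>

lemma local_nakayama:
  assumes X: "finite X" and m: "primeideal m R" and f: "f \<in> m"
    and Z: "Z \<subseteq> tuples X" and N: "tuple_module X N"
    and Zf: "\<And>z. z \<in> Z \<Longrightarrow> \<exists>u\<in>B - m. \<exists>z'\<in>Z. (\<lambda>i. u * z i - f * z' i) \<in> N"
    and z: "z \<in> Z"
  shows "\<exists>u\<in>B - m. (\<lambda>i. u * z i) \<in> N"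
proof (rule ccontr)
  assume z_bad: "\<not> ?thesis"
  note mI = idealD[OF conjunct1[OF m[unfolded primeideal_iff]]]
  note N' = tuple_moduleD[OF N]
  have fB: "f \<in> B" using f mI(1) by auto
  have unit_mult: "u * v \<in> B - m" if "u \<in> B - m" "v \<in> B - m" for u v
    using that m by (auto simp: primeideal_iff)
  \<comment> \<open>A surviving element: one that no multiplier outside \<open>m\<close> moves into \<open>N\<close>.\<close>
  define bad where "bad z \<longleftrightarrow> z \<in> Z \<and> (\<forall>u\<in>B - m. (\<lambda>i. u * z i) \<notin> N)" for z
  have next_bad: "\<exists>z'. bad z' \<and> (\<exists>u\<in>B - m. (\<lambda>i. u * z i - f * z' i) \<in> N)" if "bad z" for z
  proof -
    from that have "z \<in> Z" by (simp add: bad_def)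
    from Zf[OF this] obtain u z' where u: "u \<in> B - m" "z' \<in> Z" "(\<lambda>i. u * z i - f * z' i) \<in> N"
      by (elim bexE)
    have "(\<lambda>i. w * z' i) \<notin> N" if "w \<in> B - m" for w
    proof
      assume w: "(\<lambda>i. w * z' i) \<in> N"
      have "(\<lambda>i. w * (u * z i - f * z' i) + f * (w * z' i)) \<in> N"
        using that fB by (intro N'(3) N'(4)[OF _ u(3)] N'(4)[OF _ w]) auto
      then have "(\<lambda>i. (w * u) * z i) \<in> N" by (simp add: algebra_simps)
      then show False using \<open>bad z\<close> unit_mult[OF that u(1)] by (simp add: bad_def)
    qed
    then show ?thesis using u by (auto simp: bad_def)
  qed
  define nxt where "nxt z = (SOME z'. bad z' \<and> (\<exists>u\<in>B - m. (\<lambda>i. u * z i - f * z' i) \<in> N))" for z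
  have nxt: "bad (nxt z) \<and> (\<exists>u\<in>B - m. (\<lambda>i. u * z i - f * nxt z i) \<in> N)" if "bad z" for z
    unfolding nxt_def by (rule someI_ex[OF next_bad[OF that]])
  define t where "t n = (nxt ^^ n) z" for n
  have bad_t: "bad (t n)" for n
    by (induction n) (use z z_bad nxt in \<open>auto simp: t_def bad_def\<close>)
  have t_Suc: "\<exists>u\<in>B - m. (\<lambda>i. u * t n i - f * t (Suc n) i) \<in> N" for n
    using nxt[OF bad_t[of n]] by (simp add: t_def)
  have tB: "t n \<in> tuples X" for n
    using bad_t[of n] Z by (auto simp: bad_def)
  \<comment> \<open>The saturation of \<open>N + B * t n\<close>: its localisation at \<open>m\<close>, intersected with the free module.\<close>
  define V where "V n = {v \<in> tuples X. \<exists>u\<in>B - m. \<exists>r\<in>B. (\<lambda>i. u * v i - r * t n i) \<in> N}" for n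
  have V: "tuple_module X (V n)" for n
    unfolding tuple_module_def
  proof (intro conjI ballI)
    show "V n \<subseteq> tuples X" by (auto simp: V_def)
    show "(\<lambda>i. 0) \<in> V n"
      using N'(2) primeideal_one[OF m] by (auto simp: V_def tuples_def intro!: bexI[of _ 1] bexI[of _ 0])
    fix v assume "v \<in> V n"
    then obtain u r where v: "v \<in> tuples X" "u \<in> B - m" "r \<in> B" "(\<lambda>i. u * v i - r * t n i) \<in> N"
      by (auto simp: V_def)
    show "(\<lambda>i. v i + w i) \<in> V n" if "w \<in> V n" for w
    proof -
      obtain u' r' where w: "w \<in> tuples X" "u' \<in> B - m" "r' \<in> B" "(\<lambda>i. u' * w i - r' * t n i) \<in> N"
        using \<open>w \<in> V n\<close> by (auto simp: V_def)
      have "(\<lambda>i. u' * (u * v i - r * t n i) + u * (u' * w i - r' * t n i)) \<in> N"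
        using v(2) w(2) by (intro N'(3) N'(4)[OF _ v(4)] N'(4)[OF _ w(4)]) auto
      then have "(\<lambda>i. (u * u') * (v i + w i) - (u' * r + u * r') * t n i) \<in> N"
        by (simp add: algebra_simps)
      moreover have "u * u' \<in> B - m" "u' * r + u * r' \<in> B" "(\<lambda>i. v i + w i) \<in> tuples X"
        using unit_mult v w by (auto simp: tuples_def)
      ultimately show ?thesis unfolding V_def by blast
    qed
    show "(\<lambda>i. s * v i) \<in> V n" if "s \<in> B" for s
    proof -
      have "(\<lambda>i. s * (u * v i - r * t n i)) \<in> N"
        by (rule N'(4)[OF that v(4)])
      then have "(\<lambda>i. u * (s * v i) - (s * r) * t n i) \<in> N"
        by (simp add: algebra_simps)
      moreover have "s * r \<in> B" "(\<lambda>i. s * v i) \<in> tuples X"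
        using that v by (auto simp: tuples_def)
      ultimately show ?thesis unfolding V_def using v(2) by blast
    qed
  qed
  have V_Suc: "V n \<subseteq> V (Suc n)" for n
  proof
    fix v assume "v \<in> V n"
    then obtain u r where v: "v \<in> tuples X" "u \<in> B - m" "r \<in> B" "(\<lambda>i. u * v i - r * t n i) \<in> N"
      by (auto simp: V_def)
    obtain u' where u': "u' \<in> B - m" "(\<lambda>i. u' * t n i - f * t (Suc n) i) \<in> N"
      using t_Suc[of n] by (elim bexE)
    have "(\<lambda>i. u' * (u * v i - r * t n i) + r * (u' * t n i - f * t (Suc n) i)) \<in> N"
      using v u' by (intro N'(3) N'(4)[OF _ v(4)] N'(4)[OF _ u'(2)]) auto
    then have "(\<lambda>i. (u' * u) * v i - (r * f) * t (Suc n) i) \<in> N"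
      by (simp add: algebra_simps)
    moreover have "u' * u \<in> B - m" "r * f \<in> B" using unit_mult v u' fB by auto
    ultimately show "v \<in> V (Suc n)" unfolding V_def using v(1) by blast
  qed
  obtain n where "\<forall>k\<ge>n. V k = V n"
    using tuple_module_chain_stable[of X V, OF X V V_Suc] by (rule exE)
  then have "V (Suc n) = V n" by (elim allE[of _ "Suc n"]) simp
  moreover have "t (Suc n) \<in> V (Suc n)"
    using tB N'(2) primeideal_one[OF m] by (auto simp: V_def intro!: bexI[of _ 1])
  ultimately obtain u r where u: "u \<in> B - m" "r \<in> B" "(\<lambda>i. u * t (Suc n) i - r * t n i) \<in> N"
    by (auto simp: V_def)
  obtain u' where u': "u' \<in> B - m" "(\<lambda>i. u' * t n i - f * t (Suc n) i) \<in> N"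
    using t_Suc[of n] by (elim bexE)
  \<comment> \<open>Combining the two relations between \<open>t n\<close> and \<open>t (Suc n)\<close> eliminates \<open>t n\<close>.\<close>
  have "(\<lambda>i. u' * (u * t (Suc n) i - r * t n i) + r * (u' * t n i - f * t (Suc n) i)) \<in> N"
    using u u' by (intro N'(3) N'(4)[OF _ u(3)] N'(4)[OF _ u'(2)]) auto
  then have "(\<lambda>i. (u' * u - r * f) * t (Suc n) i) \<in> N"
    by (simp add: algebra_simps)
  moreover have "u' * u - r * f \<in> B - m"
  proof -
    have "u' * u \<in> B - m" "r * f \<in> m" using unit_mult u u' mI(6) f by auto
    then have "u' * u - r * f \<notin> m" using mI(3)[of "u' * u - r * f" "r * f"] by auto
    then show ?thesis using u u' fB by auto
  qed
  ultimately show False using bad_t[of "Suc n"] by (simp add: bad_def)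
qed

end

section \<open>Regular sequences and the vanishing of Hom and Ext\<close>

context unital_subring
begin

text \<open>The Krull dimension of \<open>R/I\<close> is less than \<open>k\<close>. For \<open>k = 0\<close> this means that \<open>I\<close> is the unit ideal.\<close>

definition dim_below :: "'a set \<Rightarrow> nat \<Rightarrow> bool" where
  "dim_below I k \<longleftrightarrow> (\<forall>n P. prime_chain R n P \<longrightarrow> I \<subseteq> P 0 \<longrightarrow> n < k)"

lemma dim_below_mono: "dim_below I k \<Longrightarrow> I \<subseteq> J \<Longrightarrow> k \<le> l \<Longrightarrow> dim_below J l"
  unfolding dim_below_def by (meson order_less_le_trans order_trans)

lemma dim_below_prime_pos: "primeideal P R \<Longrightarrow> dim_below P k \<Longrightarrow> 0 < k"
  unfolding dim_below_def prime_chain_def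
  by (elim allE[of _ 0] allE[of _ "\<lambda>_. P"]) simp

text \<open>A chain of primes above \<open>P + (f)\<close> can be extended by \<open>P\<close>.\<close>

lemma dim_below_prime_adjoin:
  assumes P: "primeideal P R" and f: "f \<notin> P" and dim: "dim_below P (Suc k)"
  shows "dim_below (adjoin P f) k"
  unfolding dim_below_def
proof (intro allI impI)
  fix n Q assume Q: "prime_chain R n Q" "adjoin P f \<subseteq> Q 0"
  have "P \<subset> Q 0"
    using Q(2) adjoin_mono[of P f] adjoin_mem[of P f] P f by (auto simp: primeideal_iff)
  then have "prime_chain R (Suc n) (case_nat P Q)"
    using Q(1) P by (auto simp: prime_chain_def split: nat.split)
  then have "Suc n < Suc k" using dim unfolding dim_below_def by fastforce
  then show "n < k" by simp
qed

text \<open>The list \<open>fs\<close> is a regular sequence on \<open>R / L\<close>, up to the condition that it does not generate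
  the unit ideal.\<close>

fun regular_mod :: "'a set \<Rightarrow> 'a list \<Rightarrow> bool" where
  "regular_mod L [] \<longleftrightarrow> True"
| "regular_mod L (f # fs) \<longleftrightarrow> (\<forall>r\<in>B. f * r \<in> L \<longrightarrow> r \<in> L) \<and> regular_mod (adjoin L f) fs"

text \<open>A homomorphism \<open>I \<rightarrow> R / L\<close> is represented by a choice of representatives of its values.\<close>

definition hom_mod :: "'a set \<Rightarrow> 'a set \<Rightarrow> ('a \<Rightarrow> 'a) \<Rightarrow> bool" where
  "hom_mod I L \<phi> \<longleftrightarrow> (\<forall>i\<in>I. \<phi> i \<in> B) \<and> (\<forall>i\<in>I. \<forall>j\<in>I. \<phi> (i + j) - (\<phi> i + \<phi> j) \<in> L) \<and>
     (\<forall>r\<in>B. \<forall>i\<in>I. \<phi> (r * i) - r * \<phi> i \<in> L)"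

lemma hom_modD:
  assumes "hom_mod I L \<phi>"
  shows "\<And>i. i \<in> I \<Longrightarrow> \<phi> i \<in> B" "\<And>i j. i \<in> I \<Longrightarrow> j \<in> I \<Longrightarrow> \<phi> (i + j) - (\<phi> i + \<phi> j) \<in> L"
    "\<And>r i. r \<in> B \<Longrightarrow> i \<in> I \<Longrightarrow> \<phi> (r * i) - r * \<phi> i \<in> L"
  using assms unfolding hom_mod_def by blast+

lemma hom_mod_mono: "hom_mod I L \<phi> \<Longrightarrow> J \<subseteq> I \<Longrightarrow> L \<subseteq> M \<Longrightarrow> hom_mod J M \<phi>"
  unfolding hom_mod_def by blast

lemma hom_mod_diff:
  assumes L: "ideal L R" and I: "ideal I R" and \<phi>: "hom_mod I L \<phi>" and i: "i \<in> I" "j \<in> I"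
  shows "\<phi> (i - j) - (\<phi> i - \<phi> j) \<in> L"
proof -
  have "\<phi> (i - j + j) - (\<phi> (i - j) + \<phi> j) \<in> L"
    using i idealD(5)[OF I] by (intro hom_modD(2)[OF \<phi>])
  from idealD(4)[OF L this] show ?thesis by (simp add: algebra_simps)
qed

text \<open>A homomorphism on \<open>I\<close> extends to \<open>I + (a)\<close> as soon as a value \<open>t\<close> at \<open>a\<close> is compatible with the
  relations \<open>r * a \<in> I\<close>.\<close>

lemma hom_mod_extend:
  assumes L: "ideal L R" and I: "ideal I R" and a: "a \<in> B" and \<phi>: "hom_mod I L \<phi>"
    and t: "t \<in> B" "\<And>r. r \<in> colon I a \<Longrightarrow> \<phi> (r * a) - t * r \<in> L"
  obtains \<psi> where "hom_mod (adjoin I a) L \<psi>" "\<And>i. i \<in> I \<Longrightarrow> \<psi> i - \<phi> i \<in> L"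
proof -
  note L' = idealD[OF L] and I' = idealD[OF I]
  define \<psi> where "\<psi> x = (SOME y. \<exists>i\<in>I. \<exists>r\<in>B. x = i + r * a \<and> y = \<phi> i + t * r)" for x
  have ex: "\<exists>i\<in>I. \<exists>r\<in>B. x = i + r * a \<and> \<psi> x = \<phi> i + t * r" if "x \<in> adjoin I a" for x
    unfolding \<psi>_def by (rule someI_ex) (use that adjoinE in blast)
  have wd: "\<psi> x - (\<phi> i + t * r) \<in> L" if i: "i \<in> I" "r \<in> B" "x = i + r * a" for x i r
  proof -
    have "x \<in> adjoin I a" using i adjoinI by simp
    from ex[OF this] obtain j s where j: "j \<in> I" "s \<in> B" "x = j + s * a" "\<psi> x = \<phi> j + t * s"
      by auto
    have eq: "(r - s) * a = j - i" using i j by (simp add: algebra_simps)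
    have "r - s \<in> colon I a" using i j eq I'(5) by (simp add: colon_def)
    then have "\<phi> (j - i) - t * (r - s) \<in> L" using t(2) eq by metis
    moreover have "\<phi> (j - i) - (\<phi> j - \<phi> i) \<in> L"
      by (rule hom_mod_diff[OF L I \<phi> j(1) i(1)])
    ultimately have "(\<phi> (j - i) - t * (r - s)) - (\<phi> (j - i) - (\<phi> j - \<phi> i)) \<in> L"
      by (rule L'(5))
    then show ?thesis using j(4) by (simp add: algebra_simps)
  qed
  show thesis
  proof (rule that)
    show "hom_mod (adjoin I a) L \<psi>"
      unfolding hom_mod_def
    proof (intro conjI ballI)
      fix x assume x: "x \<in> adjoin I a"
      from ex[OF x] obtain i r where i: "i \<in> I" "r \<in> B" "x = i + r * a" "\<psi> x = \<phi> i + t * r"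
        by auto
      show "\<psi> x \<in> B" using i t(1) hom_modD(1)[OF \<phi>] by auto
      show "\<psi> (x + y) - (\<psi> x + \<psi> y) \<in> L" if y: "y \<in> adjoin I a" for y
      proof -
        from ex[OF y] obtain j s where j: "j \<in> I" "s \<in> B" "y = j + s * a" "\<psi> y = \<phi> j + t * s"
          by auto
        have "\<psi> (x + y) - (\<phi> (i + j) + t * (r + s)) \<in> L"
          using i j I'(3) by (intro wd) (auto simp: algebra_simps)
        from L'(3)[OF this hom_modD(2)[OF \<phi> i(1) j(1)]] show ?thesis
          using i j by (simp add: algebra_simps)
      qed
      show "\<psi> (c * x) - c * \<psi> x \<in> L" if c: "c \<in> B" for c
      proof -
        have "\<psi> (c * x) - (\<phi> (c * i) + t * (c * r)) \<in> L"
          using i c I'(6) by (intro wd) (auto simp: algebra_simps)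
        from L'(3)[OF this hom_modD(3)[OF \<phi> c i(1)]] show ?thesis
          using i by (simp add: algebra_simps)
      qed
    qed
    show "\<psi> i - \<phi> i \<in> L" if "i \<in> I" for i
      using wd[of i 0 i] that by simp
  qed
qed

end

context noetherian_subring
begin

text \<open>An element \<open>z\<close> with \<open>I z \<subseteq> L\<close> is a homomorphism from \<open>R/I\<close> to \<open>R/L\<close>, so the statement is the vanishing
  of \<open>Hom(R/I, R/L)\<close>, localised at \<open>m\<close>. It suffices to treat a prime \<open>I = P\<close>. Let \<open>f\<close> be the first element
  of the regular sequence. If \<open>f \<in> P\<close>, then \<open>f z \<in> L\<close> and so \<open>z \<in> L\<close>. Otherwise \<open>R/(P + (f))\<close> has smaller
  dimension, so by induction \<open>z\<close> vanishes modulo \<open>L + (f)\<close>: up to a multiplier it is \<open>f z'\<close> modulo \<open>L\<close>. As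
  \<open>f\<close> is a nonzerodivisor, \<open>P z' \<subseteq> L\<close>, and Nakayama's lemma applies.\<close>

lemma hom_vanishing:
  assumes m: "primeideal m R"
  shows "ideal L R \<Longrightarrow> set fs \<subseteq> m \<Longrightarrow> regular_mod L fs \<Longrightarrow> ideal I R \<Longrightarrow> dim_below I (length fs)
    \<Longrightarrow> z \<in> B \<Longrightarrow> (\<And>i. i \<in> I \<Longrightarrow> i * z \<in> L) \<Longrightarrow> \<exists>u\<in>B - m. u * z \<in> L"
proof (induction "length fs" arbitrary: fs L I z rule: less_induct)
  case less
  note L' = idealD[OF less.prems(1)]
  have mI: "ideal m R" using m by (simp add: primeideal_iff)
  have unit_mult: "u * v \<in> B - m" if "u \<in> B - m" "v \<in> B - m" for u v
    using that m by (auto simp: primeideal_iff)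
  have one: "1 \<in> B - m" using primeideal_one[OF m] by simp
  have "\<forall>z\<in>B. (\<forall>i\<in>I. i * z \<in> L) \<longrightarrow> (\<exists>u\<in>B - m. u * z \<in> L)"
    using less.prems(4)
  proof (induction I rule: ideal_prime_induct)
    case whole
    show ?case
    proof (intro ballI impI)
      fix z assume "\<forall>i\<in>B. i * z \<in> L"
      then have "1 * z \<in> L" using one_mem by (rule bspec)
      then show "\<exists>u\<in>B - m. u * z \<in> L" using one by (rule bexI)
    qed
  next
    case (prime P)
    have P: "ideal P R" using prime.hyps(1) by (simp add: primeideal_iff)
    have dimP: "dim_below P (length fs)"
      using less.prems(5) prime.hyps(2) order_refl by (rule dim_below_mono)
    then obtain f gs where fs: "fs = f # gs"
      using dim_below_prime_pos[OF prime.hyps(1)] by (cases fs) auto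
    have f: "f \<in> m" "f \<in> B" using less.prems(2) idealD(1)[OF mI] by (auto simp: fs)
    have nzd: "r \<in> L" if "r \<in> B" "f * r \<in> L" for r using less.prems(3) that by (simp add: fs)
    show ?case
    proof (intro ballI impI)
      fix z assume z: "z \<in> B" "\<forall>i\<in>P. i * z \<in> L"
      show "\<exists>u\<in>B - m. u * z \<in> L"
      proof (cases "f \<in> P")
        case True
        then have "1 * z \<in> L" using z nzd by simp
        then show ?thesis using one by (rule bexI)
      next
        case False
        define Z where "Z = {v \<in> tuples (UNIV :: unit set). \<forall>i\<in>P. i * v () \<in> L}"
        define N where "N = {v \<in> tuples (UNIV :: unit set). v () \<in> L}"
        have dim: "dim_below (adjoin P f) (length gs)"
          using dim_below_prime_adjoin[OF prime.hyps(1) False] dimP by (simp add: fs)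
        have "\<exists>u\<in>B - m. (\<lambda>i. u * (\<lambda>_::unit. z) i) \<in> N"
        proof (rule local_nakayama[OF _ m f(1), where Z = Z and X = UNIV])
          show "Z \<subseteq> tuples UNIV" by (auto simp: Z_def)
          show "tuple_module UNIV N"
            unfolding tuple_module_def N_def using L' by (auto simp: tuples_def)
          show "(\<lambda>_. z) \<in> Z" using z by (simp add: Z_def tuples_def)
          fix v assume "v \<in> Z"
          then have v: "v () \<in> B" "\<And>i. i \<in> P \<Longrightarrow> i * v () \<in> L" by (auto simp: Z_def tuples_def)
          have "x * v () \<in> adjoin L f" if xP: "x \<in> adjoin P f" for x
          proof -
            obtain p r where x: "p \<in> P" "r \<in> B" "x = p + r * f" by (rule adjoinE[OF xP])
            have "p * v () + (r * v ()) * f \<in> adjoin L f"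
              using x v by (intro adjoinI) auto
            then show ?thesis using x(3) by (simp add: algebra_simps)
          qed
          then have "\<exists>u\<in>B - m. u * v () \<in> adjoin L f"
            using less.prems(2,3) ideal_adjoin[OF less.prems(1) f(2)] ideal_adjoin[OF P f(2)] dim v(1)
            by (intro less.hyps[of gs "adjoin L f" "adjoin P f"]) (auto simp: fs)
          then obtain u where u: "u \<in> B - m" "u * v () \<in> adjoin L f" by (elim bexE)
          obtain l r where l: "l \<in> L" "r \<in> B" "u * v () = l + r * f" by (rule adjoinE[OF u(2)])
          have "i * r \<in> L" if "i \<in> P" for i
          proof (rule nzd)
            have iB: "i \<in> B" using that idealD(1)[OF P] by auto
            then show "i * r \<in> B" using l by simp
            have "u * (i * v ()) - i * l \<in> L" using L'(5,6) v(2)[OF that] u(1) l(1) iB by auto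
            also have "u * (i * v ()) - i * l = i * (u * v ()) - i * l" by (simp add: algebra_simps)
            also have "\<dots> = f * (i * r)" unfolding l(3) by (simp add: algebra_simps)
            finally show "f * (i * r) \<in> L" .
          qed
          then have "(\<lambda>_. r) \<in> Z" using l(2) by (simp add: Z_def tuples_def)
          moreover have "(\<lambda>i. u * v i - f * (\<lambda>_. r) i) \<in> N"
            using u(1) v(1) l f(2) subsetD[OF L'(1) l(1)] by (auto simp: N_def tuples_def algebra_simps)
          ultimately show "\<exists>u\<in>B - m. \<exists>z'\<in>Z. (\<lambda>i. u * v i - f * z' i) \<in> N"
            using u(1) by (intro bexI[of _ u] bexI[of _ "\<lambda>_. r"])
        qed simp
        then show ?thesis by (auto simp: N_def)
      qed
    qed
  next
    case (step J a)
    show ?case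
    proof (intro ballI impI)
      fix z assume z: "z \<in> B" "\<forall>i\<in>J. i * z \<in> L"
      have "\<forall>r\<in>colon J a. r * (a * z) \<in> L"
        using z(2) by (auto simp: colon_def mult.assoc[symmetric])
      then obtain u where u: "u \<in> B - m" "u * (a * z) \<in> L"
        using step.IH(1) z(1) \<open>a \<in> B\<close> by blast
      have "\<forall>x\<in>adjoin J a. x * (u * z) \<in> L"
      proof
        fix x assume "x \<in> adjoin J a"
        then obtain j r where x: "j \<in> J" "r \<in> B" "x = j + r * a" by (rule adjoinE)
        have "u * (j * z) + r * (u * (a * z)) \<in> L"
          using x z u L'(3,6) by auto
        then show "x * (u * z) \<in> L" using x(3) by (simp add: algebra_simps)
      qed
      then obtain u' where "u' \<in> B - m" "u' * (u * z) \<in> L"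
        using step.IH(2) z(1) u(1) by blast
      then show "\<exists>u\<in>B - m. u * z \<in> L"
        using unit_mult[OF _ u(1)] by (auto simp: mult.assoc[symmetric])
    qed
  qed
  then show ?case using less.prems(6,7) by blast
qed


text \<open>That each homomorphism \<open>I \<rightarrow> R/L\<close> is the multiplication by an element of \<open>R/L\<close> is the vanishing of
  \<open>Ext\<^sup>1(R/I, R/L)\<close>, here localised at \<open>m\<close>. Again it suffices to treat a prime \<open>P\<close>. If the first element
  \<open>f\<close> of the sequence is in \<open>P\<close>, then \<open>f \<phi>(p) = p \<phi>(f)\<close> shows that \<open>\<phi>(f)\<close> is killed by \<open>P\<close> in
  \<open>R/(L + (f))\<close>, hence zero there, and \<open>\<phi>\<close> is the multiplication by \<open>\<phi>(f)/f\<close>. Otherwise \<open>\<phi>\<close> induces a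
  homomorphism from \<open>P + (f)\<close> to \<open>R/(L + (f))\<close>, which is a multiplication by induction; so each
  homomorphism is a multiplication plus \<open>f\<close> times another homomorphism, and Nakayama's lemma applies
  to the module of homomorphisms modulo multiplications.\<close>

lemma ext_vanishing:
  assumes m: "primeideal m R"
  shows "ideal L R \<Longrightarrow> set fs \<subseteq> m \<Longrightarrow> regular_mod L fs \<Longrightarrow> ideal I R \<Longrightarrow> dim_below I k \<Longrightarrow> k < length fs
    \<Longrightarrow> hom_mod I L \<phi> \<Longrightarrow> \<exists>u\<in>B - m. \<exists>s\<in>B. \<forall>i\<in>I. u * \<phi> i - s * i \<in> L"
proof (induction fs arbitrary: L I \<phi> k)
  case Nil
  then show ?case by simp
next
  case (Cons f fs)
  note L = Cons.prems(1)
  note L' = idealD[OF L]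
  have mI: "ideal m R" using m by (simp add: primeideal_iff)
  have f: "f \<in> m" "f \<in> B" using Cons.prems(2) idealD(1)[OF mI] by auto
  have nzd: "r \<in> L" if "r \<in> B" "f * r \<in> L" for r using Cons.prems(3) that by simp
  have unit_mult: "u * v \<in> B - m" if "u \<in> B - m" "v \<in> B - m" for u v
    using that m by (auto simp: primeideal_iff)
  have one: "1 \<in> B - m" using primeideal_one[OF m] by simp
  have Lf: "ideal (adjoin L f) R" using L f(2) by (rule ideal_adjoin)
  have regf: "regular_mod (adjoin L f) fs" "set fs \<subseteq> m" using Cons.prems(2,3) by simp_all
  have "\<forall>\<phi>. hom_mod I L \<phi> \<longrightarrow> (\<exists>u\<in>B - m. \<exists>s\<in>B. \<forall>i\<in>I. u * \<phi> i - s * i \<in> L)"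
    using Cons.prems(4)
  proof (induction I rule: ideal_prime_induct)
    case whole
    show ?case
    proof (intro allI impI)
      fix \<phi> assume \<phi>: "hom_mod B L \<phi>"
      have "1 * \<phi> i - \<phi> 1 * i \<in> L" if "i \<in> B" for i
        using hom_modD(3)[OF \<phi> that one_mem] by (simp add: mult.commute[of i])
      then show "\<exists>u\<in>B - m. \<exists>s\<in>B. \<forall>i\<in>B. u * \<phi> i - s * i \<in> L"
        using hom_modD(1)[OF \<phi> one_mem] by (intro bexI[OF _ one] bexI[of _ "\<phi> 1"] ballI)
    qed
  next
    case (prime P)
    have P: "ideal P R" using prime.hyps(1) by (simp add: primeideal_iff)
    note P' = idealD[OF P]
    have dimP: "dim_below P k" using Cons.prems(5) prime.hyps(2) by (rule dim_below_mono) simp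
    then obtain k' where k: "k = Suc k'" "k' < length fs"
      using dim_below_prime_pos[OF prime.hyps(1)] Cons.prems(6) by (cases k) auto
    show ?case
    proof (intro allI impI)
      fix \<phi> assume \<phi>: "hom_mod P L \<phi>"
      note \<phi>' = hom_modD[OF \<phi>]
      show "\<exists>u\<in>B - m. \<exists>s\<in>B. \<forall>i\<in>P. u * \<phi> i - s * i \<in> L"
      proof (cases "f \<in> P")
        case True
        define t where "t = \<phi> f"
        have t: "t \<in> B" using \<phi>'(1)[OF True] by (simp add: t_def)
        have ft: "f * \<phi> p - p * t \<in> L" if p: "p \<in> P" for p
        proof -
          have "(\<phi> (p * f) - p * \<phi> f) - (\<phi> (f * p) - f * \<phi> p) \<in> L"
            using p True P'(1) f(2) by (intro L'(5) \<phi>'(3)) auto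
          then show ?thesis by (simp add: t_def mult.commute[of p])
        qed
        have "p * t \<in> adjoin L f" if p: "p \<in> P" for p
        proof -
          have "- (f * \<phi> p - p * t) + \<phi> p * f \<in> adjoin L f"
            using L'(4)[OF ft[OF p]] \<phi>'(1)[OF p] by (rule adjoinI)
          then show ?thesis by (simp add: mult.commute)
        qed
        then have "\<exists>u\<in>B - m. u * t \<in> adjoin L f"
          using k dim_below_mono[OF dimP order_refl, of "length fs"] t
          by (intro hom_vanishing[OF m Lf regf(2,1) P]) auto
        then obtain u where u: "u \<in> B - m" "u * t \<in> adjoin L f" by (elim bexE)
        obtain l r where l: "l \<in> L" "r \<in> B" "u * t = l + r * f" by (rule adjoinE[OF u(2)])
        have "u * \<phi> p - r * p \<in> L" if p: "p \<in> P" for p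
        proof (rule nzd)
          have pB: "p \<in> B" using p P'(1) by auto
          show "u * \<phi> p - r * p \<in> B" using u(1) \<phi>'(1)[OF p] l(2) pB by auto
          have "u * (f * \<phi> p - p * t) + p * l \<in> L"
            using ft[OF p] u(1) l(1) pB by (intro L'(3) L'(6)) auto
          moreover have "u * (f * \<phi> p - p * t) + p * l = f * (u * \<phi> p) - p * (u * t) + p * l"
            by (simp add: algebra_simps)
          moreover have "\<dots> = f * (u * \<phi> p - r * p)"
            unfolding l(3) by (simp add: algebra_simps)
          ultimately show "f * (u * \<phi> p - r * p) \<in> L" by simp
        qed
        then show ?thesis using u(1) l(2) by (intro bexI[of _ u] bexI[of _ r] ballI)
      next
        case False
        have dim: "dim_below (adjoin P f) k'"
          using dim_below_prime_adjoin[OF prime.hyps(1) False] dimP k(1) by simp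
        obtain G where G: "finite G" "G \<subseteq> P" "P = Idl\<^bsub>R\<^esub> G"
          by (rule ideal_finitely_generated[OF P])
        \<comment> \<open>Here \<open>\<phi>\<close> is extended to \<open>P + (f)\<close> by the value \<open>0\<close> at \<open>f\<close>, which is consistent modulo \<open>f\<close>.\<close>
        have descend: "\<exists>u\<in>B - m. \<exists>s\<in>B. \<exists>\<omega>. hom_mod P L \<omega> \<and> (\<forall>p\<in>P. u * \<phi> p - f * \<omega> p - s * p \<in> L)"
          if \<phi>: "hom_mod P L \<phi>" for \<phi>
        proof -
          note \<phi>' = hom_modD[OF \<phi>]
          have \<phi>f: "hom_mod P (adjoin L f) \<phi>"
            using \<phi> adjoin_mono by (rule hom_mod_mono[OF _ order_refl])
          have "\<phi> (r * f) - 0 * r \<in> adjoin L f" if "r \<in> colon P f" for r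
          proof -
            have r: "r \<in> P" using that False prime.hyps(1) f(2) by (auto simp: colon_def primeideal_iff)
            have "(\<phi> (f * r) - f * \<phi> r) + \<phi> r * f \<in> adjoin L f"
              using \<phi>'(3)[OF f(2) r] \<phi>'(1)[OF r] by (rule adjoinI)
            then show ?thesis by (simp add: mult.commute)
          qed
          then obtain \<psi> where \<psi>: "hom_mod (adjoin P f) (adjoin L f) \<psi>"
            "\<And>i. i \<in> P \<Longrightarrow> \<psi> i - \<phi> i \<in> adjoin L f"
            using hom_mod_extend[OF Lf P f(2) \<phi>f zero_mem] by blast
          obtain u s where u: "u \<in> B - m" "s \<in> B"
              "\<And>x. x \<in> adjoin P f \<Longrightarrow> u * \<psi> x - s * x \<in> adjoin L f"
            using Cons.IH[OF Lf regf(2,1) ideal_adjoin[OF P f(2)] dim k(2) \<psi>(1)] by blast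
          have "\<exists>c\<in>B. u * \<phi> p - f * c - s * p \<in> L" if p: "p \<in> P" for p
          proof -
            have "(u * \<psi> p - s * p) - u * (\<psi> p - \<phi> p) \<in> adjoin L f"
              using u(1) p subsetD[OF adjoin_mono p]
              by (intro idealD(5,6)[OF Lf] u(3) \<psi>(2)) auto
            then have "u * \<phi> p - s * p \<in> adjoin L f" by (simp add: algebra_simps)
            then obtain l r where "l \<in> L" "r \<in> B" "u * \<phi> p - s * p = l + r * f" by (rule adjoinE)
            then have "u * \<phi> p - f * r - s * p \<in> L" "r \<in> B" by (simp_all add: algebra_simps)
            then show ?thesis by (intro bexI)
          qed
          then obtain \<omega> where \<omega>: "\<And>p. p \<in> P \<Longrightarrow> \<omega> p \<in> B" "\<And>p. p \<in> P \<Longrightarrow> u * \<phi> p - f * \<omega> p - s * p \<in> L"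
            by metis
          have "hom_mod P L \<omega>"
            unfolding hom_mod_def
          proof (intro conjI ballI)
            fix i assume i: "i \<in> P"
            show "\<omega> i \<in> B" using \<omega>(1)[OF i] .
            show "\<omega> (i + j) - (\<omega> i + \<omega> j) \<in> L" if j: "j \<in> P" for j
            proof (rule nzd)
              have "u * (\<phi> (i + j) - (\<phi> i + \<phi> j)) - (u * \<phi> (i + j) - f * \<omega> (i + j) - s * (i + j))
                  + (u * \<phi> i - f * \<omega> i - s * i) + (u * \<phi> j - f * \<omega> j - s * j) \<in> L"
                using i j u P'(3) by (intro L'(3,5,6) \<omega>(2) \<phi>'(2)) auto
              then show "f * (\<omega> (i + j) - (\<omega> i + \<omega> j)) \<in> L" by (simp add: algebra_simps)
            qed (use \<omega>(1) i j P'(3) in auto)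
            show "\<omega> (c * i) - c * \<omega> i \<in> L" if c: "c \<in> B" for c
            proof (rule nzd)
              have "u * (\<phi> (c * i) - c * \<phi> i) - (u * \<phi> (c * i) - f * \<omega> (c * i) - s * (c * i))
                  + c * (u * \<phi> i - f * \<omega> i - s * i) \<in> L"
                using i c u P'(6) by (intro L'(3,5,6) \<omega>(2) \<phi>'(3)) auto
              then show "f * (\<omega> (c * i) - c * \<omega> i) \<in> L" by (simp add: algebra_simps)
            qed (use \<omega>(1) i c P'(6) in auto)
          qed
          then show ?thesis using u(1,2) \<omega>(2) by blast
        qed
        \<comment> \<open>A homomorphism is represented by its values at finitely many generators of \<open>P\<close>.\<close>
        define restr where "restr \<phi> = (\<lambda>g. if g \<in> G then \<phi> g else (0 :: 'a))" for \<phi>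
        define Z where "Z = restr ` {\<phi>. hom_mod P L \<phi>}"
        define N where "N = {v \<in> tuples G. \<exists>s\<in>B. \<forall>g\<in>G. v g - s * g \<in> L}"
        have GB: "g \<in> B" if "g \<in> G" for g using that G(2) P'(1) by auto
        have "\<exists>u\<in>B - m. (\<lambda>i. u * restr \<phi> i) \<in> N"
        proof (rule local_nakayama[OF G(1) m f(1), where Z = Z])
          show "Z \<subseteq> tuples G"
            using G(2) by (auto simp: Z_def restr_def tuples_def dest: hom_modD(1))
          show "restr \<phi> \<in> Z" using \<phi> by (simp add: Z_def)
          show "tuple_module G N"
            unfolding tuple_module_def
          proof (intro conjI ballI)
            show "N \<subseteq> tuples G" by (auto simp: N_def)
            show "(\<lambda>i. 0) \<in> N" using L'(2) by (auto simp: N_def tuples_def intro!: bexI[of _ 0])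
            fix v assume "v \<in> N"
            then obtain s where v: "v \<in> tuples G" "s \<in> B" "\<And>g. g \<in> G \<Longrightarrow> v g - s * g \<in> L"
              by (auto simp: N_def)
            show "(\<lambda>i. v i + w i) \<in> N" if "w \<in> N" for w
            proof -
              obtain s' where w: "w \<in> tuples G" "s' \<in> B" "\<And>g. g \<in> G \<Longrightarrow> w g - s' * g \<in> L"
                using \<open>w \<in> N\<close> by (auto simp: N_def)
              have "v g + w g - (s + s') * g \<in> L" if "g \<in> G" for g
                using L'(3)[OF v(3)[OF that] w(3)[OF that]] by (simp add: algebra_simps)
              moreover have "(\<lambda>i. v i + w i) \<in> tuples G" using v w by (auto simp: tuples_def)
              ultimately show ?thesis using v(2) w(2) by (auto simp: N_def intro!: bexI[of _ "s + s'"])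
            qed
            show "(\<lambda>i. r * v i) \<in> N" if r: "r \<in> B" for r
            proof -
              have "r * v g - (r * s) * g \<in> L" if "g \<in> G" for g
                using L'(6)[OF r v(3)[OF that]] by (simp add: algebra_simps)
              moreover have "(\<lambda>i. r * v i) \<in> tuples G" using v r by (auto simp: tuples_def)
              ultimately show ?thesis using v(2) r by (auto simp: N_def intro!: bexI[of _ "r * s"])
            qed
          qed
          fix z assume "z \<in> Z"
          then obtain \<eta> where \<eta>: "hom_mod P L \<eta>" "z = restr \<eta>" by (auto simp: Z_def)
          obtain u s \<omega> where u: "u \<in> B - m" "s \<in> B" "hom_mod P L \<omega>"
              "\<And>p. p \<in> P \<Longrightarrow> u * \<eta> p - f * \<omega> p - s * p \<in> L"
            using descend[OF \<eta>(1)] by blast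
          have "(\<lambda>i. u * z i - f * restr \<omega> i) \<in> N"
            unfolding N_def
          proof (rule CollectI, intro conjI bexI[OF _ u(2)] ballI)
            show "(\<lambda>i. u * z i - f * restr \<omega> i) \<in> tuples G"
              using G(2) u(1) f(2) hom_modD(1)[OF \<eta>(1)] hom_modD(1)[OF u(3)] \<eta>(2)
              by (auto simp: tuples_def restr_def)
            show "u * z g - f * restr \<omega> g - s * g \<in> L" if "g \<in> G" for g
              using u(4)[of g] that G(2) \<eta>(2) by (auto simp: restr_def)
          qed
          moreover have "restr \<omega> \<in> Z" using u(3) by (simp add: Z_def)
          ultimately show "\<exists>u\<in>B - m. \<exists>z'\<in>Z. (\<lambda>i. u * z i - f * z' i) \<in> N" using u(1) by blast
        qed
        then obtain u s where u: "u \<in> B - m" "s \<in> B" "\<And>g. g \<in> G \<Longrightarrow> u * \<phi> g - s * g \<in> L"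
          by (auto simp: N_def restr_def)
        \<comment> \<open>From the generators back to all of \<open>P\<close>.\<close>
        define K where "K = {p \<in> P. u * \<phi> p - s * p \<in> L}"
        have "ideal K R"
          unfolding ideal_iff
        proof (intro conjI ballI)
          show "K \<subseteq> B" using P'(1) by (auto simp: K_def)
          show "0 \<in> K"
          proof -
            have "\<phi> (0 * 0) - 0 * \<phi> 0 \<in> L" using P'(2) by (intro \<phi>'(3)) auto
            then have "u * \<phi> 0 \<in> L" using u(1) L'(6) by simp
            then show ?thesis using P'(2) by (simp add: K_def)
          qed
          fix p assume "p \<in> K"
          then have p: "p \<in> P" "u * \<phi> p - s * p \<in> L" by (auto simp: K_def)
          show "p + q \<in> K" if "q \<in> K" for q
          proof -
            have q: "q \<in> P" "u * \<phi> q - s * q \<in> L" using that by (auto simp: K_def)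
            have "u * (\<phi> (p + q) - (\<phi> p + \<phi> q)) + (u * \<phi> p - s * p) + (u * \<phi> q - s * q) \<in> L"
              using p q u(1) by (intro L'(3,6) \<phi>'(2)) auto
            then show ?thesis using p q P'(3) by (simp add: K_def algebra_simps)
          qed
          show "r * p \<in> K" if r: "r \<in> B" for r
          proof -
            have "u * (\<phi> (r * p) - r * \<phi> p) + r * (u * \<phi> p - s * p) \<in> L"
              using p r u(1) by (intro L'(3,6) \<phi>'(3)) auto
            then have "u * \<phi> (r * p) - s * (r * p) \<in> L" by (simp add: algebra_simps)
            then show ?thesis using P'(6)[OF r p(1)] by (simp add: K_def)
          qed
        qed
        moreover have "G \<subseteq> K" using G(2) u(3) by (auto simp: K_def)
        ultimately have "P \<subseteq> K" unfolding G(3) by (rule genideal_least)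
        then show ?thesis using u(1,2) by (auto simp: K_def)
      qed
    qed
  next
    case (step J a)
    note J' = idealD[OF step.hyps(1)]
    show ?case
    proof (intro allI impI)
      fix \<phi> assume \<phi>: "hom_mod J L \<phi>"
      note \<phi>' = hom_modD[OF \<phi>]
      have "hom_mod (colon J a) L (\<lambda>r. \<phi> (r * a))"
        unfolding hom_mod_def colon_def using \<phi>' by (auto simp: distrib_right mult.assoc)
      then obtain u t where u: "u \<in> B - m" "t \<in> B" "\<And>r. r \<in> colon J a \<Longrightarrow> u * \<phi> (r * a) - t * r \<in> L"
        using step.IH(1) by blast
      have u\<phi>: "hom_mod J L (\<lambda>i. u * \<phi> i)"
        unfolding hom_mod_def
      proof (intro conjI ballI)
        fix i assume i: "i \<in> J"
        show "u * \<phi> i \<in> B" using u(1) \<phi>'(1)[OF i] by auto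
        show "u * \<phi> (i + j) - (u * \<phi> i + u * \<phi> j) \<in> L" if "j \<in> J" for j
          using L'(6)[OF _ \<phi>'(2)[OF i that], of u] u(1) by (simp add: algebra_simps)
        show "u * \<phi> (r * i) - r * (u * \<phi> i) \<in> L" if "r \<in> B" for r
          using L'(6)[OF _ \<phi>'(3)[OF that i], of u] u(1) by (simp add: algebra_simps)
      qed
      obtain \<psi> where \<psi>: "hom_mod (adjoin J a) L \<psi>" "\<And>i. i \<in> J \<Longrightarrow> \<psi> i - u * \<phi> i \<in> L"
        using hom_mod_extend[OF L step.hyps(1) \<open>a \<in> B\<close> u\<phi> u(2,3)] by blast
      obtain u' s where u': "u' \<in> B - m" "s \<in> B" "\<And>x. x \<in> adjoin J a \<Longrightarrow> u' * \<psi> x - s * x \<in> L"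
        using step.IH(2) \<psi>(1) by blast
      have "(u' * u) * \<phi> i - s * i \<in> L" if i: "i \<in> J" for i
      proof -
        have "(u' * \<psi> i - s * i) - u' * (\<psi> i - u * \<phi> i) \<in> L"
          using i u'(1) subsetD[OF adjoin_mono i] by (intro L'(5,6) u'(3) \<psi>(2)) auto
        then show ?thesis by (simp add: algebra_simps)
      qed
      then show "\<exists>u\<in>B - m. \<exists>s\<in>B. \<forall>i\<in>J. u * \<phi> i - s * i \<in> L"
        using unit_mult[OF u'(1) u(1)] u'(2) by (intro bexI[of _ "u' * u"] bexI[of _ s] ballI)
    qed
  qed
  then show ?case using Cons.prems(7) by blast
qed


lemma regular_sequence_regular_mod:
  assumes "regular_sequence R xs"
  shows "regular_mod {0} xs"
proof -
  have xs: "set xs \<subseteq> B" "\<And>i r. i < length xs \<Longrightarrow> r \<in> B \<Longrightarrow> xs ! i * r \<in> Idl\<^bsub>R\<^esub> (set (take i xs)) \<Longrightarrow>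
      r \<in> Idl\<^bsub>R\<^esub> (set (take i xs))"
    using assms unfolding regular_sequence_def by simp_all
  have "regular_mod (Idl\<^bsub>R\<^esub> (set (take i xs))) (drop i xs)" if "i \<le> length xs" for i
    using that
  proof (induction i rule: inc_induct)
    case (step i)
    have "set (take (Suc i) xs) = insert (xs ! i) (set (take i xs))"
      using step.hyps by (simp add: take_Suc_conv_app_nth)
    moreover have "set (take i xs) \<subseteq> B" "xs ! i \<in> B"
      using xs(1) set_take_subset[of i xs] step.hyps by auto
    ultimately have "Idl\<^bsub>R\<^esub> (set (take (Suc i) xs)) = adjoin (Idl\<^bsub>R\<^esub> (set (take i xs))) (xs ! i)"
      by (simp add: genideal_insert)
    then show ?case
      using step xs(2)[of i] by (simp add: Cons_nth_drop_Suc[symmetric])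
  qed simp
  from this[of 0] have "regular_mod (Idl\<^bsub>R\<^esub> {}) xs" by simp
  moreover have "Idl\<^bsub>R\<^esub> {} = {0}"
    using genideal_least[of "{0}" "{}"] idealD(2)[OF genideal_ideal[of "{}"]] by (auto simp: ideal_iff)
  ultimately show ?thesis by simp
qed

lemma depth_ext_vanishing:
  assumes m: "primeideal m R" and depth: "enat d \<le> depth R m" and k: "k < d"
    and I: "ideal I R" "dim_below I k" and \<phi>: "hom_mod I {0} \<phi>"
  shows "\<exists>u\<in>B - m. \<exists>s\<in>B. \<forall>i\<in>I. u * \<phi> i = s * i"
proof -
  have "enat k < enat d" using k by simp
  also note depth
  finally have "enat k < depth R m" .
  then obtain xs where xs: "set xs \<subseteq> m" "regular_sequence R xs" "k < length xs"
    unfolding depth_def less_SUP_iff by auto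
  have "\<exists>u\<in>B - m. \<exists>s\<in>B. \<forall>i\<in>I. u * \<phi> i - s * i \<in> {0}"
    using ext_vanishing[OF m _ xs(1) regular_sequence_regular_mod[OF xs(2)] I xs(3) \<phi>]
    by (simp add: ideal_iff)
  then show ?thesis by simp
qed

end

section \<open>Monomials in semigroup rings\<close>

type_synonym ('d, 'k) mpoly = "nat ^ 'd \<Rightarrow>\<^sub>0 'k"

abbreviation keys where "keys \<equiv> Poly_Mapping.keys"
abbreviation lookup where "lookup \<equiv> Poly_Mapping.lookup"
abbreviation single where "single \<equiv> Poly_Mapping.single"

definition supported_on :: "'e set \<Rightarrow> ('e \<Rightarrow>\<^sub>0 'k::zero) set" where
  "supported_on U = {p. keys p \<subseteq> U}"

abbreviation monomial :: "'e \<Rightarrow> ('e \<Rightarrow>\<^sub>0 'k::zero_neq_one)" where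
  "monomial b \<equiv> single b 1"

lemma poly_mapping_sum_single:
  fixes p :: "'e \<Rightarrow>\<^sub>0 'k::comm_monoid_add"
  shows "p = (\<Sum>k\<in>keys p. single k (lookup p k))"
proof (rule poly_mapping_eqI)
  fix b
  have "(\<Sum>k\<in>keys p. lookup (single k (lookup p k)) b)
      = (\<Sum>k\<in>keys p. if k = b then lookup p b else 0)"
    by (rule sum.cong) (auto simp: lookup_single when_def)
  then show "lookup p b =
      lookup (\<Sum>k\<in>keys p. single k (lookup p k)) b"
    by (simp add: lookup_sum sum.delta in_keys_iff)
qed

lemma lookup_single_times:
  fixes p :: "'e::cancel_comm_monoid_add \<Rightarrow>\<^sub>0 'k::comm_semiring_1"
  shows "lookup (single b c * p) (b + k) = c * lookup p k"
proof -
  have "lookup (single b c * p) (b + k) =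
      (\<Sum>l. (c * (\<Sum>q. lookup p q when b + k = l + q)) when b = l)"
    by (simp add: lookup_mult lookup_single when_mult)
  also have "\<dots> = c * (\<Sum>q. lookup p q when k = q)"
    by simp
  also have "\<dots> = c * lookup p k" by simp
  finally show ?thesis .
qed

lemma single_mult_left_cancel:
  fixes p q :: "'e::cancel_comm_monoid_add \<Rightarrow>\<^sub>0 'k::comm_ring_1"
  assumes "monomial b * p = monomial b * q"
  shows "p = q"
proof (rule poly_mapping_eqI)
  fix k
  show "lookup p k = lookup q k"
    using arg_cong[OF assms, of "\<lambda>p. lookup p (b + k)"] by (simp add: lookup_single_times)
qed

text \<open>No other pair of monomials of \<open>f\<close> and \<open>g\<close> contributes to the coefficient at \<open>x + y\<close>.\<close>

lemma lookup_mult_unique: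
  fixes f g :: "'e::cancel_comm_monoid_add \<Rightarrow>\<^sub>0 'k::comm_ring_1"
  assumes unique: "\<And>x' y'. x' \<in> keys f \<Longrightarrow> y' \<in> keys g \<Longrightarrow> x' + y' = x + y \<Longrightarrow> x' = x"
  shows "lookup (f * g) (x + y) = lookup f x * lookup g y"
proof -
  define f' where "f' = f - single x (lookup f x)"
  have keys_f': "keys f' \<subseteq> keys f - {x}"
    by (auto simp: f'_def in_keys_iff lookup_minus lookup_single when_def split: if_splits)
  have "x + y \<notin> keys (f' * g)"
    using keys_mult[of f' g] keys_f' unique by fastforce
  then have "lookup (f' * g) (x + y) = 0" by (simp add: in_keys_iff)
  moreover have "f * g = single x (lookup f x) * g + f' * g"
    by (simp add: f'_def algebra_simps)
  ultimately show ?thesis by (simp add: lookup_add lookup_single_times)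
qed

lemma monomial_mult: "monomial a * monomial b = (monomial (a + b) :: 'e::monoid_add \<Rightarrow>\<^sub>0 'k::semiring_1)"
  by (simp add: mult_single)

lemma supported_on_mono: "U \<subseteq> V \<Longrightarrow> supported_on U \<subseteq> supported_on V"
  by (auto simp: supported_on_def)

lemma single_supported_on: "b \<in> U \<Longrightarrow> single b c \<in> supported_on U"
  by (simp add: supported_on_def)

lemma monomial_supported_on_iff [simp]: "monomial b \<in> supported_on U \<longleftrightarrow> b \<in> U"
  by (simp add: supported_on_def)

lemma supported_on_inject:
  "supported_on U = (supported_on V :: ('e \<Rightarrow>\<^sub>0 'k::zero_neq_one) set) \<longleftrightarrow> U = V"
proof
  assume "supported_on U = (supported_on V :: ('e \<Rightarrow>\<^sub>0 'k) set)"
  then have "monomial b \<in> (supported_on U :: ('e \<Rightarrow>\<^sub>0 'k) set) \<longleftrightarrow> monomial b \<in> (supported_on V :: ('e \<Rightarrow>\<^sub>0 'k) set)" for b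
    by simp
  then show "U = V" by auto
qed simp

lemma supported_on_add:
  fixes p q :: "'e \<Rightarrow>\<^sub>0 'k::comm_monoid_add"
  shows "p \<in> supported_on U \<Longrightarrow> q \<in> supported_on U \<Longrightarrow> p + q \<in> supported_on U"
  using keys_add[of p q] by (auto simp: supported_on_def)

lemma supported_on_mult:
  fixes p q :: "'e::monoid_add \<Rightarrow>\<^sub>0 'k::semiring_0"
  assumes "p \<in> supported_on U" "q \<in> supported_on V"
  shows "p * q \<in> supported_on (U + V)"
  using keys_mult[of p q] assms unfolding supported_on_def by (fastforce intro: set_plus_intro)

locale vector_monoid =
  fixes S :: "(nat ^ 'd) set"
  assumes zero_in [simp]: "0 \<in> S"
    and add_in: "a \<in> S \<Longrightarrow> b \<in> S \<Longrightarrow> a + b \<in> S"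
begin

lemma semigroup_ring_eq: "semigroup_ring S = ring_on (supported_on S)"
  by (simp add: semigroup_ring_def ring_on_def supported_on_def)

lemma unital_subring: "unital_subring (supported_on S :: ('d, 'k::field) mpoly set)"
proof
  fix p q :: "('d, 'k) mpoly"
  assume p: "p \<in> supported_on S"
  show "- p \<in> supported_on S" using p by (auto simp: supported_on_def in_keys_iff)
  assume q: "q \<in> supported_on S"
  show "p + q \<in> supported_on S" using p q by (rule supported_on_add)
  have "S + S \<subseteq> S" using add_in by (auto elim!: set_plus_elim)
  then show "p * q \<in> supported_on S"
    using supported_on_mult[OF p q] supported_on_mono by blast
qed (simp add: supported_on_def)

lemma set_plus_S: "U \<subseteq> S \<Longrightarrow> U + S \<subseteq> S"
  using add_in by (auto elim!: set_plus_elim)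

lemma subset_set_plus_S: "U \<subseteq> U + S"
  using set_plus_intro[OF _ zero_in, of _ U] by auto

lemma plus_S_idem: "S + S = S"
  using set_plus_S[of S] subset_set_plus_S[of S] by auto

lemma ideal_supported_on:
  assumes "U \<subseteq> S" "U + S \<subseteq> U"
  shows "ideal (supported_on U :: ('d, 'k::field) mpoly set) (semigroup_ring S)"
proof -
  interpret unital_subring "supported_on S :: ('d, 'k) mpoly set" by (rule unital_subring)
  show ?thesis
    unfolding semigroup_ring_eq ideal_iff
  proof (intro conjI ballI)
    show "supported_on U \<subseteq> (supported_on S :: ('d, 'k) mpoly set)"
      using assms(1) by (rule supported_on_mono)
    show "r * x \<in> supported_on U" if "r \<in> supported_on S" "x \<in> supported_on U" for r x :: "('d, 'k) mpoly"
      using supported_on_mult[OF that(2,1)] supported_on_mono[OF assms(2)] by (auto simp: mult.commute)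
  qed (auto simp: supported_on_add, simp add: supported_on_def)
qed

lemma supported_on_least:
  fixes I :: "('d, 'k::field) mpoly set"
  assumes I: "ideal I (semigroup_ring S)" and U: "\<And>u. u \<in> U \<Longrightarrow> monomial u \<in> I"
  shows "supported_on U \<subseteq> I"
proof
  interpret unital_subring "supported_on S :: ('d, 'k) mpoly set" by (rule unital_subring)
  note I' = idealD[OF I[unfolded semigroup_ring_eq]]
  fix p :: "('d, 'k) mpoly" assume p: "p \<in> supported_on U"
  have monom: "single k c \<in> I" if "k \<in> U" for k c
    using I'(6)[OF _ U[OF that], of "single 0 c"] by (simp add: mult_single single_supported_on)
  have "(\<Sum>k\<in>K. single k (lookup p k)) \<in> I" if "K \<subseteq> U" "finite K" for K
    using that(2,1) by (induction K rule: finite_induct) (auto simp: I'(2,3) monom)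
  from this[of "keys p"] show "p \<in> I"
    using p poly_mapping_sum_single[of p] by (simp add: supported_on_def)
qed

lemma monomial_ideal_eq:
  assumes "A \<subseteq> S"
  shows "monomial_ideal S A = (supported_on (A + S) :: ('d, 'k::field) mpoly set)"
proof
  interpret unital_subring "supported_on S :: ('d, 'k) mpoly set" by (rule unital_subring)
  let ?M = "monomial ` A :: ('d, 'k) mpoly set"
  have M: "?M \<subseteq> supported_on S" using assms by auto
  have "(A + S) + S \<subseteq> A + S" by (simp add: add.assoc plus_S_idem)
  with set_plus_S[OF assms] have "ideal (supported_on (A + S)) (semigroup_ring S)"
    by (rule ideal_supported_on)
  moreover have "?M \<subseteq> supported_on (A + S)" using subset_set_plus_S[of A] by auto
  ultimately show "monomial_ideal S A \<subseteq> (supported_on (A + S) :: ('d, 'k) mpoly set)"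
    unfolding monomial_ideal_def semigroup_ring_eq by (rule genideal_least)
  have I: "ideal (monomial_ideal S A :: ('d, 'k) mpoly set) R"
    unfolding monomial_ideal_def semigroup_ring_eq by (rule genideal_ideal[OF M])
  show "supported_on (A + S) \<subseteq> (monomial_ideal S A :: ('d, 'k) mpoly set)"
  proof (rule supported_on_least)
    show "ideal (monomial_ideal S A :: ('d, 'k) mpoly set) (semigroup_ring S)"
      using I by (simp add: semigroup_ring_eq)
    fix u assume "u \<in> A + S"
    then obtain a b where u: "a \<in> A" "b \<in> S" "u = a + b" by (auto elim!: set_plus_elim)
    have "monomial a \<in> (monomial_ideal S A :: ('d, 'k) mpoly set)"
      using genideal_self[OF M] u(1) by (auto simp: monomial_ideal_def semigroup_ring_eq)
    from idealD(7)[OF I _ this, of "monomial b"] u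
    show "monomial u \<in> (monomial_ideal S A :: ('d, 'k) mpoly set)" by (simp add: monomial_mult)
  qed
qed

lemma ideal_prod_supported_on:
  assumes U: "U \<subseteq> S" "U + S \<subseteq> U" and V: "V \<subseteq> S" "V + S \<subseteq> V"
  shows "supported_on U \<cdot>\<^bsub>semigroup_ring S\<^esub> supported_on V = (supported_on (U + V) :: ('d, 'k::field) mpoly set)"
proof
  interpret unital_subring "supported_on S :: ('d, 'k) mpoly set" by (rule unital_subring)
  let ?UV = "supported_on U \<cdot>\<^bsub>semigroup_ring S\<^esub> supported_on V :: ('d, 'k) mpoly set"
  show "?UV \<subseteq> supported_on (U + V)"
  proof
    fix p :: "('d, 'k) mpoly" assume "p \<in> ?UV"
    then show "p \<in> supported_on (U + V)"
      by (induction p rule: ideal_prod.induct)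
        (auto simp: semigroup_ring_eq intro: supported_on_mult supported_on_add)
  qed
  show "supported_on (U + V) \<subseteq> ?UV"
  proof (rule supported_on_least)
    show "ideal ?UV (semigroup_ring S)"
      using ring.ideal_prod_is_ideal[OF ring] ideal_supported_on[OF U] ideal_supported_on[OF V]
      by (simp add: semigroup_ring_eq)
    fix w assume "w \<in> U + V"
    then obtain u v where w: "u \<in> U" "v \<in> V" "w = u + v" by (auto elim!: set_plus_elim)
    then have "monomial u \<otimes>\<^bsub>semigroup_ring S\<^esub> monomial v \<in> ?UV"
      by (intro ideal_prod.prod) simp_all
    then show "monomial w \<in> ?UV" using w by (simp add: semigroup_ring_eq monomial_mult)
  qed
qed

text \<open>For the exponent set \<open>U\<close> of a monomial ideal this is the exponent set of its \<open>n\<close>-th power; the start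
  value \<open>S\<close> belongs to the unit ideal.\<close>

definition fold_sum :: "(nat ^ 'd) set \<Rightarrow> nat \<Rightarrow> (nat ^ 'd) set" where
  "fold_sum U n = ((\<lambda>V. V + U) ^^ n) S"

lemma fold_sum_0 [simp]: "fold_sum U 0 = S"
  and fold_sum_Suc [simp]: "fold_sum U (Suc n) = fold_sum U n + U"
  by (simp_all add: fold_sum_def)

lemma fold_sum_ideal:
  assumes "U \<subseteq> S" "U + S \<subseteq> U"
  shows "fold_sum U n \<subseteq> S" "fold_sum U n + S \<subseteq> fold_sum U n"
proof -
  show "fold_sum U n \<subseteq> S"
    by (induction n) (use assms(1) add_in in \<open>auto elim!: set_plus_elim\<close>)
  have "U + S = U" using assms(2) subset_set_plus_S by auto
  then show "fold_sum U n + S \<subseteq> fold_sum U n"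
    by (cases n) (simp_all add: plus_S_idem add.assoc)
qed

lemma ideal_power_supported_on:
  assumes U: "U \<subseteq> S" "U + S \<subseteq> U"
  shows "ideal_power (semigroup_ring S) (supported_on U) n
    = (supported_on (fold_sum U n) :: ('d, 'k::field) mpoly set)"
proof (induction n)
  case 0
  have "ideal_power (semigroup_ring S) (supported_on U) 0 = carrier (semigroup_ring S :: ('d, 'k) mpoly ring)"
    by (simp add: nat_pow_def ideals_set_def)
  then show ?case by (simp add: semigroup_ring_eq)
next
  case (Suc n)
  have "ideal_power (semigroup_ring S) (supported_on U) (Suc n)
      = ideal_power (semigroup_ring S) (supported_on U) n \<cdot>\<^bsub>semigroup_ring S\<^esub> (supported_on U :: ('d, 'k) mpoly set)"
    by (simp add: nat_pow_def ideals_set_def)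
  then show ?case using Suc ideal_prod_supported_on[OF fold_sum_ideal[OF U] U] by simp
qed

end

section \<open>Lengths of quotient modules\<close>

context unital_subring
begin

lemma coset_eq_iff:
  assumes I: "ideal I R"
  shows "I +>\<^bsub>R\<^esub> p = I +>\<^bsub>R\<^esub> q \<longleftrightarrow> p - q \<in> I"
proof
  assume eq: "I +>\<^bsub>R\<^esub> p = I +>\<^bsub>R\<^esub> q"
  have "0 + p \<in> I +>\<^bsub>R\<^esub> p" using idealD(2)[OF I] by (auto simp: a_r_coset_def')
  then have "p \<in> I +>\<^bsub>R\<^esub> q" using eq by simp
  then obtain i where "i \<in> I" "p = i + q" by (auto simp: a_r_coset_def')
  then show "p - q \<in> I" by simp
next
  have sub: "I +>\<^bsub>R\<^esub> p \<subseteq> I +>\<^bsub>R\<^esub> q" if "p - q \<in> I" for p q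
  proof
    fix x assume "x \<in> I +>\<^bsub>R\<^esub> p"
    then obtain i where "i \<in> I" "x = i + p" by (auto simp: a_r_coset_def')
    then have "i + (p - q) \<in> I" "x = (i + (p - q)) + q" using idealD(3)[OF I _ that] by simp_all
    then show "x \<in> I +>\<^bsub>R\<^esub> q" unfolding a_r_coset_def' ring_on_simps by blast
  qed
  assume pq: "p - q \<in> I"
  then have "q - p \<in> I" using idealD(4)[OF I pq] by simp
  with pq show "I +>\<^bsub>R\<^esub> p = I +>\<^bsub>R\<^esub> q" using sub by blast
qed

lemma quotient_module_ops:
  assumes I: "ideal I R"
  shows "carrier (quotient_module R I) = (\<lambda>p. I +>\<^bsub>R\<^esub> p) ` B"
    and "zero (quotient_module R I) = I +>\<^bsub>R\<^esub> 0"
    and "p \<in> B \<Longrightarrow> q \<in> B \<Longrightarrow> add (quotient_module R I) (I +>\<^bsub>R\<^esub> p) (I +>\<^bsub>R\<^esub> q) = I +>\<^bsub>R\<^esub> (p + q)"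
    and "r \<in> B \<Longrightarrow> p \<in> B \<Longrightarrow> smult (quotient_module R I) r (I +>\<^bsub>R\<^esub> p) = I +>\<^bsub>R\<^esub> (r * p)"
proof -
  interpret I: ideal I R by (rule I)
  show "carrier (quotient_module R I) = (\<lambda>p. I +>\<^bsub>R\<^esub> p) ` B"
    by (auto simp: quotient_module_def ring.defs module.defs FactRing_def A_RCOSETS_def')
  have "I +>\<^bsub>R\<^esub> 0 = I" by (simp add: a_r_coset_def')
  then show "zero (quotient_module R I) = I +>\<^bsub>R\<^esub> 0"
    by (simp add: quotient_module_def ring.defs module.defs FactRing_def)
  show "add (quotient_module R I) (I +>\<^bsub>R\<^esub> p) (I +>\<^bsub>R\<^esub> q) = I +>\<^bsub>R\<^esub> (p + q)" if "p \<in> B" "q \<in> B"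
    using I.a_rcos_sum[of p q] that
    by (simp add: quotient_module_def ring.defs module.defs FactRing_def)
  show "smult (quotient_module R I) r (I +>\<^bsub>R\<^esub> p) = I +>\<^bsub>R\<^esub> (r * p)" if "r \<in> B" "p \<in> B"
    using I.rcoset_mult_add[of r p] that
    by (simp add: quotient_module_def ring.defs module.defs FactRing_def)
qed

lemma submodule_imp_ideal:
  assumes I: "ideal I R" and N: "submodule N R (quotient_module R I)"
  shows "ideal {p \<in> B. I +>\<^bsub>R\<^esub> p \<in> N} R" "I \<subseteq> {p \<in> B. I +>\<^bsub>R\<^esub> p \<in> N}"
    "N = (\<lambda>p. I +>\<^bsub>R\<^esub> p) ` {p \<in> B. I +>\<^bsub>R\<^esub> p \<in> N}"
proof -
  note ops = quotient_module_ops[OF I]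
  note sub = submodule.axioms(1)[OF N]
  have zero: "I +>\<^bsub>R\<^esub> 0 \<in> N" using subgroup.one_closed[OF sub] ops(2) by simp
  show "ideal {p \<in> B. I +>\<^bsub>R\<^esub> p \<in> N} R"
    unfolding ideal_iff
  proof (intro conjI ballI)
    show "0 \<in> {p \<in> B. I +>\<^bsub>R\<^esub> p \<in> N}" using zero by simp
    show "p + q \<in> {p \<in> B. I +>\<^bsub>R\<^esub> p \<in> N}"
      if "p \<in> {p \<in> B. I +>\<^bsub>R\<^esub> p \<in> N}" "q \<in> {p \<in> B. I +>\<^bsub>R\<^esub> p \<in> N}" for p q
      using subgroup.m_closed[OF sub, of "I +>\<^bsub>R\<^esub> p" "I +>\<^bsub>R\<^esub> q"] that by (simp add: ops(3))
    show "r * p \<in> {p \<in> B. I +>\<^bsub>R\<^esub> p \<in> N}" if "r \<in> B" "p \<in> {p \<in> B. I +>\<^bsub>R\<^esub> p \<in> N}" for r p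
      using submodule.smult_closed[OF N, of r "I +>\<^bsub>R\<^esub> p"] that by (simp add: ops(4))
  qed auto
  show "I \<subseteq> {p \<in> B. I +>\<^bsub>R\<^esub> p \<in> N}"
  proof
    fix p assume p: "p \<in> I"
    then have "I +>\<^bsub>R\<^esub> p = I +>\<^bsub>R\<^esub> 0" by (simp add: coset_eq_iff[OF I])
    then show "p \<in> {p \<in> B. I +>\<^bsub>R\<^esub> p \<in> N}" using zero p idealD(1)[OF I] by auto
  qed
  have "N \<subseteq> (\<lambda>p. I +>\<^bsub>R\<^esub> p) ` B" using subgroup.subset[OF sub] ops(1) by simp
  then show "N = (\<lambda>p. I +>\<^bsub>R\<^esub> p) ` {p \<in> B. I +>\<^bsub>R\<^esub> p \<in> N}" by auto
qed

lemma ideal_imp_submodule: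
  assumes I: "ideal I R" and K: "ideal K R"
  shows "submodule ((\<lambda>p. I +>\<^bsub>R\<^esub> p) ` K) R (quotient_module R I)"
proof -
  note ops = quotient_module_ops[OF I]
  note K' = idealD[OF K]
  have KB: "p \<in> B" if "p \<in> K" for p using that K'(1) by auto
  interpret I: ideal I R by (rule I)
  have "abelian_group (quotient_module R I)"
  proof (rule abelian_groupI)
    show "\<exists>y\<in>carrier (quotient_module R I). y \<oplus>\<^bsub>quotient_module R I\<^esub> x = \<zero>\<^bsub>quotient_module R I\<^esub>"
      if x: "x \<in> carrier (quotient_module R I)" for x
    proof -
      obtain p where p: "p \<in> B" "x = I +>\<^bsub>R\<^esub> p" using x ops(1) by auto
      then show ?thesis using ops by (intro bexI[of _ "I +>\<^bsub>R\<^esub> (- p)"]) auto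
    qed
    fix x y z
    assume "x \<in> carrier (quotient_module R I)" "y \<in> carrier (quotient_module R I)" "z \<in> carrier (quotient_module R I)"
    then obtain p q r where "p \<in> B" "x = I +>\<^bsub>R\<^esub> p" "q \<in> B" "y = I +>\<^bsub>R\<^esub> q" "r \<in> B" "z = I +>\<^bsub>R\<^esub> r"
      unfolding ops(1) by auto
    then show "(x \<oplus>\<^bsub>quotient_module R I\<^esub> y) \<oplus>\<^bsub>quotient_module R I\<^esub> z =
        x \<oplus>\<^bsub>quotient_module R I\<^esub> (y \<oplus>\<^bsub>quotient_module R I\<^esub> z)"
      by (simp add: ops(3) add.assoc)
  next
    fix x y
    assume "x \<in> carrier (quotient_module R I)" "y \<in> carrier (quotient_module R I)"
    then obtain p q where "p \<in> B" "x = I +>\<^bsub>R\<^esub> p" "q \<in> B" "y = I +>\<^bsub>R\<^esub> q"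
      unfolding ops(1) by auto
    then show "x \<oplus>\<^bsub>quotient_module R I\<^esub> y = y \<oplus>\<^bsub>quotient_module R I\<^esub> x"
      "x \<oplus>\<^bsub>quotient_module R I\<^esub> y \<in> carrier (quotient_module R I)"
      by (simp_all add: ops(1,3) add.commute)
  next
    show "\<zero>\<^bsub>quotient_module R I\<^esub> \<in> carrier (quotient_module R I)" by (simp add: ops(1,2))
    fix x assume "x \<in> carrier (quotient_module R I)"
    then obtain p where "p \<in> B" "x = I +>\<^bsub>R\<^esub> p" unfolding ops(1) by auto
    then show "\<zero>\<^bsub>quotient_module R I\<^esub> \<oplus>\<^bsub>quotient_module R I\<^esub> x = x"
      by (simp add: ops(2,3))
  qed
  then have group: "group (add_monoid (quotient_module R I))"
    by (rule abelian_group.a_group)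
  have inv: "inv\<^bsub>add_monoid (quotient_module R I)\<^esub> (I +>\<^bsub>R\<^esub> p) = I +>\<^bsub>R\<^esub> (- p)" if "p \<in> K" for p
    by (rule group.inv_equality[OF group]) (use ops that KB in auto)
  show ?thesis
  proof (intro submodule.intro subgroup.intro submodule_axioms.intro)
    show "(\<lambda>p. I +>\<^bsub>R\<^esub> p) ` K \<subseteq> carrier (add_monoid (quotient_module R I))"
      using ops(1) KB by auto
    show "x \<otimes>\<^bsub>add_monoid (quotient_module R I)\<^esub> y \<in> (\<lambda>p. I +>\<^bsub>R\<^esub> p) ` K"
      if "x \<in> (\<lambda>p. I +>\<^bsub>R\<^esub> p) ` K" "y \<in> (\<lambda>p. I +>\<^bsub>R\<^esub> p) ` K" for x y
      using that ops(3) KB K'(3) by auto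
    show "\<one>\<^bsub>add_monoid (quotient_module R I)\<^esub> \<in> (\<lambda>p. I +>\<^bsub>R\<^esub> p) ` K"
      using ops(2) K'(2) by auto
    show "inv\<^bsub>add_monoid (quotient_module R I)\<^esub> x \<in> (\<lambda>p. I +>\<^bsub>R\<^esub> p) ` K"
      if "x \<in> (\<lambda>p. I +>\<^bsub>R\<^esub> p) ` K" for x
      using that inv K'(4) by auto
    show "smult (quotient_module R I) r x \<in> (\<lambda>p. I +>\<^bsub>R\<^esub> p) ` K"
      if "r \<in> carrier R" "x \<in> (\<lambda>p. I +>\<^bsub>R\<^esub> p) ` K" for r x
      using that ops(4) KB K'(6) by auto
  qed
qed

text \<open>The submodules of \<open>R/I\<close> correspond to the ideals of \<open>R\<close> that contain \<open>I\<close>.\<close>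

lemma module_length_quotient:
  assumes I: "ideal I R"
  shows "module_length R (quotient_module R I) =
    (SUP n\<in>{n. \<exists>K. (\<forall>i\<le>n. ideal (K i) R \<and> I \<subseteq> K i) \<and> (\<forall>i<n. K i \<subset> K (Suc i))}. enat n)"
proof -
  have "(\<exists>N. (\<forall>i\<le>n. submodule (N i) R (quotient_module R I)) \<and> (\<forall>i<n. N i \<subset> N (Suc i))) \<longleftrightarrow>
      (\<exists>K. (\<forall>i\<le>n. ideal (K i) R \<and> I \<subseteq> K i) \<and> (\<forall>i<n. K i \<subset> K (Suc i)))" for n
  proof
    assume "\<exists>N. (\<forall>i\<le>n. submodule (N i) R (quotient_module R I)) \<and> (\<forall>i<n. N i \<subset> N (Suc i))"
    then obtain N where N: "\<And>i. i \<le> n \<Longrightarrow> submodule (N i) R (quotient_module R I)"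
      "\<And>i. i < n \<Longrightarrow> N i \<subset> N (Suc i)" by auto
    define K where "K i = {p \<in> B. I +>\<^bsub>R\<^esub> p \<in> N i}" for i
    have K: "ideal (K i) R" "I \<subseteq> K i" "N i = (\<lambda>p. I +>\<^bsub>R\<^esub> p) ` K i" if "i \<le> n" for i
      using submodule_imp_ideal[OF I N(1)[OF that]] by (simp_all add: K_def)
    have "K i \<subset> K (Suc i)" if "i < n" for i
    proof
      show "K i \<subseteq> K (Suc i)" using N(2)[OF that] by (auto simp: K_def)
      show "K i \<noteq> K (Suc i)"
        using N(2)[OF that] K(3)[of i] K(3)[of "Suc i"] that by auto
    qed
    with K show "\<exists>K. (\<forall>i\<le>n. ideal (K i) R \<and> I \<subseteq> K i) \<and> (\<forall>i<n. K i \<subset> K (Suc i))" by auto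
  next
    assume "\<exists>K. (\<forall>i\<le>n. ideal (K i) R \<and> I \<subseteq> K i) \<and> (\<forall>i<n. K i \<subset> K (Suc i))"
    then obtain K where K: "\<And>i. i \<le> n \<Longrightarrow> ideal (K i) R" "\<And>i. i \<le> n \<Longrightarrow> I \<subseteq> K i"
      "\<And>i. i < n \<Longrightarrow> K i \<subset> K (Suc i)" by auto
    define N where "N i = (\<lambda>p. I +>\<^bsub>R\<^esub> p) ` K i" for i
    have "N i \<subset> N (Suc i)" if i: "i < n" for i
    proof
      show "N i \<subseteq> N (Suc i)" using K(3)[OF i] by (auto simp: N_def)
      obtain p where p: "p \<in> K (Suc i)" "p \<notin> K i" using K(3)[OF i] by auto
      have "I +>\<^bsub>R\<^esub> p \<notin> N i"
      proof
        assume "I +>\<^bsub>R\<^esub> p \<in> N i"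
        then obtain q where q: "q \<in> K i" "I +>\<^bsub>R\<^esub> p = I +>\<^bsub>R\<^esub> q" by (auto simp: N_def)
        then have "p - q \<in> K i" using K(2)[of i] i coset_eq_iff[OF I] by auto
        from idealD(3)[OF K(1) this q(1)] i have "p - q + q \<in> K i" by simp
        then show False using p by simp
      qed
      then show "N i \<noteq> N (Suc i)" using p by (auto simp: N_def)
    qed
    moreover have "submodule (N i) R (quotient_module R I)" if "i \<le> n" for i
      unfolding N_def by (rule ideal_imp_submodule[OF I K(1)[OF that]])
    ultimately show "\<exists>N. (\<forall>i\<le>n. submodule (N i) R (quotient_module R I)) \<and> (\<forall>i<n. N i \<subset> N (Suc i))"
      by auto
  qed
  then show ?thesis unfolding module_length_def by simp
qed

end

section \<open>Linear algebra with monomials\<close>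

text \<open>Scalars act as constant polynomials.\<close>

interpretation pm: vector_space "\<lambda>c (p :: 'e::comm_monoid_add \<Rightarrow>\<^sub>0 'k::field). single 0 c * p"
  by unfold_locales (simp_all add: distrib_left distrib_right single_add mult_single mult.assoc[symmetric])

lemma lookup_scale [simp]:
  fixes p :: "'e::cancel_comm_monoid_add \<Rightarrow>\<^sub>0 'k::field"
  shows "lookup (single 0 c * p) k = c * lookup p k"
  using lookup_single_times[of 0 c p k] by simp

lemma monomial_eq_iff [simp]: "(monomial x :: 'e \<Rightarrow>\<^sub>0 'k::zero_neq_one) = monomial y \<longleftrightarrow> x = y"
proof
  assume "(monomial x :: 'e \<Rightarrow>\<^sub>0 'k) = monomial y"
  then have "keys (monomial x :: 'e \<Rightarrow>\<^sub>0 'k) = keys (monomial y :: 'e \<Rightarrow>\<^sub>0 'k)" by simp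
  then show "x = y" by simp
qed simp

lemma inj_monomial: "inj_on (monomial :: 'e \<Rightarrow> 'e \<Rightarrow>\<^sub>0 'k::zero_neq_one) U"
  by (simp add: inj_on_def)

lemma independent_monomials:
  "pm.independent (monomial ` U :: ('e::cancel_comm_monoid_add \<Rightarrow>\<^sub>0 'k::field) set)"
  unfolding pm.independent_explicit_finite_subsets
proof (intro allI impI ballI)
  fix T u v
  assume T: "T \<subseteq> monomial ` U" "finite T" "(\<Sum>v\<in>T. single 0 (u v) * v) = (0 :: 'e \<Rightarrow>\<^sub>0 'k)" "v \<in> T"
  obtain b where b: "v = monomial b" using T by auto
  have "0 = lookup (\<Sum>v\<in>T. single 0 (u v) * v) b" using T(3) by simp
  also have "\<dots> = (\<Sum>w\<in>T. u w * lookup w b)" by (simp add: lookup_sum)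
  also have "\<dots> = (\<Sum>w\<in>T. if w = v then u v else 0)"
  proof (rule sum.cong[OF refl])
    fix w assume "w \<in> T"
    then obtain c where "w = monomial c" using T(1) by auto
    then show "u w * lookup w b = (if w = v then u v else 0)"
      by (auto simp: b lookup_single when_def)
  qed
  also have "\<dots> = u v" using T by simp
  finally show "u v = 0" by simp
qed

lemma span_monomials:
  "pm.span (monomial ` U) = (supported_on U :: ('e::cancel_comm_monoid_add \<Rightarrow>\<^sub>0 'k::field) set)"
proof
  show "pm.span (monomial ` U) \<subseteq> (supported_on U :: ('e \<Rightarrow>\<^sub>0 'k) set)"
  proof (rule pm.span_minimal)
    show "pm.subspace (supported_on U :: ('e \<Rightarrow>\<^sub>0 'k) set)"
    proof (rule pm.subspaceI)
      show "0 \<in> (supported_on U :: ('e \<Rightarrow>\<^sub>0 'k) set)" by (simp add: supported_on_def)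
      show "single 0 c * p \<in> supported_on U" if "p \<in> supported_on U" for c and p :: "'e \<Rightarrow>\<^sub>0 'k"
        using that unfolding supported_on_def by (auto simp: in_keys_iff)
    qed (rule supported_on_add)
    show "monomial ` U \<subseteq> (supported_on U :: ('e \<Rightarrow>\<^sub>0 'k) set)" by auto
  qed
  show "supported_on U \<subseteq> pm.span (monomial ` U :: ('e \<Rightarrow>\<^sub>0 'k) set)"
  proof
    fix p :: "'e \<Rightarrow>\<^sub>0 'k" assume p: "p \<in> supported_on U"
    have monom: "single k c \<in> pm.span (monomial ` U)" if "k \<in> U" for k and c :: 'k
      using pm.span_scale[OF pm.span_base, of "monomial k" "monomial ` U" c] that by (simp add: mult_single)
    have "(\<Sum>k\<in>keys p. single k (lookup p k)) \<in> pm.span (monomial ` U)"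
      by (rule pm.span_sum, rule monom) (use p in \<open>auto simp: supported_on_def\<close>)
    then show "p \<in> pm.span (monomial ` U)" unfolding poly_mapping_sum_single[symmetric] .
  qed
qed

definition restrict_to :: "'e set \<Rightarrow> ('e \<Rightarrow>\<^sub>0 'k::comm_monoid_add) \<Rightarrow> ('e \<Rightarrow>\<^sub>0 'k)" where
  "restrict_to U p = (\<Sum>k\<in>keys p \<inter> U. single k (lookup p k))"

lemma lookup_restrict_to:
  "lookup (restrict_to U p) k = (lookup p k when k \<in> U)"
proof -
  have "lookup (restrict_to U p) k = (\<Sum>j\<in>keys p \<inter> U. if j = k then lookup p k else 0)"
    unfolding restrict_to_def lookup_sum by (rule sum.cong) (auto simp: lookup_single when_def)
  also have "\<dots> = (lookup p k when k \<in> U)"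
    by (auto simp: sum.delta when_def in_keys_iff)
  finally show ?thesis .
qed

lemma restrict_to_add: "restrict_to U (p + q) = restrict_to U p + restrict_to U q"
  by (rule poly_mapping_eqI) (simp add: lookup_restrict_to lookup_add when_add_distrib)

lemma restrict_to_supported_on: "restrict_to U p \<in> supported_on U"
  by (auto simp: supported_on_def in_keys_iff lookup_restrict_to)

lemma restrict_to_monomial: "b \<in> U \<Longrightarrow> restrict_to U (monomial b) = (monomial b :: 'e \<Rightarrow>\<^sub>0 'k::field)"
  by (rule poly_mapping_eqI) (auto simp: lookup_restrict_to lookup_single when_def)

context vector_monoid
begin

text \<open>The total degree of the corresponding monomial.\<close>

definition weight :: "nat ^ 'd \<Rightarrow> nat" where
  "weight b = (\<Sum>i\<in>UNIV. b $ i)"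

lemma weight_add [simp]: "weight (a + b) = weight a + weight b"
  by (simp add: weight_def sum.distrib)

lemma weight_eq_0_iff [simp]: "weight b = 0 \<longleftrightarrow> b = 0"
  by (auto simp: weight_def vec_eq_iff)

lemma weight_sum: "weight (\<Sum>i\<in>X. f i) = (\<Sum>i\<in>X. weight (f i))"
  by (induction X rule: infinite_finite_induct) simp_all

text \<open>Ideals are linear subspaces, so the steps of a chain of ideals above \<open>I\<close> yield linearly independent
  polynomials supported on the exponents that are missing in \<open>I\<close>. Conversely, adding the missing exponents
  one by one gives a chain of this length.\<close>

lemma module_length_supported_on:
  assumes U: "U \<subseteq> S" "U + S \<subseteq> U" and fin: "finite (S - U)"
  shows "module_length (semigroup_ring S) (quotient_module (semigroup_ring S)
    (supported_on U :: ('d, 'k::field) mpoly set)) = card (S - U)"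
proof -
  interpret unital_subring "supported_on S :: ('d, 'k) mpoly set" by (rule unital_subring)
  let ?I = "supported_on U :: ('d, 'k) mpoly set"
  have I: "ideal ?I R"
    using ideal_supported_on[OF U] unfolding semigroup_ring_eq .
  let ?C = "{n. \<exists>K. (\<forall>i\<le>n. ideal (K i) R \<and> ?I \<subseteq> K i) \<and> (\<forall>i<n. K i \<subset> K (Suc i))}"
  have upper: "n \<le> card (S - U)" if "n \<in> ?C" for n
  proof -
    from that obtain K where K: "\<And>i. i \<le> n \<Longrightarrow> ideal (K i) R" "\<And>i. i \<le> n \<Longrightarrow> ?I \<subseteq> K i"
      "\<And>i. i < n \<Longrightarrow> K i \<subset> K (Suc i)" by auto
    have subspace: "pm.subspace (K i)" if "i \<le> n" for i
      using idealD(2,3)[OF K(1)[OF that]] idealD(6)[OF K(1)[OF that] single_supported_on[OF zero_in]]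
      by (intro pm.subspaceI) auto
    have "\<exists>p. p \<in> K (Suc i) \<and> p \<notin> K i \<and> p \<in> supported_on (S - U)" if i: "i < n" for i
    proof -
      obtain p where p: "p \<in> K (Suc i)" "p \<notin> K i" using K(3)[OF i] by auto
      have "p \<in> supported_on S" using idealD(1)[OF K(1)[of "Suc i"]] p(1) i by auto
      then have "x \<in> S" if "lookup p x \<noteq> 0" for x
        using that by (auto simp: supported_on_def in_keys_iff)
      then have "p - restrict_to (S - U) p \<in> ?I"
        by (auto simp: supported_on_def in_keys_iff lookup_minus lookup_restrict_to when_def split: if_splits)
      then have *: "p - restrict_to (S - U) p \<in> K i" "p - restrict_to (S - U) p \<in> K (Suc i)"
        using subsetD[OF K(2)[of i]] subsetD[OF K(2)[of "Suc i"]] i by simp_all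
      from idealD(5)[OF K(1) p(1) *(2)] i have "restrict_to (S - U) p \<in> K (Suc i)" by simp
      moreover have "restrict_to (S - U) p \<notin> K i"
        using idealD(3)[OF K(1) *(1), of "restrict_to (S - U) p"] p(2) i by auto
      ultimately show ?thesis using restrict_to_supported_on by auto
    qed
    then obtain q where q: "\<And>i. i < n \<Longrightarrow> q i \<in> K (Suc i) \<and> q i \<notin> K i \<and> q i \<in> supported_on (S - U)"
      by metis
    have "pm.independent (q ` {..<i}) \<and> q ` {..<i} \<subseteq> K i \<and> card (q ` {..<i}) = i" if "i \<le> n" for i
      using that
    proof (induction i)
      case (Suc i)
      then have IH: "pm.independent (q ` {..<i})" "q ` {..<i} \<subseteq> K i" "card (q ` {..<i}) = i" by auto
      have "pm.span (q ` {..<i}) \<subseteq> K i" using IH(2) subspace[of i] Suc.prems by (intro pm.span_minimal) auto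
      then have "q i \<notin> pm.span (q ` {..<i})" using q[of i] Suc.prems by auto
      moreover from this have "q i \<notin> q ` {..<i}" by (rule contrapos_nn[OF _ pm.span_base])
      moreover have "insert (q i) (q ` {..<i}) \<subseteq> K (Suc i)"
        using IH(2) K(3)[of i] q[of i] Suc.prems by auto
      ultimately show ?case using IH by (simp add: lessThan_Suc pm.independent_insertI)
    qed (simp add: pm.independent_empty)
    from this[of n] have ind: "pm.independent (q ` {..<n})" "card (q ` {..<n}) = n" by auto
    have "q ` {..<n} \<subseteq> pm.span (monomial ` (S - U))" using q by (auto simp: span_monomials)
    from conjunct2[OF pm.independent_span_bound[OF finite_imageI[OF fin] ind(1) this]] ind(2)
    have "n \<le> card (monomial ` (S - U) :: ('d, 'k) mpoly set)" by simp
    then show ?thesis by (simp add: card_image inj_monomial)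
  qed
  have lower: "card (S - U) \<in> ?C"
  proof -
    \<comment> \<open>In the order of decreasing weight, all multiples of an exponent precede it.\<close>
    define bs where "bs = rev (sort_key weight (SOME xs. set xs = S - U \<and> distinct xs))"
    have "set (SOME xs. set xs = S - U \<and> distinct xs) = S - U \<and> distinct (SOME xs. set xs = S - U \<and> distinct xs)"
      by (rule someI_ex) (use finite_distinct_list[OF fin] in auto)
    then have bs: "set bs = S - U" "distinct bs" "sorted (rev (map weight bs))"
      by (simp_all add: bs_def rev_map[symmetric])
    define n where "n = card (S - U)"
    have len: "length bs = n" using distinct_card[OF bs(2)] bs(1) by (simp add: n_def)
    have weight_le: "weight (bs ! j) \<le> weight (bs ! i)" if "i \<le> j" "j < n" for i j
      using sorted_rev_nth_mono[OF bs(3), of i j] that len by simp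
    define V where "V i = U \<union> set (take i bs)" for i
    have VS: "V i \<subseteq> S" for i
      using U(1) bs(1) set_take_subset[of i bs] by (auto simp: V_def)
    have "V i + S \<subseteq> V i" if "i \<le> n" for i
    proof
      fix x assume "x \<in> V i + S"
      then obtain v s where x: "v \<in> V i" "s \<in> S" "x = v + s" by (auto elim!: set_plus_elim)
      show "x \<in> V i"
      proof (cases "s = 0 \<or> v \<in> U \<or> x \<in> U")
        case True
        then show ?thesis using x U(2) by (auto simp: V_def)
      next
        case False
        then obtain j where j: "v = bs ! j" "j < i" using x(1) that len by (auto simp: V_def in_set_conv_nth)
        have "x \<in> set bs" using x False VS[of i] add_in bs(1) by auto
        then obtain l where l: "x = bs ! l" "l < n" using len by (auto simp: in_set_conv_nth)
        have "weight v < weight x" using x(3) False by (metis less_add_same_cancel1 weight_add weight_eq_0_iff zero_less_iff_neq_zero)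
        then have "\<not> j \<le> l" using weight_le[of j l] j l by auto
        then have "x \<in> set (take i bs)" using l j that len by (auto simp: in_set_conv_nth intro!: exI[of _ l])
        then show ?thesis by (simp add: V_def)
      qed
    qed
    then have "ideal (supported_on (V i) :: ('d, 'k) mpoly set) R" if "i \<le> n" for i
      using ideal_supported_on[OF VS, of i] that unfolding semigroup_ring_eq by auto
    moreover have "?I \<subseteq> supported_on (V i)" for i
      by (rule supported_on_mono) (auto simp: V_def)
    moreover have "supported_on (V i) \<subset> (supported_on (V (Suc i)) :: ('d, 'k) mpoly set)" if "i < n" for i
    proof -
      have "bs ! i \<notin> V i"
        using bs that len nth_mem[of i bs] by (auto simp: V_def in_set_conv_nth nth_eq_iff_index_eq)
      moreover have "V (Suc i) = insert (bs ! i) (V i)"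
        using that len by (auto simp: V_def take_Suc_conv_app_nth)
      ultimately have "V i \<subseteq> V (Suc i)" "V i \<noteq> V (Suc i)" by auto
      then show ?thesis
        by (intro psubsetI supported_on_mono) (simp_all add: supported_on_inject)
    qed
    ultimately have "(\<forall>i\<le>n. ideal (supported_on (V i) :: ('d, 'k) mpoly set) R \<and> ?I \<subseteq> supported_on (V i)) \<and>
        (\<forall>i<n. supported_on (V i) \<subset> (supported_on (V (Suc i)) :: ('d, 'k) mpoly set))"
      by simp
    then show ?thesis
      unfolding n_def[symmetric] by (intro CollectI exI[of _ "\<lambda>i. supported_on (V i)"])
  qed
  have "(SUP n\<in>?C. enat n) = enat (card (S - U))"
  proof (rule antisym)
    show "(SUP n\<in>?C. enat n) \<le> enat (card (S - U))"
    proof (rule SUP_least)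
      fix n assume "n \<in> ?C"
      then show "enat n \<le> enat (card (S - U))" unfolding enat_ord_simps by (rule upper)
    qed
    show "enat (card (S - U)) \<le> (SUP n\<in>?C. enat n)" using lower by (rule SUP_upper)
  qed
  then show ?thesis
    using module_length_quotient[OF I] unfolding semigroup_ring_eq by simp
qed


text \<open>An ideal that is larger than the ideal of the nonzero exponents contains an element with nonzero
  constant term, hence a nonzero constant.\<close>

lemma primeideal_maximal:
  "primeideal (supported_on (S - {0}) :: ('d, 'k::field) mpoly set) (semigroup_ring S)"
  "maximalideal (supported_on (S - {0}) :: ('d, 'k::field) mpoly set) (semigroup_ring S)"
proof -
  interpret unital_subring "supported_on S :: ('d, 'k) mpoly set" by (rule unital_subring)
  let ?m = "supported_on (S - {0}) :: ('d, 'k) mpoly set"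
  have "a + b \<noteq> 0" if "a \<noteq> 0" for a b :: "nat ^ 'd"
    using that weight_add[of a b] weight_eq_0_iff by (metis add_is_0)
  then have m: "ideal ?m (semigroup_ring S)"
    using add_in by (intro ideal_supported_on) (auto elim!: set_plus_elim)
  have max: "maximalideal ?m (semigroup_ring S)"
  proof (rule maximalidealI[OF m])
    have "(1 :: ('d, 'k) mpoly) \<notin> ?m" by (simp add: supported_on_def)
    then show "carrier (semigroup_ring S) \<noteq> ?m" using one_mem unfolding semigroup_ring_eq ring_on_simps by metis
    fix J assume J: "ideal J (semigroup_ring S)" "?m \<subseteq> J" "J \<subseteq> carrier (semigroup_ring S)"
    show "J = ?m \<or> J = carrier (semigroup_ring S)"
    proof (cases "J \<subseteq> ?m")
      case False
      then obtain p where p: "p \<in> J" "p \<notin> ?m" by auto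
      note J' = idealD[OF J(1)[unfolded semigroup_ring_eq]]
      define c where "c = lookup p 0"
      have "p \<in> supported_on S" using p(1) J'(1) by auto
      then have "x \<in> S" if "lookup p x \<noteq> 0" for x
        using that by (auto simp: supported_on_def in_keys_iff)
      then have "p - single 0 c \<in> ?m"
        by (auto simp: supported_on_def in_keys_iff lookup_minus lookup_single c_def when_def split: if_splits)
      from J'(5)[OF p(1) subsetD[OF J(2) this]] have c: "single 0 c \<in> J" by simp
      have "c \<noteq> 0" using p J'(1) by (auto simp: supported_on_def in_keys_iff c_def)
      then have "(1 :: ('d, 'k) mpoly) \<in> J"
        using J'(6)[OF single_supported_on[OF zero_in, of "1 / c"] c] by (simp add: mult_single)
      then have "r \<in> J" if "r \<in> supported_on S" for r
        using J'(6)[OF that] by fastforce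
      then show ?thesis using J'(1) by (auto simp: semigroup_ring_eq)
    qed (use J in auto)
  qed
  then show "maximalideal ?m (semigroup_ring S)" .
  show "primeideal ?m (semigroup_ring S)"
    using cring.maximalideal_prime[OF cring] max unfolding semigroup_ring_eq by blast
qed

end

section \<open>Minimal generating sets and the embedding dimension\<close>

lemma generated_monoid_base: "a \<in> A \<Longrightarrow> a \<in> generated_monoid A"
  using generated_monoid.add[OF _ generated_monoid.zero, of a A] by simp

lemma generated_monoid_add:
  "x \<in> generated_monoid A \<Longrightarrow> y \<in> generated_monoid A \<Longrightarrow> x + y \<in> generated_monoid A"
  by (induction rule: generated_monoid.induct) (auto simp: add.assoc intro: generated_monoid.add)

lemma vector_monoid_generated: "vector_monoid (generated_monoid A :: (nat ^ 'd) set)"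
  by unfold_locales (auto intro: generated_monoid.zero generated_monoid_add)

lemma generated_monoid_least:
  assumes "A \<subseteq> generated_monoid B"
  shows "generated_monoid A \<subseteq> generated_monoid B"
proof
  fix x assume "x \<in> generated_monoid A"
  then show "x \<in> generated_monoid B"
    by induction (use assms in \<open>auto intro: generated_monoid.zero generated_monoid_add\<close>)
qed

locale minimally_generated = vector_monoid S for S :: "(nat ^ 'd) set" +
  fixes A :: "(nat ^ 'd) set"
  assumes finite_A: "finite A"
    and minimal: "minimal_generating_set A S"
begin

lemma generated_A: "generated_monoid A = S"
  using minimal by (simp add: minimal_generating_set_def)

lemma A_subset: "A \<subseteq> S"
  using generated_monoid_base generated_A by auto

lemma generator_not_redundant: "a \<in> A \<Longrightarrow> a \<notin> generated_monoid (A - {a})"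
proof
  assume a: "a \<in> A" "a \<in> generated_monoid (A - {a})"
  have "A \<subseteq> generated_monoid (A - {a})"
  proof
    fix x assume "x \<in> A"
    then show "x \<in> generated_monoid (A - {a})"
      using a(2) generated_monoid_base[of x "A - {a}"] by (cases "x = a") auto
  qed
  then have "generated_monoid A \<subseteq> generated_monoid (A - {a})" by (rule generated_monoid_least)
  moreover have "generated_monoid (A - {a}) \<subseteq> generated_monoid A"
    by (rule generated_monoid_least) (auto intro: generated_monoid_base)
  ultimately have "generated_monoid (A - {a}) = S" using generated_A by auto
  moreover have "A - {a} \<subset> A" using a by auto
  ultimately show False using minimal by (auto simp: minimal_generating_set_def)
qed

lemma zero_notin_A: "0 \<notin> A"
  using generator_not_redundant generated_monoid.zero by auto

text \<open>Nonzero summands of \<open>a\<close> have smaller weight than \<open>a\<close>, so they are generated by the other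
  generators.\<close>

lemma generator_irreducible:
  assumes a: "a \<in> A" and bc: "b \<in> S" "c \<in> S" "a = b + c"
  shows "b = 0 \<or> c = 0"
proof (rule ccontr)
  assume "\<not> ?thesis"
  then have less: "weight b < weight a" "weight c < weight a"
    using bc(3) weight_eq_0_iff by (auto simp: neq0_conv[symmetric] simp del: neq0_conv)
  have "x \<in> generated_monoid (A - {a})" if "x \<in> generated_monoid A" "weight x < weight a" for x
    using that
  proof induction
    case (add y z)
    then have "y \<noteq> a" by auto
    with add show ?case by (auto intro: generated_monoid.add)
  qed (rule generated_monoid.zero)
  then have "b + c \<in> generated_monoid (A - {a})"
    using less bc by (intro generated_monoid_add) (auto simp: generated_A)
  then show False using generator_not_redundant[OF a] bc(3) by simp
qed

lemma nonzero_decompose: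
  assumes "x \<in> S" "x \<noteq> 0"
  obtains a y where "a \<in> A" "y \<in> S" "x = a + y"
proof -
  have "x \<in> generated_monoid A" using assms generated_A by simp
  then show thesis
    by cases (use assms that generated_A in auto)
qed

lemma A_plus_S: "A + S = S - {0}"
proof
  show "A + S \<subseteq> S - {0}"
  proof
    fix x assume "x \<in> A + S"
    then obtain a y where x: "a \<in> A" "y \<in> S" "x = a + y" by (auto elim!: set_plus_elim)
    have "weight a \<noteq> 0" using x(1) zero_notin_A by auto
    then have "weight x \<noteq> 0" unfolding x(3) weight_add by simp
    then have "x \<noteq> 0" unfolding weight_eq_0_iff .
    moreover have "x \<in> S" unfolding x(3) using x(1,2) A_subset by (intro add_in) auto
    ultimately show "x \<in> S - {0}" by simp
  qed
  show "S - {0} \<subseteq> A + S"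
  proof
    fix x assume "x \<in> S - {0}"
    then have "x \<in> S" "x \<noteq> 0" by simp_all
    then obtain a y where "a \<in> A" "y \<in> S" "x = a + y" by (rule nonzero_decompose)
    then show "x \<in> A + S" by (simp add: set_plus_intro)
  qed
qed

text \<open>A generator is not a sum of two nonzero elements, so on the coefficients at the generators a
  ring element acts on the maximal ideal through its constant term. Hence the coefficients at the
  generators of any system of generators of the maximal ideal span a space of dimension
  \<open>card A\<close>.\<close>

lemma embedding_dim_eq:
  "embedding_dim (semigroup_ring S) (monomial_ideal S A :: ('d, 'k::field) mpoly set) = card A"
  unfolding embedding_dim_def
proof (rule Least_equality)
  show "\<exists>G\<subseteq>carrier (semigroup_ring S). finite G \<and> card G = card A \<and>
      Idl\<^bsub>semigroup_ring S\<^esub> G = (monomial_ideal S A :: ('d, 'k) mpoly set)"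
  proof (intro exI conjI)
    show "monomial ` A \<subseteq> carrier (semigroup_ring S :: ('d, 'k) mpoly ring)"
      using A_subset by (auto simp: semigroup_ring_eq)
    show "card (monomial ` A :: ('d, 'k) mpoly set) = card A"
      by (rule card_image[OF inj_monomial])
  qed (simp_all add: finite_A monomial_ideal_def)
next
  interpret unital_subring "supported_on S :: ('d, 'k) mpoly set" by (rule unital_subring)
  let ?m = "monomial_ideal S A :: ('d, 'k) mpoly set"
  have m_eq: "?m = supported_on (S - {0})" using monomial_ideal_eq[OF A_subset] A_plus_S by simp
  have m: "ideal ?m R"
    using primeideal_maximal(2) unfolding m_eq semigroup_ring_eq by (rule maximalideal.axioms(1))
  fix n
  assume "\<exists>G\<subseteq>carrier (semigroup_ring S). finite G \<and> card G = n \<and> Idl\<^bsub>semigroup_ring S\<^esub> G = ?m"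
  then obtain G where G: "G \<subseteq> supported_on S" "finite G" "card G = n" "Idl\<^bsub>R\<^esub> G = ?m"
    by (auto simp: semigroup_ring_eq)
  define W where "W = pm.span (restrict_to A ` G)"
  define K where "K = {p \<in> ?m. restrict_to A p \<in> W}"
  \<comment> \<open>The ring acts on the coefficients at the generators through the constant term.\<close>
  have scale: "restrict_to A (r * p) = single 0 (lookup r 0) * restrict_to A p"
    if r: "r \<in> supported_on S" and p: "p \<in> ?m" for r p
  proof (rule poly_mapping_eqI)
    fix b
    show "lookup (restrict_to A (r * p)) b =
        lookup (single 0 (lookup r 0) * restrict_to A p) b"
    proof (cases "b \<in> A")
      case True
      have "lookup (r * p) (0 + b) = lookup r 0 * lookup p b"
      proof (rule lookup_mult_unique)
        fix x y assume "x \<in> keys r" "y \<in> keys p" "x + y = 0 + b"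
        then show "x = 0"
          using generator_irreducible[OF True, of x y] r p unfolding m_eq supported_on_def by auto
      qed
      then show ?thesis using True by (simp add: lookup_restrict_to)
    qed (simp add: lookup_restrict_to)
  qed
  have "ideal K R"
    unfolding ideal_iff
  proof (intro conjI ballI)
    note m' = idealD[OF m]
    have "restrict_to A 0 = (0 :: ('d, 'k) mpoly)" by (simp add: restrict_to_def)
    then show "0 \<in> K" using m'(2) by (simp add: K_def W_def pm.span_zero)
    show "K \<subseteq> supported_on S" using m'(1) by (auto simp: K_def)
    show "p + q \<in> K" if "p \<in> K" "q \<in> K" for p q
      using that m'(3) by (simp add: K_def W_def restrict_to_add pm.span_add)
    show "r * p \<in> K" if r: "r \<in> supported_on S" and p: "p \<in> K" for r p
    proof -
      from p have p': "p \<in> ?m" "restrict_to A p \<in> W" by (auto simp: K_def)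
      have "restrict_to A (r * p) \<in> W"
        using p'(2) unfolding scale[OF r p'(1)] W_def by (rule pm.span_scale)
      then show ?thesis using m'(6)[OF r p'(1)] by (simp add: K_def)
    qed
  qed
  moreover have "G \<subseteq> K"
    using genideal_self[OF G(1)] G(4) by (auto simp: K_def W_def intro: pm.span_base)
  ultimately have "?m \<subseteq> K" using genideal_least G(4) by metis
  moreover have "monomial a \<in> ?m" if "a \<in> A" for a
    using that A_subset zero_notin_A by (auto simp: m_eq)
  ultimately have K: "monomial a \<in> K" if "a \<in> A" for a
    using that by auto
  have "monomial ` A \<subseteq> W"
  proof
    fix v :: "('d, 'k) mpoly" assume "v \<in> monomial ` A"
    then obtain a where a: "a \<in> A" "v = monomial a" by (rule imageE)
    have "restrict_to A (monomial a) \<in> W" using K[OF a(1)] by (simp add: K_def)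
    then show "v \<in> W" using restrict_to_monomial[OF a(1), where 'k = 'k] a(2) by simp
  qed
  then have "card (monomial ` A :: ('d, 'k) mpoly set) \<le> card (restrict_to A ` G)"
    unfolding W_def
    by (rule conjunct2[OF pm.independent_span_bound[OF finite_imageI[OF G(2)] independent_monomials]])
  also have "\<dots> \<le> card G" by (rule card_image_le[OF G(2)])
  finally show "card A \<le> n" using G(3) by (simp add: card_image inj_monomial)
qed

end

section \<open>Simplicial cones\<close>

lemma convex_cone_hull_finite:
  fixes V :: "'a::real_vector set"
  assumes "finite V"
  shows "convex_cone hull V = {(\<Sum>v\<in>V. u v *\<^sub>R v) | u. \<forall>v\<in>V. 0 \<le> u v}" (is "_ = ?C")
proof
  show "convex_cone hull V \<subseteq> ?C"
  proof (rule hull_minimal)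
    show "V \<subseteq> ?C"
    proof
      fix w assume "w \<in> V"
      then have "w = (\<Sum>v\<in>V. (if v = w then 1 else 0) *\<^sub>R v)"
        using assms by (simp add: if_distrib[of "\<lambda>c. c *\<^sub>R _"] cong: if_cong)
      then show "w \<in> ?C" by (intro CollectI exI[of _ "\<lambda>v. if v = w then 1 else 0"]) auto
    qed
    show "convex_cone ?C"
      unfolding convex_cone_iff
    proof (intro conjI ballI allI impI)
      have "0 = (\<Sum>v\<in>V. 0 *\<^sub>R v)" by simp
      then show "0 \<in> ?C" by (intro CollectI exI[of _ "\<lambda>v. 0"]) auto
      fix x assume "x \<in> ?C"
      then obtain u where u: "x = (\<Sum>v\<in>V. u v *\<^sub>R v)" "\<forall>v\<in>V. 0 \<le> u v" by auto
      show "x + y \<in> ?C" if y: "y \<in> ?C" for y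
      proof -
        obtain w where w: "y = (\<Sum>v\<in>V. w v *\<^sub>R v)" "\<forall>v\<in>V. 0 \<le> w v" using y by auto
        have "x + y = (\<Sum>v\<in>V. (u v + w v) *\<^sub>R v)"
          using u w by (simp add: scaleR_add_left sum.distrib)
        then show ?thesis using u w by (intro CollectI exI[of _ "\<lambda>v. u v + w v"]) auto
      qed
      show "c *\<^sub>R x \<in> ?C" if c: "c \<ge> 0" for c
      proof -
        have "c *\<^sub>R x = (\<Sum>v\<in>V. (c * u v) *\<^sub>R v)" using u by (simp add: scaleR_sum_right)
        then show ?thesis using u c by (intro CollectI exI[of _ "\<lambda>v. c * u v"]) auto
      qed
    qed
  qed
  show "?C \<subseteq> convex_cone hull V"
  proof
    fix x assume "x \<in> ?C"
    then obtain u where u: "x = (\<Sum>v\<in>V. u v *\<^sub>R v)" "\<forall>v\<in>V. 0 \<le> u v" by auto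
    have "(\<Sum>v\<in>W. u v *\<^sub>R v) \<in> convex_cone hull V" if "W \<subseteq> V" for W
      using finite_subset[OF that assms] that
    proof (induction W rule: finite_induct)
      case empty
      then show ?case by (simp add: convex_cone_hull_contains_0)
    next
      case (insert w W)
      then show ?case using u(2) by (auto intro!: convex_cone_hull_add convex_cone_hull_mul intro: hull_inc)
    qed
    then show "x \<in> convex_cone hull V" using u(1) by simp
  qed
qed

text \<open>If a multiple of an irredundant generator \<open>w\<close> is a proper convex combination of two elements of the
  cone, the coefficients of the other generators must vanish, since otherwise \<open>w\<close> would be redundant or
  the cone would not be pointed.\<close>

lemma ray_face_of_cone:
  fixes W :: "'a::euclidean_space set"
  assumes fin: "finite W" and nonneg: "\<And>v i. v \<in> W \<Longrightarrow> i \<in> Basis \<Longrightarrow> 0 \<le> v \<bullet> i"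
    and irr: "\<And>v. v \<in> W \<Longrightarrow> v \<notin> convex_cone hull (W - {v})" and w: "w \<in> W"
  shows "w \<noteq> 0" "{t *\<^sub>R w | t. 0 \<le> t} face_of convex_cone hull W" "aff_dim {t *\<^sub>R w | t. 0 \<le> t} = 1"
proof -
  let ?F = "{t *\<^sub>R w | t. 0 \<le> t}"
  have nz: "v \<noteq> 0" if "v \<in> W" for v
    using irr[OF that] convex_cone_hull_contains_0 by auto
  show w0: "w \<noteq> 0" by (rule nz[OF w])
  have ray: "x \<in> ?F"
    if x: "x = (\<Sum>v\<in>W. \<xi> v *\<^sub>R v)" "\<forall>v\<in>W. 0 \<le> \<xi> v" and y: "y = (\<Sum>v\<in>W. \<eta> v *\<^sub>R v)" "\<forall>v\<in>W. 0 \<le> \<eta> v"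
      and z: "t *\<^sub>R w = c *\<^sub>R x + d *\<^sub>R y" "c > 0" "d > 0" for x y \<xi> \<eta> t c d
  proof -
    define \<kappa> where "\<kappa> v = c * \<xi> v + d * \<eta> v" for v
    have \<kappa>: "0 \<le> \<kappa> v" if "v \<in> W" for v using that x(2) y(2) z by (simp add: \<kappa>_def)
    have "t *\<^sub>R w = (\<Sum>v\<in>W. \<kappa> v *\<^sub>R v)"
      unfolding z(1) x(1) y(1) scaleR_sum_right sum.distrib[symmetric]
      by (rule sum.cong) (simp_all add: \<kappa>_def algebra_simps)
    also have "\<dots> = \<kappa> w *\<^sub>R w + (\<Sum>v\<in>W - {w}. \<kappa> v *\<^sub>R v)" by (rule sum.remove[OF fin w])
    finally have eq: "(t - \<kappa> w) *\<^sub>R w = (\<Sum>v\<in>W - {w}. \<kappa> v *\<^sub>R v)" by (simp add: algebra_simps)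
    have "t - \<kappa> w \<le> 0"
    proof (rule ccontr)
      assume pos: "\<not> t - \<kappa> w \<le> 0"
      have "(1 / (t - \<kappa> w)) *\<^sub>R ((t - \<kappa> w) *\<^sub>R w) \<in> convex_cone hull (W - {w})"
        unfolding eq using pos \<kappa> fin
        by (intro convex_cone_hull_mul) (auto simp: convex_cone_hull_finite)
      then show False using irr[OF w] pos by simp
    qed
    have \<kappa>0: "\<kappa> v = 0" if v: "v \<in> W - {w}" for v
    proof -
      obtain i where i: "i \<in> Basis" "v \<bullet> i \<noteq> 0" using nz v euclidean_all_zero_iff[of v] by auto
      have "(\<Sum>v\<in>W - {w}. \<kappa> v * (v \<bullet> i)) = (t - \<kappa> w) * (w \<bullet> i)"
        using arg_cong[OF eq, of "\<lambda>x. x \<bullet> i"] by (simp add: inner_sum_left)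
      also have "\<dots> \<le> 0" using \<open>t - \<kappa> w \<le> 0\<close> nonneg[OF w i(1)] by (rule mult_nonpos_nonneg)
      finally have "(\<Sum>v\<in>W - {w}. \<kappa> v * (v \<bullet> i)) \<le> 0" .
      moreover have "0 \<le> \<kappa> v * (v \<bullet> i)" if "v \<in> W - {w}" for v
        using \<kappa> nonneg i(1) that by simp
      ultimately have "\<kappa> v * (v \<bullet> i) = 0"
        using v fin sum_nonneg_eq_0_iff[of "W - {w}" "\<lambda>v. \<kappa> v * (v \<bullet> i)"]
          sum_nonneg[of "W - {w}" "\<lambda>v. \<kappa> v * (v \<bullet> i)"] by fastforce
      then show ?thesis using i by simp
    qed
    have "\<xi> v = 0" if v: "v \<in> W - {w}" for v
    proof -
      have "c * \<xi> v + d * \<eta> v = 0" "0 \<le> c * \<xi> v" "0 \<le> d * \<eta> v"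
        using \<kappa>0[OF v] v x(2) y(2) z by (simp_all add: \<kappa>_def)
      then show ?thesis using z(2) by (smt (verit) mult_eq_0_iff)
    qed
    then have "x = \<xi> w *\<^sub>R w" unfolding x(1) sum.remove[OF fin w] by simp
    then show ?thesis using x(2) w by auto
  qed
  show "?F face_of convex_cone hull W"
    unfolding face_of_def
  proof (intro conjI ballI impI)
    show "?F \<subseteq> convex_cone hull W" using w by (auto intro!: convex_cone_hull_mul intro: hull_inc)
    show "convex ?F"
    proof (rule convexI)
      fix x y and u v :: real
      assume "x \<in> ?F" "y \<in> ?F" "0 \<le> u" "0 \<le> v" "u + v = 1"
      then obtain s t where "x = s *\<^sub>R w" "y = t *\<^sub>R w" "0 \<le> s" "0 \<le> t" by auto
      then show "u *\<^sub>R x + v *\<^sub>R y \<in> ?F"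
        using \<open>0 \<le> u\<close> \<open>0 \<le> v\<close> by (intro CollectI exI[of _ "u * s + v * t"]) (simp add: algebra_simps)
    qed
    fix x y z
    assume "x \<in> convex_cone hull W" "y \<in> convex_cone hull W" "z \<in> ?F" "z \<in> open_segment x y"
    then obtain \<xi> \<eta> t c where *: "x = (\<Sum>v\<in>W. \<xi> v *\<^sub>R v)" "\<forall>v\<in>W. 0 \<le> \<xi> v"
      "y = (\<Sum>v\<in>W. \<eta> v *\<^sub>R v)" "\<forall>v\<in>W. 0 \<le> \<eta> v" "t *\<^sub>R w = (1 - c) *\<^sub>R x + c *\<^sub>R y" "0 < c" "c < 1"
      unfolding convex_cone_hull_finite[OF fin] in_segment by auto
    show "x \<in> ?F" using * by (intro ray[of x \<xi> y \<eta> t "1 - c" c]) auto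
    show "y \<in> ?F" using * by (intro ray[of y \<eta> x \<xi> t c "1 - c"]) (auto simp: add.commute)
  qed
  have "0 *\<^sub>R w \<in> ?F" by (rule CollectI) (intro exI conjI, rule refl, simp)
  then have "aff_dim ?F = int (dim ?F)" by (intro aff_dim_zero hull_inc) simp
  moreover have "dim ?F = 1"
  proof (rule dim_unique[of "{w}"])
    have "1 *\<^sub>R w \<in> ?F" by (rule CollectI) (intro exI conjI, rule refl, simp)
    then show "{w} \<subseteq> ?F" by simp
    show "?F \<subseteq> span {w}" by (auto intro: span_scale span_base)
  qed (use w0 in simp_all)
  ultimately show "aff_dim ?F = 1" by simp
qed

lemma irredundant_cone_generators:
  fixes V :: "'a::euclidean_space set"
  assumes "finite V"
  obtains W where "W \<subseteq> V" "convex_cone hull W = convex_cone hull V"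
    "\<And>w. w \<in> W \<Longrightarrow> w \<notin> convex_cone hull (W - {w})"
proof -
  define P where "P W \<longleftrightarrow> W \<subseteq> V \<and> convex_cone hull W = convex_cone hull V" for W
  define W where "W = arg_min card P"
  have "P V" by (simp add: P_def)
  then have W: "P W" "\<And>X. P X \<Longrightarrow> card W \<le> card X"
    using arg_min_nat_lemma[of P V card] unfolding W_def by auto
  show thesis
  proof (rule that[of W])
    fix w assume w: "w \<in> W"
    show "w \<notin> convex_cone hull (W - {w})"
    proof
      assume red: "w \<in> convex_cone hull (W - {w})"
      have "W \<subseteq> convex_cone hull (W - {w})"
      proof
        fix x assume "x \<in> W"
        then show "x \<in> convex_cone hull (W - {w})" using red by (cases "x = w") (auto intro: hull_inc)
      qed
      then have "convex_cone hull W \<subseteq> convex_cone hull (W - {w})"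
        by (rule hull_minimal) (rule convex_cone_convex_cone_hull)
      moreover have "convex_cone hull (W - {w}) \<subseteq> convex_cone hull W" by (rule hull_mono) auto
      ultimately have "P (W - {w})" using W(1) by (auto simp: P_def)
      then have "card W \<le> card (W - {w})" by (rule W(2))
      moreover have "finite W" using W(1) assms finite_subset by (auto simp: P_def)
      ultimately show False using w card_Diff1_less[of W w] by simp
    qed
  qed (use W(1) in \<open>simp_all add: P_def\<close>)
qed

lemma real_vec_add: "real_vec (a + b) = real_vec a + real_vec b"
  by (simp add: real_vec_def vec_eq_iff)

lemma real_vec_inject [simp]: "real_vec a = real_vec b \<longleftrightarrow> a = b"
  by (simp add: real_vec_def vec_eq_iff)

lemma real_vec_0 [simp]: "real_vec 0 = 0"
  by (simp add: real_vec_def vec_eq_iff)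

lemma real_vec_Basis_nonneg: "i \<in> Basis \<Longrightarrow> 0 \<le> real_vec a \<bullet> i"
  by (auto simp: real_vec_def Basis_vec_def inner_axis)

lemma semigroup_cone_generated:
  "semigroup_cone (generated_monoid A) = convex_cone hull (real_vec ` A)"
  unfolding semigroup_cone_def
proof
  have "real_vec x \<in> convex_cone hull (real_vec ` A)" if "x \<in> generated_monoid A" for x
    using that
    by induction (auto simp: real_vec_add convex_cone_hull_contains_0 intro!: convex_cone_hull_add intro: hull_inc)
  then show "convex_cone hull (real_vec ` generated_monoid A) \<subseteq> convex_cone hull (real_vec ` A)"
    by (intro hull_minimal convex_cone_convex_cone_hull) auto
  show "convex_cone hull (real_vec ` A) \<subseteq> convex_cone hull (real_vec ` generated_monoid A)"
    by (rule hull_mono) (auto intro: generated_monoid_base)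
qed

text \<open>Each extremal ray carries at most one extremal element, so if there are as many extremal
  elements as extremal rays, each ray carries one, and these generate the cone.\<close>

lemma extremal_elements_span_cone:
  fixes A :: "(nat ^ 'd) set"
  assumes fin: "finite A" and S: "S = generated_monoid A" and simp: "simplicial S"
    and card: "card (extremal_elements S) = CARD('d)" and x: "x \<in> S"
  shows "real_vec x \<in> convex_cone hull (real_vec ` extremal_elements S)"
proof -
  let ?E = "extremal_elements S"
  define ray where "ray e = (SOME F. F \<in> extremal_rays S \<and> real_vec e \<in> F \<and>
        (\<forall>b\<in>S. b \<noteq> 0 \<longrightarrow> real_vec b \<in> F \<longrightarrow> e \<le> b))" for e
  have E: "e \<in> S" "e \<noteq> 0" "ray e \<in> extremal_rays S" "real_vec e \<in> ray e"
    "\<And>b. b \<in> S \<Longrightarrow> b \<noteq> 0 \<Longrightarrow> real_vec b \<in> ray e \<Longrightarrow> e \<le> b" if "e \<in> ?E" for e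
  proof -
    from that have "\<exists>F. F \<in> extremal_rays S \<and> real_vec e \<in> F \<and> (\<forall>b\<in>S. b \<noteq> 0 \<longrightarrow> real_vec b \<in> F \<longrightarrow> e \<le> b)"
      by (auto simp: extremal_elements_def)
    from someI_ex[OF this] show "ray e \<in> extremal_rays S" "real_vec e \<in> ray e"
      "\<And>b. b \<in> S \<Longrightarrow> b \<noteq> 0 \<Longrightarrow> real_vec b \<in> ray e \<Longrightarrow> e \<le> b" by (simp_all add: ray_def)
  qed (use that in \<open>auto simp: extremal_elements_def\<close>)
  have "inj_on ray ?E"
  proof (rule inj_onI)
    fix e e' assume e: "e \<in> ?E" "e' \<in> ?E" "ray e = ray e'"
    have "e \<le> e'" using E(5)[OF e(1) E(1,2)[OF e(2)]] E(4)[OF e(2)] e(3) by simp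
    moreover have "e' \<le> e" using E(5)[OF e(2) E(1,2)[OF e(1)]] E(4)[OF e(1)] e(3) by simp
    ultimately show "e = e'" by simp
  qed
  then have "card (ray ` ?E) = card (extremal_rays S)"
    using card simp by (simp add: card_image simplicial_def)
  moreover have "ray ` ?E \<subseteq> extremal_rays S" using E(3) by auto
  ultimately have rays: "ray ` ?E = extremal_rays S"
    using simp by (intro card_subset_eq) (simp_all add: simplicial_def)
  obtain W where W: "W \<subseteq> real_vec ` A" "convex_cone hull W = convex_cone hull (real_vec ` A)"
    "\<And>w. w \<in> W \<Longrightarrow> w \<notin> convex_cone hull (W - {w})"
    using irredundant_cone_generators[of "real_vec ` A"] fin by auto
  have finW: "finite W" using W(1) fin finite_subset by auto
  have nonneg: "0 \<le> v \<bullet> i" if "v \<in> W" "i \<in> Basis" for v i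
    using that W(1) real_vec_Basis_nonneg by auto
  have cone: "semigroup_cone S = convex_cone hull W"
    unfolding S semigroup_cone_generated W(2) ..
  have "W \<subseteq> convex_cone hull (real_vec ` ?E)"
  proof
    fix w assume w: "w \<in> W"
    note face = ray_face_of_cone[of W, OF finW nonneg W(3) w]
    have "{t *\<^sub>R w | t. 0 \<le> t} \<in> ray ` ?E"
      using face(2,3) unfolding rays by (simp add: extremal_rays_def cone)
    then obtain e where e: "e \<in> ?E" "ray e = {t *\<^sub>R w | t. 0 \<le> t}" by (elim imageE) simp
    then obtain t where t: "0 \<le> t" "real_vec e = t *\<^sub>R w" using E(4)[OF e(1)] by auto
    have "t \<noteq> 0"
    proof
      assume "t = 0"
      then have "real_vec e = real_vec 0" using t(2) by simp
      then show False using E(2)[OF e(1)] by (simp only: real_vec_inject)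
    qed
    then have "(1 / t) *\<^sub>R real_vec e = w" using t by simp
    moreover have "(1 / t) *\<^sub>R real_vec e \<in> convex_cone hull (real_vec ` ?E)"
      using t(1) e(1) by (intro convex_cone_hull_mul hull_inc) auto
    ultimately show "w \<in> convex_cone hull (real_vec ` ?E)" by simp
  qed
  then have "convex_cone hull W \<subseteq> convex_cone hull (real_vec ` ?E)"
    by (rule hull_minimal) (rule convex_cone_convex_cone_hull)
  moreover have "real_vec x \<in> semigroup_cone S"
    using x by (auto simp: semigroup_cone_def intro: hull_inc)
  ultimately show ?thesis using cone by auto
qed


declare of_nat_index [simp]

text \<open>The fractional parts of the coordinates of \<open>n * x\<close> with respect to a basis \<open>E\<close> of lattice points
  form lattice points in a bounded region, so two of them agree; the difference of the corresponding
  multiples of \<open>x\<close> has integral coordinates.\<close>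

lemma multiple_in_lattice_cone:
  fixes E :: "(nat ^ 'd) set" and r :: "nat ^ 'd \<Rightarrow> real"
  assumes fin: "finite E" and r: "\<And>e. e \<in> E \<Longrightarrow> 0 \<le> r e" and x: "real_vec x = (\<Sum>e\<in>E. r e *\<^sub>R real_vec e)"
  shows "\<exists>k>0. \<exists>f. of_nat k * x = (\<Sum>e\<in>E. of_nat (f e) * e)"
proof -
  define \<rho> where "\<rho> n = (\<lambda>i. int (n * x $ i) - (\<Sum>e\<in>E. \<lfloor>real n * r e\<rfloor> * int (e $ i)))" for n
  define M where "M i = (\<Sum>e\<in>E. int (e $ i))" for i
  have \<rho>: "real_of_int (\<rho> n i) = (\<Sum>e\<in>E. frac (real n * r e) * real (e $ i))" for n i
  proof -
    have "real (x $ i) = (\<Sum>e\<in>E. r e * real (e $ i))"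
      using arg_cong[OF x, of "\<lambda>v. v $ i"] by (simp add: real_vec_def)
    then have "real n * real (x $ i) = (\<Sum>e\<in>E. (real n * r e) * real (e $ i))"
      by (simp add: sum_distrib_left mult.assoc)
    then show ?thesis
      by (simp add: \<rho>_def frac_def algebra_simps sum_subtractf)
  qed
  have "0 \<le> \<rho> n i \<and> \<rho> n i \<le> M i" for n i
  proof -
    have "0 \<le> real_of_int (\<rho> n i)" unfolding \<rho> by (intro sum_nonneg mult_nonneg_nonneg) auto
    moreover have "real_of_int (\<rho> n i) \<le> real_of_int (M i)"
      unfolding \<rho> M_def of_int_sum
    proof (rule sum_mono)
      fix e
      have "frac (real n * r e) \<le> 1" using frac_lt_1[of "real n * r e"] by simp
      then show "frac (real n * r e) * real (e $ i) \<le> real_of_int (int (e $ i))"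
        by (simp add: mult_left_le_one_le)
    qed
    ultimately show ?thesis by simp
  qed
  then have "range \<rho> \<subseteq> PiE UNIV (\<lambda>i. {0..M i})" by auto
  then have "finite (range \<rho>)" by (rule finite_subset) (auto intro: finite_PiE)
  then have "\<not> inj \<rho>" using finite_imageD infinite_UNIV_nat by blast
  then obtain p q where "p \<noteq> q" "\<rho> p = \<rho> q" by (auto simp: inj_def)
  then obtain n m where nm: "n < m" "\<rho> n = \<rho> m" by (metis linorder_neqE_nat)
  define f where "f e = nat (\<lfloor>real m * r e\<rfloor> - \<lfloor>real n * r e\<rfloor>)" for e
  have f: "int (f e) = \<lfloor>real m * r e\<rfloor> - \<lfloor>real n * r e\<rfloor>" if "e \<in> E" for e
  proof -
    have "real n * r e \<le> real m * r e" using nm(1) r[OF that] by (intro mult_right_mono) auto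
    then show ?thesis using floor_mono[of "real n * r e" "real m * r e"] by (simp add: f_def)
  qed
  have "of_nat (m - n) * x = (\<Sum>e\<in>E. of_nat (f e) * e)"
    unfolding vec_eq_iff
  proof
    fix i
    have "int ((m - n) * x $ i) = int (m * x $ i) - int (n * x $ i)"
      using nm(1) by (simp add: of_nat_diff left_diff_distrib)
    also have "\<dots> = (\<Sum>e\<in>E. (\<lfloor>real m * r e\<rfloor> - \<lfloor>real n * r e\<rfloor>) * int (e $ i))"
      using fun_cong[OF nm(2), of i] by (simp add: \<rho>_def left_diff_distrib sum_subtractf)
    also have "\<dots> = (\<Sum>e\<in>E. int (f e * e $ i))" by (rule sum.cong) (simp_all add: f)
    finally have "(m - n) * x $ i = (\<Sum>e\<in>E. f e * e $ i)"
      unfolding of_nat_sum[symmetric] of_nat_eq_iff .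
    then show "(of_nat (m - n) * x) $ i = (\<Sum>e\<in>E. of_nat (f e) * e) $ i"
      by (simp del: of_nat_diff)
  qed
  then show ?thesis using nm(1) by (intro exI[of _ "m - n"]) auto
qed

lemma simplicial_coordinates:
  fixes A :: "(nat ^ 'd) set"
  assumes fin: "finite A" and S: "S = generated_monoid A" and full: "fully_embedded S"
    and simp: "simplicial S" and card: "card (extremal_elements S) = CARD('d)"
  obtains c :: "nat ^ 'd \<Rightarrow> nat ^ 'd \<Rightarrow> real"
  where "\<And>e x y. x \<in> S \<Longrightarrow> y \<in> S \<Longrightarrow> c e (x + y) = c e x + c e y"
    "\<And>e x. e \<in> extremal_elements S \<Longrightarrow> x \<in> S \<Longrightarrow> 0 \<le> c e x"
    "\<And>e e'. e \<in> extremal_elements S \<Longrightarrow> e' \<in> extremal_elements S \<Longrightarrow> c e e' = (if e = e' then 1 else 0)"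
    "\<And>x. x \<in> S \<Longrightarrow> \<forall>e\<in>extremal_elements S. c e x = 0 \<Longrightarrow> x = 0"
    "\<And>x. x \<in> S \<Longrightarrow> \<exists>k>0. \<exists>f. of_nat k * x = (\<Sum>e\<in>extremal_elements S. of_nat (f e) * e)"
proof -
  define E where "E = extremal_elements S"
  define D where "D = real_vec ` E"
  have inj: "inj_on real_vec E" by (simp add: inj_on_def)
  have "finite E" using card by (intro card_ge_0_finite) (simp add: E_def)
  then have finD: "finite D" by (simp add: D_def)
  have cardD: "card D = CARD('d)" using card inj by (simp add: D_def E_def card_image)
  have cone: "\<exists>u. real_vec x = (\<Sum>v\<in>D. u v *\<^sub>R v) \<and> (\<forall>v\<in>D. 0 \<le> u v)" if "x \<in> S" for x
    using extremal_elements_span_cone[OF fin S simp card that] finD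
    by (auto simp: convex_cone_hull_finite D_def E_def)
  have "real_vec x \<in> span D" if x: "x \<in> S" for x
  proof -
    obtain u where "real_vec x = (\<Sum>v\<in>D. u v *\<^sub>R v)" using cone[OF x] by auto
    then show ?thesis by (auto intro: span_sum span_scale span_base)
  qed
  then have "span (real_vec ` S) \<subseteq> span D" by (intro span_minimal) auto
  then have span: "span D = UNIV" using full by (auto simp: fully_embedded_def)
  have ind: "independent D"
    by (rule card_le_dim_spanning[of D UNIV]) (use span finD cardD in auto)
  define c where "c e x = representation D (real_vec x) (real_vec e)" for e x
  have c_eq: "c e x = u (real_vec e)" if "e \<in> E" "real_vec x = (\<Sum>v\<in>D. u v *\<^sub>R v)" for e x u
  proof -
    have "representation D (real_vec x) = (\<lambda>b. \<Sum>v\<in>D. representation D (u v *\<^sub>R v) b)"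
      unfolding that(2) by (rule representation_sum[OF ind]) (simp add: span)
    then have "c e x = (\<Sum>v\<in>D. u v * (if real_vec e = v then 1 else 0))"
      using ind span by (simp add: c_def representation_scale representation_basis)
    also have "\<dots> = (\<Sum>v\<in>D. if real_vec e = v then u v else 0)"
      by (rule sum.cong) auto
    also have "\<dots> = u (real_vec e)" using finD that(1) by (simp add: D_def)
    finally show ?thesis .
  qed
  show thesis
  proof (rule that)
    show "c e (x + y) = c e x + c e y" for e x y
      using ind span by (simp add: c_def real_vec_add representation_add)
    show "0 \<le> c e x" if "e \<in> extremal_elements S" "x \<in> S" for e x
      using cone[OF that(2)] c_eq[of e x] that(1) by (auto simp: E_def D_def)
    show "c e e' = (if e = e' then 1 else 0)" if "e \<in> extremal_elements S" "e' \<in> extremal_elements S" for e e'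
      using ind that by (simp add: c_def representation_basis D_def E_def)
    fix x assume x: "x \<in> S"
    obtain u where u: "real_vec x = (\<Sum>v\<in>D. u v *\<^sub>R v)" "\<forall>v\<in>D. 0 \<le> u v" using cone[OF x] by auto
    have u': "real_vec x = (\<Sum>e\<in>E. u (real_vec e) *\<^sub>R real_vec e)"
      using u(1) inj by (simp add: D_def sum.reindex)
    show "\<exists>k>0. \<exists>f. of_nat k * x = (\<Sum>e\<in>extremal_elements S. of_nat (f e) * e)"
      using multiple_in_lattice_cone[OF \<open>finite E\<close> _ u'] u(2) by (auto simp: E_def D_def)
    show "x = 0" if zero: "\<forall>e\<in>extremal_elements S. c e x = 0"
    proof -
      have "u (real_vec e) = 0" if "e \<in> E" for e
        using c_eq[OF that u(1)] zero that by (simp add: E_def)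
      then have "real_vec x = real_vec 0" using u' by simp
      then show ?thesis by (simp only: real_vec_inject)
    qed
  qed
qed

section \<open>The Apery set of a simplicial semigroup\<close>

text \<open>Here \<open>coord e x\<close> is the coefficient of \<open>e\<close> in the expansion of \<open>x\<close> with respect to the basis \<open>E\<close> of
  the real vector space; the axioms collect what is used about the cone.\<close>

locale simplicial_monoid = minimally_generated S A for S A :: "(nat ^ 'd) set" +
  fixes E :: "(nat ^ 'd) set" and coord :: "nat ^ 'd \<Rightarrow> nat ^ 'd \<Rightarrow> real"
  assumes E_subset: "E \<subseteq> A" and card_E: "card E = CARD('d)"
    and coord_add: "\<And>e x y. x \<in> S \<Longrightarrow> y \<in> S \<Longrightarrow> coord e (x + y) = coord e x + coord e y"
    and coord_nonneg: "\<And>e x. e \<in> E \<Longrightarrow> x \<in> S \<Longrightarrow> 0 \<le> coord e x"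
    and coord_unit: "\<And>e e'. e \<in> E \<Longrightarrow> e' \<in> E \<Longrightarrow> coord e e' = (if e = e' then 1 else 0)"
    and coord_eq_0: "\<And>x. x \<in> S \<Longrightarrow> \<forall>e\<in>E. coord e x = 0 \<Longrightarrow> x = 0"
    and multiple_in_cone: "\<And>x. x \<in> S \<Longrightarrow> \<exists>k>0. \<exists>f. of_nat k * x = (\<Sum>e\<in>E. of_nat (f e) * e)"
begin

lemma finite_E: "finite E"
  using E_subset finite_A finite_subset by auto

lemma E_S: "e \<in> E \<Longrightarrow> e \<in> S"
  using E_subset A_subset by auto

lemma E_nonzero: "e \<in> E \<Longrightarrow> e \<noteq> 0"
  using E_subset zero_notin_A by auto

definition comb :: "(nat ^ 'd \<Rightarrow> nat) \<Rightarrow> nat ^ 'd" where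
  "comb f = (\<Sum>e\<in>E. of_nat (f e) * e)"

lemma of_nat_mult_in: "x \<in> S \<Longrightarrow> of_nat n * x \<in> S"
  by (induction n) (auto simp: distrib_right intro: add_in)

lemma sum_in: "(\<And>i. i \<in> X \<Longrightarrow> f i \<in> S) \<Longrightarrow> (\<Sum>i\<in>X. f i) \<in> S"
  by (induction X rule: infinite_finite_induct) (auto intro: add_in)

lemma comb_in: "comb f \<in> S"
  unfolding comb_def by (intro sum_in of_nat_mult_in E_S)

lemma comb_add: "comb (\<lambda>e. f e + g e) = comb f + comb g"
  by (simp add: comb_def distrib_right sum.distrib)

lemma comb_cong: "(\<And>e. e \<in> E \<Longrightarrow> f e = g e) \<Longrightarrow> comb f = comb g"
  by (simp add: comb_def)

lemma comb_zero: "(\<And>e. e \<in> E \<Longrightarrow> f e = 0) \<Longrightarrow> comb f = 0"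
  by (simp add: comb_def)

lemma comb_unit: "e \<in> E \<Longrightarrow> comb (\<lambda>i. if i = e then 1 else 0) = e"
  using finite_E by (simp add: comb_def if_distrib[of "\<lambda>n. of_nat n * _"] cong: if_cong)

lemma comb_remove:
  assumes "e \<in> E" "0 < f e"
  shows "comb f = e + comb (f(e := f e - 1))"
proof -
  have "comb f = comb (\<lambda>i. (if i = e then 1 else 0) + (f(e := f e - 1)) i)"
    by (rule comb_cong) (use assms in auto)
  then show ?thesis using assms by (simp only: comb_add comb_unit)
qed

lemma weight_of_nat_mult: "weight (of_nat n * x) = n * weight x"
  by (simp add: weight_def sum_distrib_left)

lemma weight_E_pos: "e \<in> E \<Longrightarrow> 0 < weight e"
  using E_nonzero by (simp add: neq0_conv[symmetric] del: neq0_conv)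

lemma le_weight_comb: "e \<in> E \<Longrightarrow> f e \<le> weight (comb f)"
proof -
  assume e: "e \<in> E"
  have "f e \<le> f e * weight e" using weight_E_pos[OF e] by simp
  also have "\<dots> \<le> (\<Sum>e\<in>E. f e * weight e)" using finite_E e by (intro member_le_sum) auto
  also have "\<dots> = weight (comb f)" by (simp add: comb_def weight_sum weight_of_nat_mult)
  finally show ?thesis .
qed

abbreviation Ap where "Ap \<equiv> apery_set S E"

lemma Ap_S: "w \<in> Ap \<Longrightarrow> w \<in> S"
  by (simp add: apery_set_def)

lemma Ap_not_sum: "w \<in> Ap \<Longrightarrow> e \<in> E \<Longrightarrow> y \<in> S \<Longrightarrow> w \<noteq> e + y"
  by (auto simp: apery_set_def add.commute)

lemma zero_in_Ap: "0 \<in> Ap"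
proof -
  have "0 \<noteq> y + e" if "e \<in> E" for e y :: "nat ^ 'd"
    using weight_E_pos[OF that] weight_add[of y e] weight_eq_0_iff by (metis add_is_0 less_not_refl)
  then show ?thesis by (auto simp: apery_set_def)
qed

lemma decompose:
  assumes "x \<in> S"
  obtains w f where "w \<in> Ap" "x = w + comb f"
proof -
  have "\<exists>w\<in>Ap. \<exists>f. x = w + comb f"
    using assms
  proof (induction "weight x" arbitrary: x rule: less_induct)
    case less
    show ?case
    proof (cases "x \<in> Ap")
      case True
      then show ?thesis by (intro bexI[of _ x] exI[of _ "\<lambda>_. 0"]) (simp_all add: comb_zero)
    next
      case False
      then obtain e y where e: "e \<in> E" "y \<in> S" "x = y + e" using less.prems by (auto simp: apery_set_def)
      then have "weight y < weight x" using weight_E_pos by simp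
      from less.hyps[OF this e(2)] obtain w f where w: "w \<in> Ap" "y = w + comb f" by (elim bexE exE)
      have "x = w + comb (\<lambda>i. f i + (if i = e then 1 else 0))"
        unfolding comb_add comb_unit[OF e(1)] e(3) w(2) by (simp add: add.assoc)
      then show ?thesis using w(1) by (intro bexI exI)
    qed
  qed
  then show thesis using that by (elim bexE exE)
qed

lemma decompose_outside:
  assumes x: "x \<in> S" "x \<notin> T + S" and T: "T \<subseteq> E"
  obtains w f where "w \<in> Ap" "x = w + comb f" "\<And>e. e \<in> T \<Longrightarrow> f e = 0"
proof -
  obtain w f where w: "w \<in> Ap" "x = w + comb f" by (rule decompose[OF x(1)])
  have "f e = 0" if "e \<in> T" for e
  proof (rule ccontr)
    assume "f e \<noteq> 0"
    then have "x = e + (w + comb (f(e := f e - 1)))"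
      using comb_remove[of e f] that T w(2) by (auto simp: add_ac)
    then have "x \<in> T + S" using that w(1) Ap_S comb_in by (auto intro!: set_plus_intro add_in)
    then show False using x(2) by simp
  qed
  then show thesis using that w by simp
qed

text \<open>A multiple \<open>k a\<close> of each generator \<open>a\<close> is a nonzero combination of \<open>E\<close>, so in a sum of generators that
  belongs to the Apery set, \<open>a\<close> occurs fewer than \<open>k\<close> times.\<close>

lemma finite_Ap: "finite Ap"
proof -
  have "\<forall>a\<in>A. \<exists>k>0. \<exists>f. of_nat k * a = comb f"
    unfolding comb_def using multiple_in_cone A_subset by auto
  then obtain k where k: "\<And>a. a \<in> A \<Longrightarrow> 0 < k a \<and> (\<exists>f. of_nat (k a) * a = comb f)" by metis
  let ?g = "\<lambda>n. \<Sum>a\<in>A. of_nat (n a) * a"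
  have gen: "\<exists>n. x = ?g n" if "x \<in> generated_monoid A" for x
    using that
  proof induction
    case zero
    then show ?case by (intro exI[of _ "\<lambda>_. 0"]) simp
  next
    case (add a y)
    then obtain n where n: "y = ?g n" by auto
    have "a = ?g (\<lambda>i. if i = a then 1 else 0)"
      using add(1) finite_A by (simp add: if_distrib[of "\<lambda>n. of_nat n * _"] cong: if_cong)
    then have "a + y = ?g (\<lambda>i. (if i = a then 1 else 0) + n i)"
      unfolding n by (simp add: distrib_right sum.distrib)
    then show ?case by (rule exI[of _ "\<lambda>i. (if i = a then 1 else 0) + n i"])
  qed
  have "Ap \<subseteq> ?g ` (PiE A (\<lambda>a. {..<k a}))"
  proof
    fix w assume w: "w \<in> Ap"
    then obtain n where n: "w = ?g n" using gen[of w] Ap_S generated_A by auto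
    have "n a < k a" if a: "a \<in> A" for a
    proof (rule ccontr)
      assume "\<not> n a < k a"
      then have na: "n a = k a + (n a - k a)" by simp
      obtain f where f: "of_nat (k a) * a = comb f" using k[OF a] by auto
      have "weight (comb f) \<noteq> 0"
        unfolding f[symmetric] weight_of_nat_mult using k[OF a] a zero_notin_A by auto
      then obtain e where e: "e \<in> E" "0 < f e"
        using comb_zero[of f] weight_eq_0_iff by (metis gr0I)
      have "w = of_nat (n a) * a + (\<Sum>b\<in>A - {a}. of_nat (n b) * b)"
        unfolding n by (rule sum.remove[OF finite_A a])
      also have "of_nat (n a) * a = comb f + of_nat (n a - k a) * a"
        by (subst na) (simp only: of_nat_add distrib_right f)
      also have "comb f = e + comb (f(e := f e - 1))" by (rule comb_remove[where f = f, OF e])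
      finally have "w = e + (comb (f(e := f e - 1)) + of_nat (n a - k a) * a
          + (\<Sum>b\<in>A - {a}. of_nat (n b) * b))" by (simp only: add.assoc)
      moreover have "comb (f(e := f e - 1)) + of_nat (n a - k a) * a + (\<Sum>b\<in>A - {a}. of_nat (n b) * b) \<in> S"
        using a A_subset by (intro add_in comb_in sum_in of_nat_mult_in) auto
      ultimately show False using Ap_not_sum[OF w e(1)] by blast
    qed
    then have "restrict n A \<in> PiE A (\<lambda>a. {..<k a})" by auto
    moreover have "w = ?g (restrict n A)" unfolding n by (rule sum.cong) simp_all
    ultimately show "w \<in> ?g ` (PiE A (\<lambda>a. {..<k a}))" by (simp only: image_eqI)
  qed
  then show ?thesis by (rule finite_subset) (intro finite_imageI finite_PiE finite_A, simp)
qed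

section \<open>Krull dimension\<close>

end

text \<open>To find a pair whose sum is attained only once, maximise the coordinates one after the other. This
  replaces a monomial order.\<close>

lemma unique_sum_pair:
  fixes X Y :: "(nat ^ 'd) set"
  assumes "finite X" "finite Y" "X \<noteq> {}" "Y \<noteq> {}"
  obtains x y where "x \<in> X" "y \<in> Y" "\<And>x' y'. x' \<in> X \<Longrightarrow> y' \<in> Y \<Longrightarrow> x' + y' = x + y \<Longrightarrow> x' = x"
proof -
  have "\<exists>x\<in>X. \<exists>y\<in>Y. \<forall>x'\<in>X. \<forall>y'\<in>Y. x' + y' = x + y \<longrightarrow> (\<forall>i\<in>I. x' $ i = x $ i)" if "finite I" for I
    using that assms
  proof (induction I arbitrary: X Y rule: finite_induct)
    case empty
    then show ?case by auto
  next
    case (insert i I)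
    define p where "p = Max ((\<lambda>x. x $ i) ` X)"
    define q where "q = Max ((\<lambda>x. x $ i) ` Y)"
    have le: "\<And>x. x \<in> X \<Longrightarrow> x $ i \<le> p" "\<And>y. y \<in> Y \<Longrightarrow> y $ i \<le> q"
      using insert.prems by (auto simp: p_def q_def)
    have "p \<in> (\<lambda>x. x $ i) ` X" "q \<in> (\<lambda>x. x $ i) ` Y"
      using insert.prems unfolding p_def q_def by (auto intro!: Max_in)
    then have ne: "{x \<in> X. x $ i = p} \<noteq> {}" "{y \<in> Y. y $ i = q} \<noteq> {}" by auto
    have "\<exists>x\<in>{x \<in> X. x $ i = p}. \<exists>y\<in>{y \<in> Y. y $ i = q}. \<forall>x'\<in>{x \<in> X. x $ i = p}. \<forall>y'\<in>{y \<in> Y. y $ i = q}.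
        x' + y' = x + y \<longrightarrow> (\<forall>j\<in>I. x' $ j = x $ j)"
      by (rule insert.IH[OF _ _ ne]) (use insert.prems in simp_all)
    then obtain x y where mem: "x \<in> {x \<in> X. x $ i = p}" "y \<in> {y \<in> Y. y $ i = q}"
      and unique: "\<forall>x'\<in>{x \<in> X. x $ i = p}. \<forall>y'\<in>{y \<in> Y. y $ i = q}. x' + y' = x + y \<longrightarrow> (\<forall>j\<in>I. x' $ j = x $ j)"
      by (elim bexE) (rule that)
    have xy: "x \<in> X" "x $ i = p" "y \<in> Y" "y $ i = q" using mem by simp_all
    have main: "\<forall>j\<in>insert i I. x' $ j = x $ j" if "x' \<in> X" "y' \<in> Y" "x' + y' = x + y" for x' y'
    proof -
      have "x' $ i + y' $ i = p + q" using arg_cong[OF that(3), of "\<lambda>v. v $ i"] xy by simp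
      then have "x' $ i = p" "y' $ i = q" using le(1)[OF that(1)] le(2)[OF that(2)] by simp_all
      then have "x' \<in> {x \<in> X. x $ i = p}" "y' \<in> {y \<in> Y. y $ i = q}" using that by simp_all
      from mp[OF bspec[OF bspec[OF unique this(1)] this(2)] that(3)] show ?thesis
        using \<open>x' $ i = p\<close> xy(2) by simp
    qed
    then have "\<forall>x'\<in>X. \<forall>y'\<in>Y. x' + y' = x + y \<longrightarrow> (\<forall>j\<in>insert i I. x' $ j = x $ j)"
      by (intro ballI impI) (rule bspec[OF main], assumption+)
    then show ?case by (rule bexI[OF bexI[OF _ xy(3)] xy(1)])
  qed
  from this[OF finite[of UNIV]] obtain x y where xy: "x \<in> X" "y \<in> Y"
    "\<forall>x'\<in>X. \<forall>y'\<in>Y. x' + y' = x + y \<longrightarrow> (\<forall>i\<in>UNIV. x' $ i = x $ i)" by (elim bexE) (rule that)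
  show thesis
  proof (rule that[OF xy(1,2)])
    fix x' y' assume "x' \<in> X" "y' \<in> Y" "x' + y' = x + y"
    from mp[OF bspec[OF bspec[OF xy(3) this(1)] this(2)] this(3)] show "x' = x"
      by (simp add: vec_eq_iff)
  qed
qed

context simplicial_monoid
begin

text \<open>The exponents in \<open>S\<close> outside the face of the cone that is spanned by \<open>E - T\<close>.\<close>

definition off_face :: "(nat ^ 'd) set \<Rightarrow> (nat ^ 'd) set" where
  "off_face T = {x \<in> S. \<exists>e\<in>T. 0 < coord e x}"

text \<open>If neither \<open>f\<close> nor \<open>g\<close> is in the ideal, both have monomials on the face. A pair of these with a unique
  sum survives in \<open>f g\<close>, because a sum of exponents lies on the face only if both summands do.\<close>

lemma primeideal_off_face:
  assumes T: "T \<subseteq> E"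
  shows "primeideal (supported_on (off_face T) :: ('d, 'k::field) mpoly set) (semigroup_ring S)"
proof -
  interpret unital_subring "supported_on S :: ('d, 'k) mpoly set" by (rule unital_subring)
  let ?P = "supported_on (off_face T) :: ('d, 'k) mpoly set"
  have face_add: "x + y \<in> off_face T \<longleftrightarrow> x \<in> off_face T \<or> y \<in> off_face T" if xy: "x \<in> S" "y \<in> S" for x y
  proof -
    have "0 < coord e (x + y) \<longleftrightarrow> 0 < coord e x \<or> 0 < coord e y" if "e \<in> T" for e
      using coord_add[OF xy, of e] coord_nonneg[of e x] coord_nonneg[of e y] xy that T by auto
    then show ?thesis using xy add_in[OF xy] by (auto simp: off_face_def)
  qed
  have sub: "off_face T \<subseteq> S" by (auto simp: off_face_def)
  have ideal: "ideal ?P (semigroup_ring S)"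
  proof (rule ideal_supported_on[OF sub])
    show "off_face T + S \<subseteq> off_face T"
    proof
      fix z assume "z \<in> off_face T + S"
      then obtain x y where "x \<in> off_face T" "y \<in> S" "z = x + y" by (auto elim!: set_plus_elim)
      then show "z \<in> off_face T" using face_add[of x y] sub by auto
    qed
  qed
  have zero: "0 \<notin> off_face T"
    using coord_add[OF zero_in zero_in] by (auto simp: off_face_def)
  show ?thesis
    unfolding semigroup_ring_eq primeideal_iff
  proof (intro conjI ballI impI)
    show "ideal ?P R" using ideal by (simp add: semigroup_ring_eq)
    show "?P \<noteq> supported_on S" using zero zero_in unfolding supported_on_inject by auto
    fix f g :: "('d, 'k) mpoly"
    assume f: "f \<in> supported_on S" and g: "g \<in> supported_on S" and fg: "f * g \<in> ?P"
    show "f \<in> ?P \<or> g \<in> ?P"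
    proof (rule ccontr)
      assume "\<not> ?thesis"
      then have ne: "keys f - off_face T \<noteq> {}" "keys g - off_face T \<noteq> {}"
        by (auto simp: supported_on_def)
      obtain x y where xy: "x \<in> keys f - off_face T" "y \<in> keys g - off_face T"
        "\<And>x' y'. x' \<in> keys f - off_face T \<Longrightarrow> y' \<in> keys g - off_face T \<Longrightarrow>
          x' + y' = x + y \<Longrightarrow> x' = x"
        using unique_sum_pair[of "keys f - off_face T" "keys g - off_face T"] ne by auto
      have keys: "x' \<in> S" if "x' \<in> keys f \<or> x' \<in> keys g" for x'
        using that f g by (auto simp: supported_on_def)
      have off: "x + y \<notin> off_face T" using face_add[of x y] keys xy by auto
      have "lookup (f * g) (x + y) = lookup f x * lookup g y"
      proof (rule lookup_mult_unique)
        fix x' y' assume *: "x' \<in> keys f" "y' \<in> keys g" "x' + y' = x + y"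
        then have "x' + y' \<notin> off_face T" using off by simp
        then show "x' = x" using xy(3)[of x' y'] face_add[of x' y'] keys * by auto
      qed
      also have "\<dots> \<noteq> 0" using xy by (auto simp: in_keys_iff)
      finally have "x + y \<in> keys (f * g)" by (simp add: in_keys_iff)
      then show False using fg off by (auto simp: supported_on_def)
    qed
  qed
qed

lemma off_face_E: "off_face E = S - {0}"
proof -
  have "coord e 0 = 0" for e using coord_add[OF zero_in zero_in, of e] by simp
  moreover have "\<exists>e\<in>E. 0 < coord e x" if x: "x \<in> S" "x \<noteq> 0" for x
  proof (rule ccontr)
    assume neg: "\<not> ?thesis"
    have "coord e x = 0" if "e \<in> E" for e
      using neg coord_nonneg[OF that x(1)] that by fastforce
    then show False using coord_eq_0[OF x(1)] x(2) by simp
  qed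
  ultimately show ?thesis by (auto simp: off_face_def)
qed

text \<open>The chain of faces obtained by omitting the elements of \<open>E\<close> one after the other.\<close>

lemma face_chain:
  "\<exists>P. prime_chain (semigroup_ring S) CARD('d) P \<and> P CARD('d) = (supported_on (S - {0}) :: ('d, 'k::field) mpoly set)"
proof -
  obtain es where es: "set es = E" "distinct es" using finite_distinct_list[OF finite_E] by auto
  then have len: "length es = CARD('d)" using distinct_card[of es] card_E by simp
  define P where "P i = (supported_on (off_face (set (take i es))) :: ('d, 'k) mpoly set)" for i
  have "primeideal (P i) (semigroup_ring S)" for i
    unfolding P_def by (rule primeideal_off_face) (use es(1) set_take_subset[of i es] in simp)
  moreover have "P i \<subset> P (Suc i)" if "i < CARD('d)" for i
  proof -
    have i: "i < length es" using that len by simp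
    have take: "set (take (Suc i) es) = insert (es ! i) (set (take i es))"
      using i by (simp add: take_Suc_conv_app_nth)
    have iE: "es ! i \<in> E" using i es(1) nth_mem by auto
    have "es ! i \<notin> set (take i es)"
      using es(2) i by (auto simp: in_set_conv_nth nth_eq_iff_index_eq)
    moreover have "set (take i es) \<subseteq> E" using es(1) set_take_subset[of i es] by auto
    ultimately have "coord e (es ! i) = 0" if "e \<in> set (take i es)" for e
      using coord_unit[of e "es ! i"] that iE by auto
    then have "es ! i \<in> off_face (set (take (Suc i) es))" "es ! i \<notin> off_face (set (take i es))"
      unfolding take using coord_unit[OF iE iE] E_S[OF iE] by (auto simp: off_face_def)
    then have "off_face (set (take i es)) \<noteq> off_face (set (take (Suc i) es))" by auto
    moreover have "off_face (set (take i es)) \<subseteq> off_face (set (take (Suc i) es))"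
      unfolding take by (auto simp: off_face_def)
    ultimately show ?thesis
      unfolding P_def by (intro psubsetI supported_on_mono) (simp_all add: supported_on_inject)
  qed
  moreover have "P CARD('d) = supported_on (S - {0})"
    using es(1) len off_face_E by (simp add: P_def)
  ultimately show ?thesis unfolding prime_chain_def by (intro exI[of _ P]) simp
qed

end

context unital_subring
begin

fun power_product :: "'a list \<Rightarrow> nat list \<Rightarrow> 'a" where
  "power_product (x # xs) (n # ns) = x ^ n * power_product xs ns"
| "power_product _ _ = 1"

lemma power_mem: "x \<in> B \<Longrightarrow> x ^ n \<in> B"
  by (induction n) auto

lemma sum_mem: "(\<And>i. i \<in> X \<Longrightarrow> f i \<in> B) \<Longrightarrow> sum f X \<in> B"
  by (induction X rule: infinite_finite_induct) auto

lemma power_product_mem: "set xs \<subseteq> B \<Longrightarrow> power_product xs ns \<in> B"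
  by (induction xs ns rule: power_product.induct) (auto intro: power_mem)

text \<open>In a polynomial relation of the \<open>x\<^sub>i\<close> modulo \<open>P\<^sub>0\<close>, divide by the smallest power of \<open>x\<^sub>0\<close> that
  occurs, which is possible since \<open>x\<^sub>0 \<notin> P\<^sub>0\<close>. As \<open>x\<^sub>0 \<in> P\<^sub>1\<close>, the terms that are now free of \<open>x\<^sub>0\<close> give a
  nontrivial relation of the remaining elements modulo \<open>P\<^sub>1\<close>, and so on until a unit lies in a prime.\<close>

lemma prime_chain_independent:
  assumes "finite F" "F \<noteq> {}" "\<And>\<alpha>. \<alpha> \<in> F \<Longrightarrow> length \<alpha> = length xs"
    and "\<And>\<alpha>. \<alpha> \<in> F \<Longrightarrow> k \<alpha> \<in> B \<and> (\<exists>v\<in>B. v * k \<alpha> = 1)"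
    and "prime_chain R (length xs) P" "\<And>i. i < length xs \<Longrightarrow> xs ! i \<in> P (Suc i) - P i"
  shows "(\<Sum>\<alpha>\<in>F. k \<alpha> * power_product xs \<alpha>) \<notin> P 0"
  using assms
proof (induction xs arbitrary: F k P)
  case Nil
  then have F: "F = {[]}" by auto
  have P: "primeideal (P 0) R" using Nil.prems(5) by (simp add: prime_chain_def)
  obtain v where v: "v \<in> B" "v * k [] = 1" using Nil.prems(4)[of "[]"] F by auto
  have "k [] \<notin> P 0"
  proof
    assume "k [] \<in> P 0"
    then have "v * k [] \<in> P 0" using P v(1) idealD(6) by (simp add: primeideal_iff)
    then show False using v(2) primeideal_one[OF P] by simp
  qed
  then show ?case using F by simp
next
  case (Cons x xs)
  have P: "primeideal (P i) R" if "i \<le> Suc (length xs)" for i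
    using Cons.prems(5) that by (simp add: prime_chain_def)
  have PI: "ideal (P 0) R" "ideal (P 1) R" using P[of 0] P[of 1] by (simp_all add: primeideal_iff)
  have P01: "P 0 \<subseteq> P 1" using Cons.prems(5) by (auto simp: prime_chain_def)
  have x: "x \<in> P 1" "x \<notin> P 0" "x \<in> B" using Cons.prems(6)[of 0] idealD(1)[OF PI(2)] by auto
  have xs: "set xs \<subseteq> B"
  proof
    fix y assume "y \<in> set xs"
    then obtain i where i: "i < length xs" "y = xs ! i" by (auto simp: in_set_conv_nth)
    then have "y \<in> P (Suc (Suc i))" using Cons.prems(6)[of "Suc i"] by simp
    moreover have "ideal (P (Suc (Suc i))) R" using P[of "Suc (Suc i)"] i by (simp add: primeideal_iff)
    ultimately show "y \<in> B" using idealD(1) by blast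
  qed
  have shape: "\<alpha> = hd \<alpha> # tl \<alpha>" "length (tl \<alpha>) = length xs" if "\<alpha> \<in> F" for \<alpha>
    using Cons.prems(3)[OF that] by (cases \<alpha>; simp)+
  define e where "e = Min (hd ` F)"
  define F0 where "F0 = {\<alpha> \<in> F. hd \<alpha> = e}"
  have e_le: "e \<le> hd \<alpha>" if "\<alpha> \<in> F" for \<alpha>
    using Cons.prems(1) that by (simp add: e_def)
  have "e \<in> hd ` F" unfolding e_def using Cons.prems(1,2) by (intro Min_in) auto
  then have F0: "F0 \<noteq> {}" "finite F0" "F0 \<subseteq> F" using Cons.prems(1) by (auto simp: F0_def)
  define low where "low = (\<Sum>\<alpha>\<in>F0. k \<alpha> * power_product xs (tl \<alpha>))"
  define high where "high = (\<Sum>\<alpha>\<in>F - F0. k \<alpha> * (x ^ (hd \<alpha> - Suc e) * power_product xs (tl \<alpha>)))"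
  have pp: "power_product (x # xs) \<alpha> = x ^ hd \<alpha> * power_product xs (tl \<alpha>)" if "\<alpha> \<in> F" for \<alpha>
    by (subst shape(1)[OF that]) simp
  have "(\<Sum>\<alpha>\<in>F. k \<alpha> * power_product (x # xs) \<alpha>) =
      (\<Sum>\<alpha>\<in>F - F0. k \<alpha> * power_product (x # xs) \<alpha>) + (\<Sum>\<alpha>\<in>F0. k \<alpha> * power_product (x # xs) \<alpha>)"
    using F0 Cons.prems(1) by (intro sum.subset_diff) auto
  also have "(\<Sum>\<alpha>\<in>F0. k \<alpha> * power_product (x # xs) \<alpha>) = x ^ e * low"
    unfolding low_def sum_distrib_left
  proof (rule sum.cong[OF refl])
    fix \<alpha> assume "\<alpha> \<in> F0"
    then have "power_product (x # xs) \<alpha> = x ^ e * power_product xs (tl \<alpha>)" using pp by (auto simp: F0_def)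
    then show "k \<alpha> * power_product (x # xs) \<alpha> = x ^ e * (k \<alpha> * power_product xs (tl \<alpha>))"
      by (simp only: mult.left_commute)
  qed
  also have "(\<Sum>\<alpha>\<in>F - F0. k \<alpha> * power_product (x # xs) \<alpha>) = x ^ e * (x * high)"
    unfolding high_def sum_distrib_left
  proof (rule sum.cong[OF refl])
    fix \<alpha> assume \<alpha>: "\<alpha> \<in> F - F0"
    then have "e < hd \<alpha>" using e_le[of \<alpha>] by (auto simp: F0_def)
    then have "hd \<alpha> = e + Suc (hd \<alpha> - Suc e)" by simp
    then have "x ^ hd \<alpha> = x ^ e * (x * x ^ (hd \<alpha> - Suc e))" by (metis power_add power_Suc)
    then show "k \<alpha> * power_product (x # xs) \<alpha> =
        x ^ e * (x * (k \<alpha> * (x ^ (hd \<alpha> - Suc e) * power_product xs (tl \<alpha>))))"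
      using pp[of \<alpha>] \<alpha> by (simp add: mult_ac)
  qed
  finally have split: "(\<Sum>\<alpha>\<in>F. k \<alpha> * power_product (x # xs) \<alpha>) = x ^ e * (low + x * high)"
    by (simp add: algebra_simps)
  have kB: "k \<alpha> \<in> B" if "\<alpha> \<in> F" for \<alpha> using Cons.prems(4)[OF that] by simp
  have mem: "low \<in> B" "high \<in> B"
    unfolding low_def high_def
    using F0(3) by (auto intro!: sum_mem mult_mem kB power_mem x(3) power_product_mem[OF xs])
  have "low \<notin> P 1"
  proof -
    have "low = (\<Sum>\<beta>\<in>tl ` F0. k (e # \<beta>) * power_product xs \<beta>)"
    proof -
      have "inj_on tl F0"
      proof (rule inj_onI)
        fix \<alpha> \<beta> assume "\<alpha> \<in> F0" "\<beta> \<in> F0" "tl \<alpha> = tl \<beta>"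
        then show "\<alpha> = \<beta>" using shape(1)[of \<alpha>] shape(1)[of \<beta>] by (auto simp: F0_def)
      qed
      then have "(\<Sum>\<beta>\<in>tl ` F0. k (e # \<beta>) * power_product xs \<beta>) =
          (\<Sum>\<alpha>\<in>F0. k (e # tl \<alpha>) * power_product xs (tl \<alpha>))"
        by (simp add: sum.reindex)
      also have "\<dots> = low"
        unfolding low_def
      proof (rule sum.cong[OF refl])
        fix \<alpha> assume "\<alpha> \<in> F0"
        then have "e # tl \<alpha> = \<alpha>" using shape(1)[of \<alpha>] by (auto simp: F0_def)
        then show "k (e # tl \<alpha>) * power_product xs (tl \<alpha>) = k \<alpha> * power_product xs (tl \<alpha>)" by simp
      qed
      finally show ?thesis by simp
    qed
    moreover have "(\<Sum>\<beta>\<in>tl ` F0. k (e # \<beta>) * power_product xs \<beta>) \<notin> P (Suc 0)"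
    proof (rule Cons.IH)
      show "finite (tl ` F0)" "tl ` F0 \<noteq> {}" using F0 by auto
      show "length \<alpha> = length xs" if "\<alpha> \<in> tl ` F0" for \<alpha> using that shape(2) F0(3) by auto
      show "k (e # \<alpha>) \<in> B \<and> (\<exists>v\<in>B. v * k (e # \<alpha>) = 1)" if \<alpha>: "\<alpha> \<in> tl ` F0" for \<alpha>
      proof -
        obtain \<beta> where \<beta>: "\<beta> \<in> F0" "\<alpha> = tl \<beta>" using \<alpha> by auto
        then have "\<beta> = e # \<alpha>" "\<beta> \<in> F" using shape(1)[of \<beta>] by (auto simp: F0_def)
        then show ?thesis using Cons.prems(4)[of \<beta>] by simp
      qed
      show "prime_chain R (length xs) (\<lambda>i. P (Suc i))"
        using Cons.prems(5) by (simp add: prime_chain_def)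
      show "xs ! i \<in> P (Suc (Suc i)) - P (Suc i)" if "i < length xs" for i
        using Cons.prems(6)[of "Suc i"] that by simp
    qed
    ultimately show ?thesis by simp
  qed
  show ?case
  proof
    assume "(\<Sum>\<alpha>\<in>F. k \<alpha> * power_product (x # xs) \<alpha>) \<in> P 0"
    then have *: "x ^ e * (low + x * high) \<in> P 0" by (simp add: split)
    have prime: "a \<in> P 0 \<or> b \<in> P 0" if "a \<in> B" "b \<in> B" "a * b \<in> P 0" for a b
      using P[of 0] that by (auto simp: primeideal_iff)
    have "x ^ n \<notin> P 0" for n
    proof (induction n)
      case 0
      then show ?case using primeideal_one[OF P[of 0]] by simp
    next
      case (Suc n)
      then show ?case using prime[of x "x ^ n"] x power_mem[of x n] by auto
    qed
    then have "low + x * high \<in> P 0"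
      using prime[OF power_mem[OF x(3)] _ *] mem x(3) by auto
    then have "low + x * high \<in> P 1" using P01 by auto
    moreover have "x * high \<in> P 1" using idealD(7)[OF PI(2) mem(2) x(1)] .
    ultimately have "low + x * high - x * high \<in> P 1" by (rule idealD(5)[OF PI(2)])
    then show False using \<open>low \<notin> P 1\<close> by simp
  qed
qed

end

text \<open>The coefficients are indexed by \<open>J\<close>, as the family may repeat a vector.\<close>

lemma family_dependent:
  fixes v :: "'j \<Rightarrow> ('e::cancel_comm_monoid_add \<Rightarrow>\<^sub>0 'k::field)"
  assumes J: "finite J" and U: "finite U" "card U < card J" and v: "\<And>j. j \<in> J \<Longrightarrow> v j \<in> supported_on U"
  shows "\<exists>u. (\<exists>j\<in>J. u j \<noteq> 0) \<and> (\<Sum>j\<in>J. single 0 (u j) * v j) = 0"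
proof (cases "inj_on v J")
  case True
  have "\<not> pm.independent (v ` J)"
  proof
    assume "pm.independent (v ` J)"
    moreover have "v ` J \<subseteq> pm.span (monomial ` U)" using v by (auto simp: span_monomials)
    ultimately have "card (v ` J) \<le> card (monomial ` U :: ('e \<Rightarrow>\<^sub>0 'k) set)"
      by (rule conjunct2[OF pm.independent_span_bound[OF finite_imageI[OF U(1)]]])
    then show False using U(2) True by (simp add: card_image inj_monomial)
  qed
  then have "\<exists>u. (\<exists>w\<in>v ` J. u w \<noteq> 0) \<and> (\<Sum>w\<in>v ` J. single 0 (u w) * w) = 0"
    unfolding pm.dependent_finite[OF finite_imageI[OF J]] not_not .
  then obtain u where u: "\<exists>w\<in>v ` J. u w \<noteq> 0" "(\<Sum>w\<in>v ` J. single 0 (u w) * w) = 0"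
    by (elim exE conjE)
  have "(\<Sum>j\<in>J. single 0 (u (v j)) * v j) = 0"
    using u(2) True by (simp add: sum.reindex)
  then show ?thesis using u(1) by (intro exI[of _ "u \<circ> v"]) auto
next
  case False
  then obtain i j where ij: "i \<in> J" "j \<in> J" "i \<noteq> j" "v i = v j" by (auto simp: inj_on_def)
  define u where "u l = (if l = i then 1 else if l = j then - 1 else (0 :: 'k))" for l
  have "(\<Sum>l\<in>J. single 0 (u l) * v l) =
      (\<Sum>l\<in>{i, j}. single 0 (u l) * v l)"
    by (rule sum.mono_neutral_right[OF J]) (use ij in \<open>auto simp: u_def\<close>)
  also have "\<dots> = 0" using ij by (simp add: u_def single_uminus)
  finally show ?thesis using ij(1) by (intro exI[of _ u]) (auto simp: u_def)
qed

context simplicial_monoid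
begin

lemma weight_bounded_mult:
  fixes p q :: "('d, 'k::field) mpoly"
  assumes "p \<in> supported_on {b \<in> S. weight b \<le> L}" "q \<in> supported_on {b \<in> S. weight b \<le> M}"
  shows "p * q \<in> supported_on {b \<in> S. weight b \<le> L + M}"
proof -
  have "{b \<in> S. weight b \<le> L} + {b \<in> S. weight b \<le> M} \<subseteq> {b \<in> S. weight b \<le> L + M}"
    by (auto elim!: set_plus_elim intro: add_in)
  then show ?thesis using supported_on_mult[OF assms] supported_on_mono by blast
qed

text \<open>An element outside \<open>T + S\<close> is a sum of an element of the Apery set and a combination of \<open>E - T\<close>, whose
  coefficients are bounded by its weight.\<close>

lemma card_outside_bound:
  assumes T: "T \<subseteq> E"
  shows "finite {x \<in> S - (T + S). weight x \<le> L}"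
    "card {x \<in> S - (T + S). weight x \<le> L} \<le> card Ap * Suc L ^ card (E - T)"
proof -
  let ?P = "PiE (E - T) (\<lambda>_. {..L})"
  let ?ext = "\<lambda>f e. if e \<in> E - T then f e else (0 :: nat)"
  let ?g = "\<lambda>(w, f). w + comb (?ext f)"
  have sub: "{x \<in> S - (T + S). weight x \<le> L} \<subseteq> ?g ` (Ap \<times> ?P)"
  proof
    fix x assume "x \<in> {x \<in> S - (T + S). weight x \<le> L}"
    then have x: "x \<in> S" "x \<notin> T + S" "weight x \<le> L" by auto
    obtain w f where w: "w \<in> Ap" "x = w + comb f" "\<And>e. e \<in> T \<Longrightarrow> f e = 0"
      by (rule decompose_outside[OF x(1,2) T]) (rule that)
    have "f e \<le> L" if "e \<in> E" for e
      using le_weight_comb[OF that, of f] x(3) w(2) by simp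
    then have "restrict f (E - T) \<in> ?P" by auto
    moreover have "comb f = comb (?ext (restrict f (E - T)))"
      by (rule comb_cong) (use w(3) in auto)
    ultimately show "x \<in> ?g ` (Ap \<times> ?P)"
      using w(1,2) by (intro image_eqI[of _ _ "(w, restrict f (E - T))"]) auto
  qed
  have fin: "finite (Ap \<times> ?P)" using finite_Ap finite_E by (intro finite_cartesian_product finite_PiE) auto
  show "finite {x \<in> S - (T + S). weight x \<le> L}"
    by (rule finite_subset[OF sub finite_imageI[OF fin]])
  have "card {x \<in> S - (T + S). weight x \<le> L} \<le> card (?g ` (Ap \<times> ?P))"
    by (rule card_mono[OF finite_imageI[OF fin] sub])
  also have "\<dots> \<le> card (Ap \<times> ?P)" by (rule card_image_le[OF fin])
  also have "\<dots> = card Ap * Suc L ^ card (E - T)"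
    using finite_E by (simp add: card_cartesian_product card_PiE)
  finally show "card {x \<in> S - (T + S). weight x \<le> L} \<le> card Ap * Suc L ^ card (E - T)" .
qed

text \<open>The polynomials \<open>x\<^sub>0, \<dots>, x\<^sub>D\<close> taken from the steps of a chain of primes have more power products with
  exponents below \<open>N\<close> than there are monomials outside \<open>T + S\<close> that can occur in them, if \<open>N\<close> is large. The
  resulting linear dependence modulo the monomials in \<open>T + S\<close> is a polynomial relation, contrary to
  \<open>prime_chain_independent\<close>.\<close>

lemma dim_below_outside:
  assumes T: "T \<subseteq> E"
  shows "unital_subring.dim_below (supported_on S) (supported_on (T + S) :: ('d, 'k::field) mpoly set) (Suc (card (E - T)))"
proof -
  interpret unital_subring "supported_on S :: ('d, 'k) mpoly set" by (rule unital_subring)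
  let ?I = "supported_on (T + S) :: ('d, 'k) mpoly set"
  define D where "D = card (E - T)"
  show ?thesis
    unfolding dim_below_def D_def[symmetric]
  proof (intro allI impI, rule ccontr)
    fix n P assume chain: "prime_chain R n P" and I: "?I \<subseteq> P 0" and n: "\<not> n < Suc D"
    then have chainD: "prime_chain R (Suc D) P" by (auto simp: prime_chain_def)
    have "\<exists>x. x \<in> P (Suc i) - P i" if "i < Suc D" for i
      using chainD that by (auto simp: prime_chain_def)
    then obtain x where x: "\<And>i. i < Suc D \<Longrightarrow> x i \<in> P (Suc i) - P i" by metis
    define xs where "xs = map x [0..<Suc D]"
    have len: "length xs = Suc D" by (simp add: xs_def)
    have xs_nth: "xs ! i \<in> P (Suc i) - P i" if "i < length xs" for i
      using x[of i] that by (simp add: xs_def del: upt_Suc)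
    have xs_S: "set xs \<subseteq> supported_on S"
    proof
      fix y assume "y \<in> set xs"
      then obtain i where i: "i < length xs" "y = xs ! i" by (auto simp: in_set_conv_nth)
      then have "y \<in> P (Suc i)" using xs_nth by auto
      moreover have "ideal (P (Suc i)) R" using chainD i len by (simp add: prime_chain_def primeideal_iff)
      ultimately show "y \<in> supported_on S" using idealD(1) by blast
    qed
    define M where "M = Max (insert 0 (weight ` (\<Union>y\<in>set xs. keys y)))"
    have fin_keys: "finite (\<Union>y\<in>set xs. keys y)" by simp
    have xs_M: "y \<in> supported_on {b \<in> S. weight b \<le> M}" if "y \<in> set xs" for y
    proof -
      have "weight b \<le> M" if "b \<in> keys y" for b
        unfolding M_def using fin_keys \<open>y \<in> set xs\<close> that by (intro Max_ge) auto
      then show ?thesis using subsetD[OF xs_S that] by (auto simp: supported_on_def)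
    qed
    have power_M: "y ^ j \<in> supported_on {b \<in> S. weight b \<le> M * j}" if "y \<in> set xs" for y j
    proof (induction j)
      case 0
      then show ?case by (simp add: supported_on_def)
    next
      case (Suc j)
      then show ?case using weight_bounded_mult[OF xs_M[OF that] Suc] by simp
    qed
    have pp_M: "power_product ys \<alpha> \<in> supported_on {b \<in> S. weight b \<le> M * N * length ys}"
      if "set ys \<subseteq> set xs" "length \<alpha> = length ys" "set \<alpha> \<subseteq> {..<N}" for ys \<alpha> N
      using that
    proof (induction ys \<alpha> rule: power_product.induct)
      case (1 y ys j \<alpha>)
      have "power_product ys \<alpha> \<in> supported_on {b \<in> S. weight b \<le> M * N * length ys}"
        using 1 by simp
      from weight_bounded_mult[OF power_M this, of y j]
      have "y ^ j * power_product ys \<alpha> \<in> supported_on {b \<in> S. weight b \<le> M * j + M * N * length ys}"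
        using 1 by simp
      moreover have "j \<le> N" using 1 by auto
      then have "M * j + M * N * length ys \<le> M * N * length (y # ys)" by simp
      then have "{b \<in> S. weight b \<le> M * j + M * N * length ys} \<subseteq> {b \<in> S. weight b \<le> M * N * length (y # ys)}"
        by (intro Collect_mono) (blast intro: order_trans)
      from supported_on_mono[OF this] have "supported_on {b \<in> S. weight b \<le> M * j + M * N * length ys} \<subseteq>
          (supported_on {b \<in> S. weight b \<le> M * N * length (y # ys)} :: ('d, 'k) mpoly set)" .
      ultimately show ?case unfolding power_product.simps by (rule rev_subsetD)
    qed (auto simp: supported_on_def)
    \<comment> \<open>There are \<open>N ^ (D + 1)\<close> power products with exponents below \<open>N\<close>, but only \<open>O(N ^ D)\<close> monomials
      that they involve modulo \<open>I\<close>; this value of \<open>N\<close> suffices to make the former number larger.\<close>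
    define q where "q = Suc (M * Suc D)"
    define N where "N = Suc (card Ap * q ^ D)"
    define L where "L = M * N * Suc D"
    define C where "C = {b \<in> S - (T + S). weight b \<le> L}"
    define J where "J = {\<alpha>. set \<alpha> \<subseteq> {..<N} \<and> length \<alpha> = Suc D}"
    have J: "finite J" "card J = N ^ Suc D"
      unfolding J_def using finite_lists_length_eq[of "{..<N}" "Suc D"] card_lists_length_eq[of "{..<N}" "Suc D"]
      by auto
    have "card C \<le> card Ap * Suc L ^ D"
      using card_outside_bound(2)[OF T, of L] by (simp add: C_def D_def)
    also have "\<dots> \<le> card Ap * (q * N) ^ D"
    proof -
      have "Suc L \<le> q * N" by (simp add: L_def q_def N_def algebra_simps)
      then show ?thesis by (intro mult_left_mono power_mono) auto
    qed
    also have "\<dots> = (card Ap * q ^ D) * N ^ D" by (simp add: power_mult_distrib)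
    also have "\<dots> < N * N ^ D" by (simp add: N_def)
    finally have cardC: "card C < card J" by (simp add: J(2))
    have finC: "finite C" using card_outside_bound(1)[OF T] by (simp add: C_def)
    have ppJ: "power_product xs \<alpha> \<in> supported_on {b \<in> S. weight b \<le> L}" if "\<alpha> \<in> J" for \<alpha>
      using pp_M[of xs \<alpha> N] that len by (simp add: J_def L_def)
    obtain u where u: "\<exists>\<alpha>\<in>J. u \<alpha> \<noteq> 0"
      "(\<Sum>\<alpha>\<in>J. single 0 (u \<alpha>) * restrict_to C (power_product xs \<alpha>)) = 0"
      using family_dependent[OF J(1) finC cardC, of "\<lambda>\<alpha>. restrict_to C (power_product xs \<alpha>)"]
        restrict_to_supported_on by blast
    define F where "F = {\<alpha> \<in> J. u \<alpha> \<noteq> 0}"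
    define k where "k \<alpha> = single (0 :: nat ^ 'd) (u \<alpha>)" for \<alpha>
    have sumF: "(\<Sum>\<alpha>\<in>F. k \<alpha> * g \<alpha>) = (\<Sum>\<alpha>\<in>J. single 0 (u \<alpha>) * g \<alpha>)" for g
      unfolding F_def k_def by (rule sum.mono_neutral_left) (use J(1) in auto)
    have "(\<Sum>\<alpha>\<in>F. k \<alpha> * power_product xs \<alpha>) =
        (\<Sum>\<alpha>\<in>F. k \<alpha> * (power_product xs \<alpha> - restrict_to C (power_product xs \<alpha>)))"
      using u(2) by (simp add: right_diff_distrib sum_subtractf sumF)
    moreover have "(\<Sum>\<alpha>\<in>F. k \<alpha> * (power_product xs \<alpha> - restrict_to C (power_product xs \<alpha>))) \<in> ?I"
    proof -
      have "ideal ?I (semigroup_ring S)"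
      proof (rule ideal_supported_on)
        show "T + S \<subseteq> S" by (rule set_plus_S) (use T E_S in auto)
      qed (simp add: add.assoc plus_S_idem)
      note I' = idealD[OF this[unfolded semigroup_ring_eq]]
      have "k \<alpha> * (power_product xs \<alpha> - restrict_to C (power_product xs \<alpha>)) \<in> ?I" if "\<alpha> \<in> F" for \<alpha>
      proof (rule I'(6))
        show "k \<alpha> \<in> supported_on S" by (simp add: k_def single_supported_on)
        have keys: "b \<in> S \<and> weight b \<le> L" if "lookup (power_product xs \<alpha>) b \<noteq> 0" for b
          using ppJ[of \<alpha>] \<open>\<alpha> \<in> F\<close> that by (auto simp: F_def supported_on_def in_keys_iff)
        show "power_product xs \<alpha> - restrict_to C (power_product xs \<alpha>) \<in> ?I"
          using keys by (auto simp: supported_on_def in_keys_iff lookup_minus lookup_restrict_to when_def C_def split: if_splits)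
      qed
      then show ?thesis
        using J(1) by (induction F rule: infinite_finite_induct) (auto simp: I'(2,3))
    qed
    ultimately have "(\<Sum>\<alpha>\<in>F. k \<alpha> * power_product xs \<alpha>) \<in> P 0" using I by auto
    moreover have "(\<Sum>\<alpha>\<in>F. k \<alpha> * power_product xs \<alpha>) \<notin> P 0"
    proof (rule prime_chain_independent)
      show "finite F" "F \<noteq> {}" using J(1) u(1) by (auto simp: F_def)
      show "length \<alpha> = length xs" if "\<alpha> \<in> F" for \<alpha> using that len by (auto simp: F_def J_def)
      show "k \<alpha> \<in> supported_on S \<and> (\<exists>v\<in>supported_on S. v * k \<alpha> = 1)" if "\<alpha> \<in> F" for \<alpha>
      proof
        show "k \<alpha> \<in> supported_on S" by (simp add: k_def single_supported_on)
        have "single 0 (1 / u \<alpha>) * k \<alpha> = 1"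
          using that by (simp add: k_def mult_single F_def)
        then show "\<exists>v\<in>supported_on S. v * k \<alpha> = 1"
          by (rule bexI) (simp add: single_supported_on)
      qed
      show "prime_chain R (length xs) P" using chainD len by simp
    qed (rule xs_nth)
    ultimately show False by contradiction
  qed
qed

lemma krull_dim_eq: "krull_dim (semigroup_ring S :: ('d, 'k::field) mpoly ring) = CARD('d)"
proof -
  interpret unital_subring "supported_on S :: ('d, 'k) mpoly set" by (rule unital_subring)
  have "n \<le> CARD('d)" if "prime_chain R n P" for n P
  proof -
    have "ideal (P 0) R" using that by (simp add: prime_chain_def primeideal_iff)
    then have "supported_on ({} + S) \<subseteq> P 0"
      using idealD(2) by (auto simp: set_plus_def supported_on_def)
    then have "n < Suc (card (E - {}))"
      using dim_below_outside[of "{}", where 'k = 'k] that unfolding dim_below_def by blast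
    then show ?thesis using card_E by simp
  qed
  then show ?thesis
    using face_chain[where 'k = 'k] unfolding krull_dim_def semigroup_ring_eq
    by (intro antisym SUP_least SUP_upper) auto
qed

lemma height_maximal:
  "enat CARD('d) \<le> height (semigroup_ring S) (supported_on (S - {0}) :: ('d, 'k::field) mpoly set)"
  unfolding height_def using face_chain[where 'k = 'k] by (intro SUP_upper) auto

end

section \<open>Cohen-Macaulay simplicial semigroup rings\<close>

context simplicial_monoid
begin

text \<open>The quotient by \<open>I = (x\<^sup>e, x\<^bsup>e'\<^esup>)\<close> has dimension at most \<open>d - 2\<close>, so the homomorphism \<open>p \<mapsto> p x\<^sup>b / x\<^sup>e\<close> on
  \<open>I\<close> agrees with the multiplication by some \<open>s \<in> R\<close> after multiplication by an element \<open>u \<notin> m\<close>. This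
  gives \<open>u x\<^sup>b = s x\<^sup>e\<close>. Since \<open>u\<close> has a nonzero constant term, \<open>x\<^sup>b\<close> occurs in \<open>s x\<^sup>e\<close>.\<close>

lemma cohen_macaulay_exchange:
  assumes CM: "cohen_macaulay (semigroup_ring S :: ('d, 'k::field) mpoly ring)"
    and e: "e \<in> E" "e' \<in> E" "e \<noteq> e'" and b: "b \<in> S" "c \<in> S" "b + e' = c + e"
  shows "\<exists>x\<in>S. b = x + e"
proof -
  interpret noetherian_subring "supported_on S :: ('d, 'k) mpoly set"
    using unital_subring[where 'k = 'k] CM
    by (simp add: noetherian_subring_def noetherian_subring_axioms_def cohen_macaulay_def semigroup_ring_eq)
  let ?m = "supported_on (S - {0}) :: ('d, 'k) mpoly set"
  let ?I = "monomial_ideal S {e, e'} :: ('d, 'k) mpoly set"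
  have m: "primeideal ?m R" using primeideal_maximal(1) unfolding semigroup_ring_eq .
  have depth: "enat CARD('d) \<le> depth R ?m"
    using CM primeideal_maximal(2)[where 'k = 'k] height_maximal[where 'k = 'k]
    by (simp add: cohen_macaulay_def semigroup_ring_eq)
  have eS: "e \<in> S" "e' \<in> S" using e E_S by auto
  have I_eq: "?I = supported_on ({e, e'} + S)" by (rule monomial_ideal_eq) (use eS in auto)
  have I_gen: "?I = Idl\<^bsub>R\<^esub> {monomial e, monomial e'}"
    by (simp add: monomial_ideal_def semigroup_ring_eq)
  have I: "ideal ?I R" unfolding I_gen by (rule genideal_ideal) (use eS in simp)
  have card2: "card {e, e'} \<le> CARD('d)"
    unfolding card_E[symmetric] using e finite_E by (intro card_mono) auto
  have "card (E - {e, e'}) = CARD('d) - 2"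
    using e finite_E card_E by (simp add: card_Diff_subset)
  then have dim: "dim_below ?I (Suc (CARD('d) - 2))"
    using dim_below_outside[of "{e, e'}", where 'k = 'k] e unfolding I_eq by simp
  have k: "Suc (CARD('d) - 2) < CARD('d)" using card2 e(3) by simp
  \<comment> \<open>The quotient \<open>p x\<^sup>b / x\<^sup>e\<close>; it is a polynomial in \<open>R\<close> for each \<open>p \<in> I\<close>, as it is for both generators.\<close>
  define \<phi> where "\<phi> p = (SOME q. q \<in> supported_on S \<and> monomial e * q = p * monomial b)" for p :: "('d, 'k) mpoly"
  let ?Q = "{p \<in> supported_on S :: ('d, 'k) mpoly set. \<exists>q\<in>supported_on S. monomial e * q = p * monomial b}"
  have "ideal ?Q R"
    unfolding ideal_iff
  proof (intro conjI ballI)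
    show "0 \<in> ?Q" by (intro CollectI conjI bexI[of _ 0]) simp_all
    fix p assume "p \<in> ?Q"
    then obtain q where p: "p \<in> supported_on S" "q \<in> supported_on S" "monomial e * q = p * monomial b" by auto
    show "p + p' \<in> ?Q" if p': "p' \<in> ?Q" for p'
    proof -
      obtain q' where "p' \<in> supported_on S" "q' \<in> supported_on S" "monomial e * q' = p' * monomial b" using p' by auto
      then show ?thesis using p by (intro CollectI conjI bexI[of _ "q + q'"]) (auto simp: algebra_simps)
    qed
    show "r * p \<in> ?Q" if r: "r \<in> supported_on S" for r
    proof -
      have "monomial e * (r * q) = r * p * monomial b" using p(3) by (simp add: mult.left_commute mult.assoc)
      then show ?thesis using p r by (intro CollectI conjI bexI[of _ "r * q"]) auto
    qed
  qed auto
  moreover have "{monomial e, monomial e'} \<subseteq> ?Q"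
  proof -
    have "monomial e * monomial b = (monomial e * monomial b :: ('d, 'k) mpoly)" ..
    moreover have "monomial e * monomial c = (monomial e' * monomial b :: ('d, 'k) mpoly)"
      using b(3) by (simp add: monomial_mult add.commute)
    ultimately show ?thesis using eS b(1,2) by auto
  qed
  ultimately have I_Q: "?I \<subseteq> ?Q" unfolding I_gen by (rule genideal_least)
  have \<phi>: "\<phi> p \<in> supported_on S" "monomial e * \<phi> p = p * monomial b" if "p \<in> ?I" for p
  proof -
    have "\<exists>q. q \<in> supported_on S \<and> monomial e * q = p * monomial b" using that I_Q by blast
    from someI_ex[OF this] show "\<phi> p \<in> supported_on S" "monomial e * \<phi> p = p * monomial b"
      by (simp_all add: \<phi>_def)
  qed
  have "hom_mod ?I {0} \<phi>"
    unfolding hom_mod_def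
  proof (intro conjI ballI)
    fix p assume p: "p \<in> ?I"
    show "\<phi> p \<in> supported_on S" by (rule \<phi>(1)[OF p])
    show "\<phi> (p + q) - (\<phi> p + \<phi> q) \<in> {0}" if q: "q \<in> ?I" for q
    proof -
      have "monomial e * \<phi> (p + q) = monomial e * (\<phi> p + \<phi> q)"
        using \<phi>(2)[OF p] \<phi>(2)[OF q] \<phi>(2)[OF idealD(3)[OF I p q]] by (simp add: algebra_simps)
      then show ?thesis using single_mult_left_cancel by simp
    qed
    show "\<phi> (r * p) - r * \<phi> p \<in> {0}" if r: "r \<in> supported_on S" for r
    proof -
      have "monomial e * \<phi> (r * p) = r * (monomial e * \<phi> p)"
        using \<phi>(2)[OF p] \<phi>(2)[OF idealD(6)[OF I r p]] by (simp add: mult.assoc)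
      also have "\<dots> = monomial e * (r * \<phi> p)" by (simp add: mult.left_commute)
      finally show ?thesis using single_mult_left_cancel by simp
    qed
  qed
  from depth_ext_vanishing[OF m depth k I dim this]
  obtain u s where u: "u \<in> supported_on S - ?m" "s \<in> supported_on S" "\<forall>p\<in>?I. u * \<phi> p = s * p"
    by (elim bexE)
  have eI: "monomial e \<in> ?I"
    using genideal_self[of "{monomial e, monomial e'}"] eS unfolding I_gen by simp
  have "\<phi> (monomial e) = monomial b" using \<phi>(2)[OF eI] by (rule single_mult_left_cancel)
  then have eq: "u * monomial b = s * monomial e" using u(3) eI by metis
  have "lookup u 0 \<noteq> 0"
    using u(1) by (auto simp: supported_on_def in_keys_iff)
  moreover have "lookup (u * monomial b) b = lookup u 0"
    using lookup_single_times[of b 1 u 0] by (simp add: mult.commute)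
  ultimately have "b \<in> keys (s * monomial e)" by (simp add: eq[symmetric] in_keys_iff)
  then obtain x y where "x \<in> keys s" "y \<in> keys (monomial e :: ('d, 'k) mpoly)" "b = x + y"
    using keys_mult[of s "monomial e"] by blast
  then show ?thesis using u(2) by (auto simp: supported_on_def)
qed

text \<open>Both conclusions say that the vector \<open>u - comb g = v - comb f\<close> lies in \<open>S\<close>. By induction this holds for
  the sum of this vector with some \<open>i\<close> in the support of \<open>f\<close> and for its sum with some \<open>j\<close> in the support
  of \<open>g\<close>, and the exchange property applies to these two sums.\<close>

lemma comb_exchange:
  assumes exchange: "\<And>e e' b c. e \<in> E \<Longrightarrow> e' \<in> E \<Longrightarrow> e \<noteq> e' \<Longrightarrow> b \<in> S \<Longrightarrow> c \<in> S \<Longrightarrow> b + e' = c + e \<Longrightarrow>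
      \<exists>x\<in>S. b = x + e"
  shows "u \<in> S \<Longrightarrow> v \<in> S \<Longrightarrow> u + comb f = v + comb g \<Longrightarrow> (\<And>e. e \<in> E \<Longrightarrow> f e = 0 \<or> g e = 0) \<Longrightarrow>
    \<exists>x\<in>S. u = x + comb g \<and> v = x + comb f"
proof (induction "(\<Sum>e\<in>E. f e) + (\<Sum>e\<in>E. g e)" arbitrary: u v f g rule: less_induct)
  case less
  show ?case
  proof (cases "(\<forall>e\<in>E. f e = 0) \<or> (\<forall>e\<in>E. g e = 0)")
    case True
    then show ?thesis
    proof
      assume "\<forall>e\<in>E. f e = 0"
      then have "comb f = 0" by (simp add: comb_zero)
      then show ?thesis using less.prems by (intro bexI[of _ v]) auto
    next
      assume "\<forall>e\<in>E. g e = 0"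
      then have "comb g = 0" by (simp add: comb_zero)
      then show ?thesis using less.prems by (intro bexI[of _ u]) auto
    qed
  next
    case False
    then obtain i j where ij: "i \<in> E" "0 < f i" "j \<in> E" "0 < g j" by auto
    then have "i \<noteq> j" using less.prems(4)[of i] by auto
    define f' where "f' = f(i := f i - 1)"
    define g' where "g' = g(j := g j - 1)"
    have f': "comb f = i + comb f'" unfolding f'_def by (rule comb_remove[where f = f, OF ij(1,2)])
    have g': "comb g = j + comb g'" unfolding g'_def by (rule comb_remove[where f = g, OF ij(3,4)])
    have sum_less: "(\<Sum>e\<in>E. (h(l := h l - 1)) e) < (\<Sum>e\<in>E. h e)" if "l \<in> E" "0 < h l" for h :: "nat ^ 'd \<Rightarrow> nat" and l
      using that finite_E by (intro sum_strict_mono_ex1) auto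
    have "\<exists>y\<in>S. u + i = y + comb g \<and> v = y + comb f'"
    proof (rule less.hyps)
      show "sum f' E + sum g E < sum f E + sum g E" using sum_less[of i f] ij by (simp add: f'_def)
      show "u + i \<in> S" using less.prems(1) E_S[OF ij(1)] by (rule add_in)
      show "u + i + comb f' = v + comb g" using less.prems(3) f' by (simp add: add.assoc)
      show "f' e = 0 \<or> g e = 0" if "e \<in> E" for e using less.prems(4)[OF that] by (auto simp: f'_def)
    qed (rule less.prems)
    then obtain y where y: "y \<in> S" "u + i = y + comb g" "v = y + comb f'" by auto
    have "\<exists>z\<in>S. u = z + comb g' \<and> v + j = z + comb f"
    proof (rule less.hyps)
      show "sum f E + sum g' E < sum f E + sum g E" using sum_less[of j g] ij by (simp add: g'_def)
      show "v + j \<in> S" using less.prems(2) E_S[OF ij(3)] by (rule add_in)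
      show "u + comb f = v + j + comb g'" using less.prems(3) g' by (simp add: add.assoc)
      show "f e = 0 \<or> g' e = 0" if "e \<in> E" for e using less.prems(4)[OF that] by (auto simp: g'_def)
    qed (rule less.prems)
    then obtain z where z: "z \<in> S" "u = z + comb g'" "v + j = z + comb f" by auto
    have "y + j + comb g' = z + i + comb g'"
      using y(2) z(2) g' by (simp add: add_ac)
    then have "y + j = z + i" by simp
    from exchange[OF ij(1,3) \<open>i \<noteq> j\<close> y(1) z(1) this] obtain x where x: "x \<in> S" "y = x + i" by auto
    have "u + i = x + comb g + i" using y(2) x(2) by (simp add: add_ac)
    then have "u = x + comb g" by simp
    moreover have "v = x + comb f" using y(3) x(2) f' by (simp add: add_ac)
    ultimately show ?thesis using x(1) by auto
  qed
qed

text \<open>After cancelling the common part \<open>h\<close> of \<open>f\<close> and \<open>f'\<close>, the exchange lemma writes \<open>w\<close> and \<open>w'\<close> as sums in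
  which the remaining combinations of \<open>E\<close> occur; these must be empty, as \<open>w\<close> and \<open>w'\<close> are in the Apery set.\<close>

lemma decomposition_unique:
  assumes exchange: "\<And>e e' b c. e \<in> E \<Longrightarrow> e' \<in> E \<Longrightarrow> e \<noteq> e' \<Longrightarrow> b \<in> S \<Longrightarrow> c \<in> S \<Longrightarrow> b + e' = c + e \<Longrightarrow>
      \<exists>x\<in>S. b = x + e"
    and w: "w \<in> Ap" "w' \<in> Ap" and eq: "w + comb f = w' + comb f'"
  shows "w = w' \<and> (\<forall>e\<in>E. f e = f' e)"
proof -
  define h where "h e = min (f e) (f' e)" for e
  define g where "g e = f e - h e" for e
  define g' where "g' e = f' e - h e" for e
  have f: "comb f = comb h + comb g" "comb f' = comb h + comb g'"
    unfolding comb_add[symmetric] by (rule comb_cong; simp add: g_def g'_def h_def)+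
  have "w + comb g + comb h = w' + comb g' + comb h" using eq f by (simp add: add_ac)
  then have eq': "w + comb g = w' + comb g'" by simp
  have "\<exists>x\<in>S. w = x + comb g' \<and> w' = x + comb g"
    by (rule comb_exchange, fact exchange) (use eq' w Ap_S in \<open>auto simp: g_def g'_def h_def\<close>)
  then obtain x where x: "x \<in> S" "w = x + comb g'" "w' = x + comb g" by auto
  have zero: "\<forall>e\<in>E. r e = 0" if "v \<in> Ap" "v = x + comb r" for v r
  proof (rule ballI, rule ccontr)
    fix e assume e: "e \<in> E" "r e \<noteq> 0"
    then have "v = e + (x + comb (r(e := r e - 1)))"
      using comb_remove[of e r] that(2) by (simp add: add_ac)
    moreover have "x + comb (r(e := r e - 1)) \<in> S" using x(1) comb_in by (rule add_in)
    ultimately show False using Ap_not_sum[OF that(1) e(1)] by blast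
  qed
  have "\<forall>e\<in>E. g' e = 0" "\<forall>e\<in>E. g e = 0" using zero[OF w(1) x(2)] zero[OF w(2) x(3)] by auto
  then show ?thesis
    using x(2,3) by (auto simp: comb_zero g_def g'_def h_def intro!: le_antisym)
qed

section \<open>The multiplicity\<close>

text \<open>The exponents of the \<open>n\<close>-th power of the ideal generated by the monomials of \<open>E\<close>.\<close>

definition E_power :: "nat \<Rightarrow> (nat ^ 'd) set" where
  "E_power n = {comb f + y | f y. (\<Sum>e\<in>E. f e) = n \<and> y \<in> S}"

lemma E_power_0: "E_power 0 = S"
proof -
  have "comb f = 0" if "(\<Sum>e\<in>E. f e) = 0" for f using that finite_E by (intro comb_zero) simp
  then show ?thesis unfolding E_power_def by (force intro: exI[of _ "\<lambda>_. 0"])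
qed

lemma E_power_Suc: "E_power (Suc n) = E + E_power n"
proof
  show "E_power (Suc n) \<subseteq> E + E_power n"
  proof
    fix x assume "x \<in> E_power (Suc n)"
    then obtain f y where x: "x = comb f + y" "(\<Sum>e\<in>E. f e) = Suc n" "y \<in> S" by (auto simp: E_power_def)
    then obtain e where e: "e \<in> E" "0 < f e" by (metis sum.neutral gr0I nat.distinct(1))
    have "x = e + (comb (f(e := f e - 1)) + y)" using comb_remove[where f = f, OF e] x(1) by (simp add: add.assoc)
    moreover have "(\<Sum>l\<in>E. (f(e := f e - 1)) l) = n"
      using x(2) e finite_E by (simp add: sum.remove[OF finite_E e(1)])
    ultimately have "comb (f(e := f e - 1)) + y \<in> E_power n"
      unfolding E_power_def using x(3) by (intro CollectI exI[of _ "f(e := f e - 1)"] exI[of _ y]) simp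
    then show "x \<in> E + E_power n"
      unfolding \<open>x = e + _\<close> using e(1) by (intro set_plus_intro)
  qed
  show "E + E_power n \<subseteq> E_power (Suc n)"
  proof
    fix x assume "x \<in> E + E_power n"
    then obtain e f y where x: "e \<in> E" "x = e + (comb f + y)" "(\<Sum>e\<in>E. f e) = n" "y \<in> S"
      by (auto simp: E_power_def elim!: set_plus_elim)
    have "comb (\<lambda>i. (if i = e then 1 else 0) + f i) = e + comb f"
      unfolding comb_add comb_unit[OF x(1)] ..
    moreover have "(\<Sum>i\<in>E. (if i = e then 1 else 0) + f i) = Suc n"
      using x(1,3) finite_E by (simp add: sum.distrib)
    ultimately show "x \<in> E_power (Suc n)"
      unfolding E_power_def using x(2,4)
      by (intro CollectI exI[of _ "\<lambda>i. (if i = e then 1 else 0) + f i"] exI[of _ y]) (simp add: add.assoc)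
  qed
qed

lemma E_power_antimono: "m \<le> n \<Longrightarrow> E_power n \<subseteq> E_power m"
proof (rule lift_Suc_antimono_le[of E_power])
  fix n
  show "E_power (Suc n) \<subseteq> E_power n"
  proof
    fix x assume "x \<in> E_power (Suc n)"
    then obtain e f y where x: "e \<in> E" "x = e + (comb f + y)" "(\<Sum>e\<in>E. f e) = n" "y \<in> S"
      unfolding E_power_Suc by (auto simp: E_power_def elim!: set_plus_elim)
    then have "x = comb f + (e + y)" "e + y \<in> S" using E_S by (auto simp: add_ac intro: add_in)
    then show "x \<in> E_power n"
      unfolding E_power_def using x(3) by (intro CollectI exI[of _ f] exI[of _ "e + y"]) simp
  qed
qed

end

text \<open>Summing over \<open>i\<close>, where \<open>n - i\<close> is the value at one element of \<open>E\<close>, reduces the count to the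
  hockey-stick identity for binomial coefficients.\<close>

lemma card_bounded_sum:
  assumes "finite E"
  shows "finite {f \<in> E \<rightarrow>\<^sub>E UNIV. (\<Sum>e\<in>E. f e) \<le> n} \<and>
    card {f \<in> E \<rightarrow>\<^sub>E (UNIV :: nat set). (\<Sum>e\<in>E. f e) \<le> n} = (n + card E) choose card E"
  using assms
proof (induction E arbitrary: n rule: finite_induct)
  case empty
  have "{f \<in> {} \<rightarrow>\<^sub>E (UNIV :: nat set). (\<Sum>e\<in>{}. f e) \<le> n} = {\<lambda>_. undefined}" by auto
  then show ?case by simp
next
  case (insert e E)
  let ?B = "\<lambda>n. {f \<in> E \<rightarrow>\<^sub>E (UNIV :: nat set). (\<Sum>e\<in>E. f e) \<le> n}"
  let ?X = "Sigma {..n} ?B"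
  have sum_upd: "(\<Sum>i\<in>E. (f(e := c)) i) = (\<Sum>i\<in>E. f i)" for f :: "'a \<Rightarrow> nat" and c
    using insert.hyps by (intro sum.cong) auto
  have bij: "bij_betw (\<lambda>(i, f). f(e := n - i)) ?X {f \<in> insert e E \<rightarrow>\<^sub>E (UNIV :: nat set). (\<Sum>e\<in>insert e E. f e) \<le> n}"
  proof (rule bij_betwI[where g = "\<lambda>f. (n - f e, restrict f E)"])
    show "(\<lambda>(i, f). f(e := n - i)) \<in> ?X \<rightarrow> {f \<in> insert e E \<rightarrow>\<^sub>E UNIV. (\<Sum>e\<in>insert e E. f e) \<le> n}"
    proof
      fix x assume "x \<in> ?X"
      then obtain i f where x: "x = (i, f)" "i \<le> n" "f \<in> E \<rightarrow>\<^sub>E UNIV" "(\<Sum>e\<in>E. f e) \<le> i" by auto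
      have "f(e := n - i) \<in> insert e E \<rightarrow>\<^sub>E UNIV"
        using x(3) by (auto simp: PiE_iff extensional_def)
      moreover have "(\<Sum>l\<in>insert e E. (f(e := n - i)) l) \<le> n"
        unfolding sum.insert[OF insert.hyps] sum_upd using x(2,4) by simp
      ultimately show "(case x of (i, f) \<Rightarrow> f(e := n - i)) \<in> {f \<in> insert e E \<rightarrow>\<^sub>E UNIV. (\<Sum>e\<in>insert e E. f e) \<le> n}"
        using x(1) by simp
    qed
    show "(\<lambda>f. (n - f e, restrict f E)) \<in> {f \<in> insert e E \<rightarrow>\<^sub>E UNIV. (\<Sum>e\<in>insert e E. f e) \<le> n} \<rightarrow> ?X"
      using insert.hyps by auto
    show "(n - (case x of (i, f) \<Rightarrow> f(e := n - i)) e, restrict (case x of (i, f) \<Rightarrow> f(e := n - i)) E) = x" if "x \<in> ?X" for x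
      using that insert.hyps by (auto simp: fun_eq_iff PiE_def extensional_def restrict_def)
    show "(case (n - f e, restrict f E) of (i, f) \<Rightarrow> f(e := n - i)) = f"
      if "f \<in> {f \<in> insert e E \<rightarrow>\<^sub>E UNIV. (\<Sum>e\<in>insert e E. f e) \<le> n}" for f
      using that insert.hyps by (auto simp: fun_eq_iff PiE_def extensional_def restrict_def)
  qed
  have "finite ?X" using insert.IH by auto
  moreover have "card ?X = (n + card (insert e E)) choose card (insert e E)"
  proof -
    have "card ?X = (\<Sum>i\<le>n. (i + card E) choose card E)" using insert.IH by (simp add: card_SigmaI)
    also have "\<dots> = (\<Sum>i\<le>n. (card E + i) choose i)"
    proof (rule sum.cong[OF refl])
      fix i
      show "(i + card E) choose card E = (card E + i) choose i"
        using binomial_symmetric[of i "card E + i"] by (simp add: add.commute)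
    qed
    also have "\<dots> = Suc (card E + n) choose n" by (rule sum_choose_lower)
    also have "\<dots> = Suc (card E + n) choose Suc (card E)"
      using binomial_symmetric[of n "Suc (card E + n)"] by simp
    finally show ?thesis using insert.hyps by (simp add: add.commute)
  qed
  ultimately show ?case
    using bij_betw_finite[OF bij] bij_betw_same_card[OF bij] by simp
qed

text \<open>The shift \<open>k\<close> absorbs the bounded distance between powers of the maximal ideal and of its reduction.\<close>

lemma binomial_asymptotics:
  "(\<lambda>n. fact d * real (((n - k) + d) choose d) / real n ^ d) \<longlonglongrightarrow> 1"
proof (induction d)
  case (Suc d)
  have "(\<lambda>n. (real (n - k) + real d + 1) / real n) \<longlonglongrightarrow> 1"
  proof (rule Lim_transform_eventually)
    show "(\<lambda>n. (real n - real k + real d + 1) / real n) \<longlonglongrightarrow> 1" by real_asymp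
    show "eventually (\<lambda>n. (real n - real k + real d + 1) / real n = (real (n - k) + real d + 1) / real n) sequentially"
      using eventually_ge_at_top[of k] by eventually_elim (simp add: of_nat_diff)
  qed
  from tendsto_mult[OF Suc this]
  have "(\<lambda>n. fact d * real (((n - k) + d) choose d) / real n ^ d * ((real (n - k) + real d + 1) / real n)) \<longlonglongrightarrow> 1"
    by simp
  moreover have "fact d * real (((n - k) + d) choose d) / real n ^ d * ((real (n - k) + real d + 1) / real n) =
      fact (Suc d) * real (((n - k) + Suc d) choose Suc d) / real n ^ Suc d" for n
  proof -
    define m where "m = (n - k) + d"
    have eq: "real (Suc m) * real (m choose d) = real (Suc m choose Suc d) * real (Suc d)"
      unfolding of_nat_mult[symmetric] Suc_times_binomial_eq ..
    have "fact d * real (m choose d) / real n ^ d * ((real (n - k) + real d + 1) / real n) =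
        fact d * (real (Suc m) * real (m choose d)) / real n ^ Suc d"
      by (simp add: m_def mult_ac)
    also have "\<dots> = fact (Suc d) * real (Suc m choose Suc d) / real n ^ Suc d"
      unfolding eq fact_Suc by (simp only: mult_ac of_nat_mult)
    finally show ?thesis by (simp only: m_def add_Suc_right)
  qed
  ultimately show ?case by simp
qed simp


context simplicial_monoid
begin

lemma finite_bounded_sum: "finite {f \<in> E \<rightarrow>\<^sub>E (UNIV :: nat set). (\<Sum>e\<in>E. f e) \<le> n}"
  using card_bounded_sum[OF finite_E] by blast

text \<open>By uniqueness of the decomposition, the elements outside are the sums \<open>w + comb f\<close> in which the
  values of \<open>f\<close> add up to at most \<open>n\<close>.\<close>

lemma card_E_power_complement:
  assumes exchange: "\<And>e e' b c. e \<in> E \<Longrightarrow> e' \<in> E \<Longrightarrow> e \<noteq> e' \<Longrightarrow> b \<in> S \<Longrightarrow> c \<in> S \<Longrightarrow> b + e' = c + e \<Longrightarrow>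
      \<exists>x\<in>S. b = x + e"
  shows "finite (S - E_power (Suc n))" "card (S - E_power (Suc n)) = card Ap * ((n + CARD('d)) choose CARD('d))"
proof -
  let ?B = "{f \<in> E \<rightarrow>\<^sub>E (UNIV :: nat set). (\<Sum>e\<in>E. f e) \<le> n}"
  let ?g = "\<lambda>(w, f). w + comb f"
  have comb_restrict: "comb (restrict f E) = comb f" for f by (rule comb_cong) simp
  have bij: "bij_betw ?g (Ap \<times> ?B) (S - E_power (Suc n))"
    unfolding bij_betw_def
  proof
    show "inj_on ?g (Ap \<times> ?B)"
    proof (rule inj_onI)
      fix x y assume x: "x \<in> Ap \<times> ?B" and y: "y \<in> Ap \<times> ?B" and eq: "?g x = ?g y"
      obtain w f w' f' where xy: "x = (w, f)" "y = (w', f')" by (cases x, cases y)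
      have "w = w' \<and> (\<forall>e\<in>E. f e = f' e)"
        by (rule decomposition_unique, fact exchange) (use x y eq xy in auto)
      then show "x = y" using x y xy by (auto intro: PiE_ext)
    qed
    show "?g ` (Ap \<times> ?B) = S - E_power (Suc n)"
    proof
      show "?g ` (Ap \<times> ?B) \<subseteq> S - E_power (Suc n)"
      proof
        fix x assume "x \<in> ?g ` (Ap \<times> ?B)"
        then obtain w f where x: "x = w + comb f" "w \<in> Ap" "(\<Sum>e\<in>E. f e) \<le> n" by auto
        have "x \<notin> E_power (Suc n)"
        proof
          assume "x \<in> E_power (Suc n)"
          then obtain h y where h: "x = comb h + y" "(\<Sum>e\<in>E. h e) = Suc n" "y \<in> S" by (auto simp: E_power_def)
          obtain w' f' where y: "w' \<in> Ap" "y = w' + comb f'" by (rule decompose[OF h(3)])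
          have eq: "w + comb f = w' + comb (\<lambda>e. h e + f' e)"
            using x(1) h(1) y(2) by (simp add: comb_add add_ac)
          have "w = w' \<and> (\<forall>e\<in>E. f e = h e + f' e)"
            by (rule decomposition_unique[OF _ x(2) y(1) eq]) (fact exchange)
          then have "(\<Sum>e\<in>E. f e) = Suc n + (\<Sum>e\<in>E. f' e)" using h(2) by (simp add: sum.distrib)
          then show False using x(3) by simp
        qed
        then show "x \<in> S - E_power (Suc n)" using x(1,2) Ap_S comb_in by (auto intro: add_in)
      qed
      show "S - E_power (Suc n) \<subseteq> ?g ` (Ap \<times> ?B)"
      proof
        fix x assume x: "x \<in> S - E_power (Suc n)"
        then have "x \<in> S" by simp
        then obtain w f where w: "w \<in> Ap" "x = w + comb f" by (rule decompose)
        have "(\<Sum>e\<in>E. f e) \<le> n"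
        proof (rule ccontr)
          assume "\<not> ?thesis"
          then obtain k where k: "(\<Sum>e\<in>E. f e) = k + Suc n" by (metis add.commute le_Suc_ex not_less_eq_eq)
          have "x \<in> E_power (k + Suc n)"
            unfolding E_power_def using w Ap_S k
            by (intro CollectI exI[of _ f] exI[of _ w]) (simp add: add.commute)
          then show False using E_power_antimono[of "Suc n" "k + Suc n"] x by auto
        qed
        then have "(w, restrict f E) \<in> Ap \<times> ?B" using w(1) by simp
        moreover have "x = ?g (w, restrict f E)" using w(2) by (simp add: comb_restrict)
        ultimately show "x \<in> ?g ` (Ap \<times> ?B)" by (simp only: image_eqI)
      qed
    qed
  qed
  have "finite (Ap \<times> ?B)" using finite_Ap finite_bounded_sum by (rule finite_cartesian_product)
  moreover have "card (Ap \<times> ?B) = card Ap * ((n + CARD('d)) choose CARD('d))"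
    using card_bounded_sum[OF finite_E, of n] card_E by (simp add: card_cartesian_product)
  ultimately show "finite (S - E_power (Suc n))" "card (S - E_power (Suc n)) = card Ap * ((n + CARD('d)) choose CARD('d))"
    using bij_betw_finite[OF bij] bij_betw_same_card[OF bij] by simp_all
qed

lemma maximal_ideal_exponents: "S - {0} \<subseteq> S" "(S - {0}) + S \<subseteq> S - {0}"
proof -
  show "(S - {0}) + S \<subseteq> S - {0}"
    unfolding A_plus_S[symmetric] by (simp add: add.assoc plus_S_idem)
qed auto

lemma E_power_subset_fold_sum: "E_power n \<subseteq> fold_sum (S - {0}) n"
proof (induction n)
  case 0
  then show ?case by (simp add: E_power_0)
next
  case (Suc n)
  have "E \<subseteq> S - {0}" using E_S E_nonzero by auto
  then have "E + E_power n \<subseteq> (S - {0}) + fold_sum (S - {0}) n" using Suc by (rule set_plus_mono2)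
  then show ?case by (simp add: E_power_Suc add.commute)
qed

text \<open>The hypothesis is that the monomials of \<open>E\<close> generate a reduction of the maximal ideal: from the exponent
  \<open>n0\<close> on, each further factor can be taken from \<open>E\<close>.\<close>

lemma fold_sum_subset_E_power:
  assumes red: "\<And>n. n0 \<le> n \<Longrightarrow> fold_sum (S - {0}) (Suc n) = (E + S) + fold_sum (S - {0}) n"
  shows "fold_sum (S - {0}) (n0 + n) \<subseteq> E_power n"
proof (induction n)
  case 0
  then show ?case using fold_sum_ideal(1)[OF maximal_ideal_exponents] by (simp add: E_power_0)
next
  case (Suc n)
  have idem: "S + fold_sum (S - {0}) k \<subseteq> fold_sum (S - {0}) k" for k
    using fold_sum_ideal(2)[OF maximal_ideal_exponents, of k] by (simp add: add.commute)
  have "fold_sum (S - {0}) (n0 + Suc n) = E + (S + fold_sum (S - {0}) (n0 + n))"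
    using red[of "n0 + n"] by (simp add: add.assoc del: fold_sum_Suc)
  also have "\<dots> \<subseteq> E + E_power n"
    using subset_trans[OF idem Suc] by (rule set_plus_mono2[OF order_refl])
  finally show ?case by (simp add: E_power_Suc)
qed

text \<open>The powers of \<open>m\<close> are squeezed between powers of the reduction whose exponents differ by a constant, and
  the colengths of the latter are known.\<close>

lemma multiplicity_eq_card_Ap:
  assumes CM: "cohen_macaulay (semigroup_ring S :: ('d, 'k::field) mpoly ring)"
    and red: "\<And>n. n0 \<le> n \<Longrightarrow> fold_sum (S - {0}) (Suc n) = (E + S) + fold_sum (S - {0}) n"
  shows "ring_multiplicity (semigroup_ring S) (supported_on (S - {0}) :: ('d, 'k) mpoly set) = card Ap"
proof -
  let ?m = "supported_on (S - {0}) :: ('d, 'k) mpoly set"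
  let ?M = "fold_sum (S - {0})"
  let ?d = "CARD('d)"
  have exchange: "\<exists>x\<in>S. b = x + e" if "e \<in> E" "e' \<in> E" "e \<noteq> e'" "b \<in> S" "c \<in> S" "b + e' = c + e" for e e' b c
    by (rule cohen_macaulay_exchange[OF CM that])
  have count: "finite (S - E_power (Suc n))" "card (S - E_power (Suc n)) = card Ap * ((n + ?d) choose ?d)" for n
    by (rule card_E_power_complement, fact exchange)+
  have fin: "finite (S - ?M n)" for n
  proof (cases n)
    case (Suc k)
    have "S - ?M n \<subseteq> S - E_power (Suc k)" using E_power_subset_fold_sum Suc by blast
    then show ?thesis using count(1) by (rule finite_subset)
  qed simp
  have length: "module_length (semigroup_ring S) (quotient_module (semigroup_ring S) (ideal_power (semigroup_ring S) ?m n))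
      = enat (card (S - ?M n))" for n
    unfolding ideal_power_supported_on[OF maximal_ideal_exponents]
    by (rule module_length_supported_on[OF fold_sum_ideal[OF maximal_ideal_exponents] fin])
  let ?bd = "\<lambda>j n. real (card Ap) * (fact ?d * real (((n - j) + ?d) choose ?d) / real n ^ ?d)"
  have bd: "?bd j \<longlonglongrightarrow> real (card Ap)" for j
    using tendsto_mult[OF tendsto_const binomial_asymptotics[of ?d j], of "real (card Ap)"] by simp
  have lower: "?bd (Suc n0) n \<le> fact ?d / real n ^ ?d * real (card (S - ?M n))" if n: "n > n0" for n
  proof -
    have "?M n \<subseteq> E_power (Suc (n - Suc n0))"
    proof -
      have "?M (n0 + (n - n0)) \<subseteq> E_power (n - n0)"
        by (rule fold_sum_subset_E_power) (rule red)
      then show ?thesis using n by (simp add: Suc_diff_Suc)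
    qed
    then have "card (S - E_power (Suc (n - Suc n0))) \<le> card (S - ?M n)" using fin by (intro card_mono) auto
    then have "real (card Ap * (((n - Suc n0) + ?d) choose ?d)) \<le> real (card (S - ?M n))"
      unfolding count(2) of_nat_le_iff .
    then have "fact ?d / real n ^ ?d * real (card Ap * (((n - Suc n0) + ?d) choose ?d)) \<le>
        fact ?d / real n ^ ?d * real (card (S - ?M n))"
      by (rule mult_left_mono) simp
    then show ?thesis by (simp add: mult_ac)
  qed
  have upper: "fact ?d / real n ^ ?d * real (card (S - ?M n)) \<le> ?bd 1 n" if n: "n > 0" for n
  proof -
    have "card (S - ?M n) \<le> card (S - E_power (Suc (n - 1)))"
      using E_power_subset_fold_sum[of n] n count(1)[of "n - 1"] by (intro card_mono) auto
    then have "real (card (S - ?M n)) \<le> real (card Ap * (((n - 1) + ?d) choose ?d))"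
      unfolding count(2) of_nat_le_iff .
    then have "fact ?d / real n ^ ?d * real (card (S - ?M n)) \<le>
        fact ?d / real n ^ ?d * real (card Ap * (((n - 1) + ?d) choose ?d))"
      by (rule mult_left_mono) simp
    then show ?thesis by (simp add: mult_ac)
  qed
  have "(\<lambda>n. fact ?d / real n ^ ?d * real (card (S - ?M n))) \<longlonglongrightarrow> real (card Ap)"
  proof (rule tendsto_sandwich[OF _ _ bd bd])
    show "eventually (\<lambda>n. ?bd (Suc n0) n \<le> fact ?d / real n ^ ?d * real (card (S - ?M n))) sequentially"
      using eventually_gt_at_top[of n0] by eventually_elim (rule lower)
    show "eventually (\<lambda>n. fact ?d / real n ^ ?d * real (card (S - ?M n)) \<le> ?bd 1 n) sequentially"
      using eventually_gt_at_top[of 0] by eventually_elim (rule upper)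
  qed
  then show ?thesis
    unfolding ring_multiplicity_def krull_dim_eq Let_def the_enat.simps length by (rule limI)
qed

text \<open>Generators outside \<open>E\<close> and \<open>0\<close> are never divisible by an element of \<open>E\<close>, whereas every other element
  is a sum of two nonzero elements or a member of \<open>E\<close>. So the Apery set has no further elements if and only
  if each sum of two nonzero elements is divisible by an element of \<open>E\<close>; the cofactor is nonzero because
  members of \<open>E\<close> are irreducible.\<close>

lemma Ap_minimal_iff:
  "card Ap = 1 + (card A - card E) \<longleftrightarrow> (E + S) + (S - {0}) = fold_sum (S - {0}) 2"
proof -
  let ?W = "insert 0 (A - E)"
  have A_irr: "a \<noteq> e + y" if "a \<in> A" "e \<in> E" "y \<in> S" "a \<notin> E" for a e y
    using generator_irreducible[OF that(1) E_S[OF that(2)] that(3)] E_nonzero[OF that(2)] that(2,4) by auto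
  have W_sub: "?W \<subseteq> Ap"
  proof
    fix a assume "a \<in> ?W"
    then consider "a = 0" | "a \<in> A" "a \<notin> E" by auto
    then show "a \<in> Ap"
    proof cases
      case 2
      have "a \<noteq> y + e" if "e \<in> E" "y \<in> S" for e y
        using A_irr[OF 2(1) that 2(2)] by (simp add: add.commute)
      then show ?thesis using 2(1) A_subset by (auto simp: apery_set_def)
    qed (simp add: zero_in_Ap)
  qed
  have cardW: "card ?W = 1 + (card A - card E)"
    using finite_A E_subset zero_notin_A finite_E by (simp add: card_Diff_subset)
  have fold2: "fold_sum (S - {0}) 2 = (S - {0}) + (S - {0})"
  proof -
    have "S + (S - {0}) = S - {0}"
      using maximal_ideal_exponents subset_set_plus_S[of "S - {0}"] by (auto simp: add.commute)
    then show ?thesis by (simp add: numeral_2_eq_2)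
  qed
  have ES: "E + S \<subseteq> S - {0}"
    using set_plus_mono2[OF E_subset, of S S] A_plus_S by simp
  have "card Ap = 1 + (card A - card E) \<longleftrightarrow> Ap \<subseteq> ?W"
    using card_subset_eq[OF finite_Ap W_sub] card_mono[OF finite_Ap W_sub] W_sub cardW
    by (metis subset_antisym order_refl)
  also have "\<dots> \<longleftrightarrow> (S - {0}) + (S - {0}) \<subseteq> (E + S) + (S - {0})"
  proof
    assume W: "Ap \<subseteq> ?W"
    show "(S - {0}) + (S - {0}) \<subseteq> (E + S) + (S - {0})"
    proof
      fix x assume "x \<in> (S - {0}) + (S - {0})"
      then obtain b c where bc: "b \<in> S" "b \<noteq> 0" "c \<in> S" "c \<noteq> 0" "x = b + c" by (auto elim!: set_plus_elim)
      have x: "x \<in> S" "x \<notin> A" using bc add_in generator_irreducible[of x b c] by auto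
      have "weight x \<noteq> 0" using bc by simp
      then have "x \<notin> ?W" using x by auto
      then have "x \<notin> Ap" using W by auto
      then obtain e y where ey: "e \<in> E" "y \<in> S" "x = y + e" using x(1) by (auto simp: apery_set_def)
      have "y \<noteq> 0" using ey x(2) E_subset by auto
      then have "(e + 0) + y \<in> (E + S) + (S - {0})"
        using ey by (intro set_plus_intro) auto
      then show "x \<in> (E + S) + (S - {0})" using ey(3) by (simp add: add.commute)
    qed
  next
    assume sub: "(S - {0}) + (S - {0}) \<subseteq> (E + S) + (S - {0})"
    show "Ap \<subseteq> ?W"
    proof
      fix w assume w: "w \<in> Ap"
      show "w \<in> ?W"
      proof (cases "w = 0")
        case False
        then obtain a y where ay: "a \<in> A" "y \<in> S" "w = a + y"
          using nonzero_decompose[OF Ap_S[OF w]] by blast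
        have "y = 0"
        proof (rule ccontr)
          assume "y \<noteq> 0"
          then have "w \<in> (S - {0}) + (S - {0})"
            unfolding ay(3) using ay A_subset zero_notin_A by (intro set_plus_intro) auto
          then have "w \<in> (E + S) + (S - {0})" using sub by auto
          then obtain e z z' where "e \<in> E" "z \<in> S" "z' \<in> S" "w = (e + z) + z'" by (auto elim!: set_plus_elim)
          then show False using Ap_not_sum[OF w, of e "z + z'"] add_in by (simp add: add.assoc)
        qed
        moreover have "a \<notin> E"
          using Ap_not_sum[OF w _ ay(2), of a] ay(3) by blast
        ultimately show ?thesis using ay by simp
      qed simp
    qed
  qed
  also have "\<dots> \<longleftrightarrow> (E + S) + (S - {0}) = (S - {0}) + (S - {0})"
    using set_plus_mono2[OF ES order_refl, of "S - {0}"] by auto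
  finally show ?thesis unfolding fold2 .
qed

end

section \<open>The equivalence\<close>

theorem proposition2p5:
  fixes S :: "(nat ^ 'd) set"
    and a :: "nat \<Rightarrow> nat ^ 'd"
    and s :: nat
    and E :: "(nat ^ 'd) set"
    and R :: "(nat ^ 'd \<Rightarrow>\<^sub>0 'k::field) ring"
    and J m :: "(nat ^ 'd \<Rightarrow>\<^sub>0 'k) set"
  assumes "affine_semigroup S"
    and "fully_embedded S"
    and "simplicial S"
    and "inj_on a {1..CARD('d) + s}"
    and "minimal_generating_set (a ` {1..CARD('d) + s}) S"
    and "a ` {1..CARD('d)} = extremal_elements S"
  defines "E \<equiv> a ` {1..CARD('d)}"
    and "R \<equiv> semigroup_ring S"
    and "J \<equiv> monomial_ideal S E"
    and "m \<equiv> monomial_ideal S (a ` {1..CARD('d) + s})"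
  assumes "cohen_macaulay R"
  shows "(card (apery_set S E) = 1 + codim R m
            \<longleftrightarrow> reduction_ideal R J m \<and> ring_multiplicity R m = real (1 + codim R m))
       \<and> (reduction_ideal R J m \<and> ring_multiplicity R m = real (1 + codim R m)
            \<longleftrightarrow> J \<cdot>\<^bsub>R\<^esub> m = ideal_power R m 2)"
proof -
  define A where "A = a ` {1..CARD('d) + s}"
  have gen: "S = generated_monoid A" using assms(5) by (simp add: minimal_generating_set_def A_def)
  have cardA: "card A = CARD('d) + s" using assms(4) by (simp add: A_def card_image)
  have EA: "E \<subseteq> A" by (auto simp: E_def A_def)
  have "inj_on a {1..CARD('d)}" using assms(4) by (rule inj_on_subset) auto
  then have cardE: "card E = CARD('d)" by (simp add: E_def card_image)
  have E_ext: "E = extremal_elements S" using assms(6) by (simp add: E_def)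
  have finA: "finite A" by (simp add: A_def)
  obtain coord :: "nat ^ 'd \<Rightarrow> nat ^ 'd \<Rightarrow> real" where coord:
    "\<And>e x y. x \<in> S \<Longrightarrow> y \<in> S \<Longrightarrow> coord e (x + y) = coord e x + coord e y"
    "\<And>e x. e \<in> E \<Longrightarrow> x \<in> S \<Longrightarrow> 0 \<le> coord e x"
    "\<And>e e'. e \<in> E \<Longrightarrow> e' \<in> E \<Longrightarrow> coord e e' = (if e = e' then 1 else 0)"
    "\<And>x. x \<in> S \<Longrightarrow> \<forall>e\<in>E. coord e x = 0 \<Longrightarrow> x = 0"
    "\<And>x. x \<in> S \<Longrightarrow> \<exists>k>0. \<exists>f. of_nat k * x = (\<Sum>e\<in>E. of_nat (f e) * e)"
    by (rule simplicial_coordinates[OF finA gen assms(2,3) cardE[unfolded E_ext], folded E_ext]) (rule that)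
  interpret vector_monoid S unfolding gen by (rule vector_monoid_generated)
  interpret minimally_generated S A
    by unfold_locales (use finA assms(5) in \<open>simp_all add: A_def\<close>)
  interpret simplicial_monoid S A E coord
    by unfold_locales (fact EA cardE coord)+
  have m_eq: "m = supported_on (S - {0})"
    unfolding m_def A_def[symmetric] monomial_ideal_eq[OF A_subset] A_plus_S ..
  have E_S: "E \<subseteq> S" using EA A_subset by auto
  have J_eq: "J = supported_on (E + S)"
    unfolding J_def by (rule monomial_ideal_eq[OF E_S])
  have J_exponents: "E + S \<subseteq> S" "(E + S) + S \<subseteq> E + S"
    using set_plus_S[OF E_S] by (simp_all add: add.assoc plus_S_idem)
  have codim: "codim R m = s"
    using embedding_dim_eq[where 'k = 'k] cardA
    unfolding codim_def R_def m_def A_def[symmetric] krull_dim_eq by simp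
  have J_power: "J \<cdot>\<^bsub>R\<^esub> ideal_power R m n = supported_on ((E + S) + fold_sum (S - {0}) n)" for n
    unfolding J_eq m_eq R_def ideal_power_supported_on[OF maximal_ideal_exponents]
    by (rule ideal_prod_supported_on[OF J_exponents fold_sum_ideal[OF maximal_ideal_exponents]])
  have m_power: "ideal_power R m n = supported_on (fold_sum (S - {0}) n)" for n
    unfolding m_eq R_def by (rule ideal_power_supported_on[OF maximal_ideal_exponents])
  have Jm: "J \<cdot>\<^bsub>R\<^esub> m = supported_on ((E + S) + (S - {0}))"
    unfolding J_eq m_eq R_def by (rule ideal_prod_supported_on[OF J_exponents maximal_ideal_exponents])
  have a_iff_c: "card Ap = 1 + codim R m \<longleftrightarrow> J \<cdot>\<^bsub>R\<^esub> m = ideal_power R m 2"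
    using Ap_minimal_iff cardA cardE unfolding Jm m_power supported_on_inject codim by simp
  have red_iff: "reduction_ideal R J m \<longleftrightarrow>
      (\<exists>n0. \<forall>n\<ge>n0. fold_sum (S - {0}) (Suc n) = (E + S) + fold_sum (S - {0}) n)"
  proof -
    have "J \<subseteq> m"
      unfolding J_eq m_eq A_plus_S[symmetric] by (intro supported_on_mono set_plus_mono2 EA order_refl)
    moreover have "ideal J R" unfolding J_eq R_def by (rule ideal_supported_on[OF J_exponents])
    ultimately show ?thesis
      unfolding reduction_ideal_def J_power unfolding m_power supported_on_inject by simp
  qed
  have mult: "ring_multiplicity R m = card Ap" if "reduction_ideal R J m"
  proof -
    obtain n0 where n0: "\<And>n. n0 \<le> n \<Longrightarrow> fold_sum (S - {0}) (Suc n) = (E + S) + fold_sum (S - {0}) n"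
      using \<open>reduction_ideal R J m\<close> red_iff by auto
    show ?thesis
      unfolding m_eq R_def by (rule multiplicity_eq_card_Ap[OF _ n0]) (use assms(11) in \<open>simp_all add: R_def\<close>)
  qed
  have c_red: "reduction_ideal R J m" if "J \<cdot>\<^bsub>R\<^esub> m = ideal_power R m 2"
  proof -
    have two: "fold_sum (S - {0}) 2 = (E + S) + (S - {0})"
      using that unfolding Jm m_power supported_on_inject by simp
    have "fold_sum (S - {0}) (Suc n) = (E + S) + fold_sum (S - {0}) n" if "n \<ge> 1" for n
      using that
    proof (induction n rule: nat_induct_at_least)
      case base
      have "S + (S - {0}) = S - {0}"
        using maximal_ideal_exponents subset_set_plus_S[of "S - {0}"] by (auto simp: add.commute)
      then show ?case using two by (simp add: numeral_2_eq_2)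
    next
      case (Suc n)
      then show ?case by (metis add.assoc fold_sum_Suc)
    qed
    then show ?thesis unfolding red_iff by blast
  qed
  have "real (card Ap) = real (1 + codim R m) \<longleftrightarrow> card Ap = 1 + codim R m"
    by (rule of_nat_eq_iff)
  then show ?thesis using a_iff_c mult c_red by metis
qed

end
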